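(* Let $A$ be a linear operator on a Banach space $X$ with $\sigma(A)\subset\overline{\mathbb C}_+$ such that \[\sup_{\alpha>0}(\alpha+1)\int_{\mathbb R}\big|\langle(\alpha+i\beta+A)^{-2}x,x^*\rangle\big|\,d\beta<\infty\quad\text{for all }x\in X,\ x^*\in X^*.\] Then $\lim_{t\to\infty}\|f(tA)\|=0$ for every $f\in\mathcal B_0$. Consequently there exist constants $M$ and $\omega>0$ such that $\|e^{-tA}\|\le Me^{-\omega t}$ for all $t\ge0$.
   Context: $\mathbb C_+=\{z:\Re z>0\}$. $\mathcal B$ is the Banach algebra of holomorphic $f$ on $\mathbb C_+$ with $\|f\|_{\mathcal B_0}:=\int_0^\infty\sup_{\beta\in\mathbb R}|f'(\alpha+i\beta)|\,d\alpha<\infty$, norm $\|f\|_{\mathcal B}=\sup|f|+\|f\|_{\mathcal B_0}$; $f(\infty):=\lim_{\Re z\to\infty}f(z)$ and $\mathcal B_0=\{f\in\mathcal B:f(\infty)=0\}$. The hypothesis implies (known result) that $A$ is densely defined... more precisely, for $A$ densely defined satisfying the hypothesis, the formula $\langle f(A)x,x^*\rangle=f(\infty)\langle x,x^*\rangle-\frac2\pi\int_0^\infty\alpha\int_{\mathbb R}\langle(\alpha-i\beta+A)^{-2}x,x^*\rangle f'(\alpha+i\beta)\,d\beta\,d\alpha$ defines a bounded algebra homomorphism $f\mapsto f(A)$ from $\mathcal B$ into $L(X)$, $-A$ generates a bounded $C_0$-semigroup $(e^{-tA})_{t\ge0}$ with $e^{-tA}=e_t(A)$ for $e_t(z)=e^{-tz}$,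 and $f(tA):=f_t(A)$ with $f_t(z)=f(tz)$. ($A$ is assumed densely defined, as a standing assumption.) *)

theory Defs
  imports "HOL-Analysis.Analysis"
begin

class complex_banach = banach +
  fixes cscale :: "complex \<Rightarrow> 'a \<Rightarrow> 'a"
  assumes cscale_add_right: "cscale a (x + y) = cscale a x + cscale a y"
    and cscale_add_left: "cscale (a + b) x = cscale a x + cscale b x"
    and cscale_cscale: "cscale a (cscale b x) = cscale (a * b) x"
    and cscale_one: "cscale 1 x = x"
    and cscale_of_real: "cscale (of_real r) x = scaleR r x"
    and norm_cscale: "norm (cscale a x) = cmod a * norm x"

definition dual_space :: "('a::complex_banach \<Rightarrow> complex) set" where
  "dual_space = {\<phi>. bounded_linear \<phi> \<and> (\<forall>c x. \<phi> (cscale c x) = c * \<phi> x)}"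

definition lin_operator :: "'a::complex_banach set \<Rightarrow> ('a \<Rightarrow> 'a) \<Rightarrow> bool" where
  "lin_operator D A \<longleftrightarrow> 0 \<in> D \<and> (\<forall>x\<in>D. \<forall>y\<in>D. x + y \<in> D) \<and> (\<forall>c. \<forall>x\<in>D. cscale c x \<in> D)
     \<and> (\<forall>x\<in>D. \<forall>y\<in>D. A (x + y) = A x + A y) \<and> (\<forall>c. \<forall>x\<in>D. A (cscale c x) = cscale c (A x))"

definition densely_defined :: "'a::complex_banach set \<Rightarrow> bool" where
  "densely_defined D \<longleftrightarrow> closure D = UNIV"

definition resolvent :: "'a::complex_banach set \<Rightarrow> ('a \<Rightarrow> 'a) \<Rightarrow> complex \<Rightarrow> 'a \<Rightarrow> 'a" where
  "resolvent D A z y = (THE x. x \<in> D \<and> cscale z x - A x = y)"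

definition resolvent_set :: "'a::complex_banach set \<Rightarrow> ('a \<Rightarrow> 'a) \<Rightarrow> complex set" where
  "resolvent_set D A = {z. (\<forall>y. \<exists>!x. x \<in> D \<and> cscale z x - A x = y)
                          \<and> bounded_linear (resolvent D A z)}"

definition op_spectrum :: "'a::complex_banach set \<Rightarrow> ('a \<Rightarrow> 'a) \<Rightarrow> complex set" where
  "op_spectrum D A = UNIV - resolvent_set D A"

definition res_plus :: "'a::complex_banach set \<Rightarrow> ('a \<Rightarrow> 'a) \<Rightarrow> complex \<Rightarrow> 'a \<Rightarrow> 'a" where
  "res_plus D A w y = (THE x. x \<in> D \<and> cscale w x + A x = y)"

definition rhp :: "complex set" where
  "rhp = {z. Re z > 0}"

definition B_space :: "(complex \<Rightarrow> complex) set" where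
  "B_space = {f. f holomorphic_on rhp \<and> bounded (f ` rhp)
     \<and> (\<integral>\<^sup>+ \<alpha>. indicator {0<..} \<alpha> * (SUP \<beta>. ennreal (cmod (deriv f (Complex \<alpha> \<beta>)))) \<partial>lborel) < \<infinity>}"

definition val_infty :: "(complex \<Rightarrow> complex) \<Rightarrow> complex" where
  "val_infty f = Lim (filtercomap Re at_top) f"

definition B0_space :: "(complex \<Rightarrow> complex) set" where
  "B0_space = {f \<in> B_space. val_infty f = 0}"

definition B_calc :: "'a::complex_banach set \<Rightarrow> ('a \<Rightarrow> 'a) \<Rightarrow> (complex \<Rightarrow> complex) \<Rightarrow> 'a \<Rightarrow> 'a" where
  "B_calc D A f = (THE T. bounded_linear T \<and> (\<forall>x. \<forall>\<phi>\<in>dual_space.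
      \<phi> (T x) = val_infty f * \<phi> x
        - of_real (2 / pi) * (LINT \<alpha>:{0<..}|lborel. of_real \<alpha> *
             (LINT \<beta>|lborel. \<phi> (res_plus D A (Complex \<alpha> (- \<beta>)) (res_plus D A (Complex \<alpha> (- \<beta>)) x))
                               * deriv f (Complex \<alpha> \<beta>)))))"

end

theory Submission
  imports
    Defs
    "HOL-Complex_Analysis.Complex_Analysis"
    "HOL-Probability.Sinc_Integral"
    "HOL-Real_Asymp.Real_Asymp"
begin

text \<open>
  By the uniform boundedness principle the integral condition becomes a bound
  \<open>C * onorm \<phi> * norm x / (\<alpha> + 1)\<close>, which also bounds the resolvent on the right half-plane. The weak
  formula for \<open>f(A)\<close> then defines a bounded form; on the range of \<open>(1 + A)\<^sup>-\<^sup>2\<close>, the core, it is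
  given by a norm-convergent integral, so by density it comes from an operator on \<open>X\<close>, with
  \<open>\<parallel>f(tA)\<parallel> \<le> const * \<integral> s / (s + t) * sup \<bar>f'(s + i\<beta>)\<bar> ds\<close>, and this tends to \<open>0\<close>. For the exponential
  decay it remains to see that \<open>e\<^sup>-\<^sup>t\<^sup>A\<close> is a semigroup. Up to a factor \<open>2\<pi>\<close>, the operator
  \<open>e\<^sup>-\<^sup>t\<^sup>A (1 + A)\<^sup>-\<^sup>2\<close> is the integral of \<open>e\<^sup>t\<^sup>z (z + A)\<^sup>-\<^sup>1 / (z - 1)\<^sup>2\<close> along any line \<open>Re z = b\<close> with
  \<open>0 < b < 1\<close>, and the product formula follows, as for the Dunford calculus, from the resolvent
  identity and Cauchy's formula on two different lines.
\<close>

section \<open>The Hahn-Banach theorem\<close>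

definition sublinear :: "('a::real_vector \<Rightarrow> real) \<Rightarrow> bool" where
  "sublinear p \<longleftrightarrow> (\<forall>x y. p (x + y) \<le> p x + p y) \<and> (\<forall>c\<ge>0. \<forall>x. p (c *\<^sub>R x) = c * p x)"

lemma sublinear_add: "sublinear p \<Longrightarrow> p (x + y) \<le> p x + p y"
  by (simp add: sublinear_def)

lemma sublinear_scale: "sublinear p \<Longrightarrow> 0 \<le> c \<Longrightarrow> p (c *\<^sub>R x) = c * p x"
  by (simp add: sublinear_def)

lemma sublinear_zero: "sublinear p \<Longrightarrow> p 0 = 0"
  using sublinear_scale[of p 0 0] by simp

lemma sublinear_minus: "sublinear p \<Longrightarrow> - p (- x) \<le> p x"
  using sublinear_add[of p x "- x"] sublinear_zero[of p] by simp

lemma sublinear_norm: "sublinear norm"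
  by (simp add: sublinear_def norm_triangle_ineq)

lemma sublinearI:
  fixes p :: "'a::real_vector \<Rightarrow> real"
  assumes add: "\<And>x y. p (x + y) \<le> p x + p y" and zero: "p 0 = 0"
    and scale_le: "\<And>c x. 0 < c \<Longrightarrow> p (c *\<^sub>R x) \<le> c * p x"
  shows "sublinear p"
  unfolding sublinear_def
proof (intro conjI allI impI add)
  fix c :: real and x :: 'a
  assume "0 \<le> c"
  show "p (c *\<^sub>R x) = c * p x"
  proof (cases "c = 0")
    case False
    with \<open>0 \<le> c\<close> have "0 < c" by simp
    hence "p (inverse c *\<^sub>R (c *\<^sub>R x)) \<le> inverse c * p (c *\<^sub>R x)" by (intro scale_le) simp
    hence "c * p x \<le> p (c *\<^sub>R x)" using \<open>0 < c\<close> by (simp add: field_simps)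
    with scale_le[OF \<open>0 < c\<close>, of x] show ?thesis by simp
  qed (simp add: zero)
qed

lemma sublinear_INF:
  fixes F :: "'i \<Rightarrow> 'a::real_vector \<Rightarrow> real"
  assumes nonempty: "I \<noteq> {}" and bdd: "\<And>x. bdd_below ((\<lambda>i. F i x) ` I)"
    and add: "\<And>i j x y. i \<in> I \<Longrightarrow> j \<in> I \<Longrightarrow> \<exists>k\<in>I. F k (x + y) \<le> F i x + F j y"
    and scale: "\<And>i c x. i \<in> I \<Longrightarrow> 0 < c \<Longrightarrow> \<exists>k\<in>I. F k (c *\<^sub>R x) \<le> c * F i x"
    and zero: "\<And>i. i \<in> I \<Longrightarrow> F i 0 = 0"
  shows "sublinear (\<lambda>x. INF i\<in>I. F i x)"
proof (rule sublinearI)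
  fix x y
  have "(INF k\<in>I. F k (x + y)) - F j y \<le> (INF i\<in>I. F i x)" if "j \<in> I" for j
  proof (rule cINF_greatest[OF nonempty])
    fix i assume "i \<in> I"
    then obtain k where "k \<in> I" "F k (x + y) \<le> F i x + F j y" using add \<open>j \<in> I\<close> by blast
    thus "(INF k\<in>I. F k (x + y)) - F j y \<le> F i x"
      using cINF_lower[OF bdd \<open>k \<in> I\<close>, of "x + y"] by simp
  qed
  hence "(INF k\<in>I. F k (x + y)) - (INF i\<in>I. F i x) \<le> (INF j\<in>I. F j y)"
    by (intro cINF_greatest[OF nonempty]) (simp add: algebra_simps)
  thus "(INF k\<in>I. F k (x + y)) \<le> (INF i\<in>I. F i x) + (INF j\<in>I. F j y)" by simp
next
  have "(INF i\<in>I. F i 0) = (INF i\<in>I. 0)" by (intro INF_cong refl) (simp add: zero)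
  thus "(INF i\<in>I. F i 0) = 0" using nonempty by simp
next
  fix c :: real and x
  assume "0 < c"
  have "(INF k\<in>I. F k (c *\<^sub>R x)) / c \<le> (INF i\<in>I. F i x)"
  proof (rule cINF_greatest[OF nonempty])
    fix i assume "i \<in> I"
    then obtain k where "k \<in> I" "F k (c *\<^sub>R x) \<le> c * F i x" using scale \<open>0 < c\<close> by blast
    hence "(INF k\<in>I. F k (c *\<^sub>R x)) \<le> c * F i x"
      using cINF_lower[OF bdd \<open>k \<in> I\<close>, of "c *\<^sub>R x"] by simp
    thus "(INF k\<in>I. F k (c *\<^sub>R x)) / c \<le> F i x" using \<open>0 < c\<close> by (simp add: field_simps)
  qed
  thus "(INF k\<in>I. F k (c *\<^sub>R x)) \<le> c * (INF i\<in>I. F i x)" using \<open>0 < c\<close> by (simp add: field_simps)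
qed

lemma chain_of_sublinear_lower_bound:
  assumes sub: "\<And>p. p \<in> \<C> \<Longrightarrow> sublinear p" and chain: "\<And>p q. p \<in> \<C> \<Longrightarrow> q \<in> \<C> \<Longrightarrow> p \<le> q \<or> q \<le> p"
    and below: "\<And>p. p \<in> \<C> \<Longrightarrow> p \<le> p\<^sub>0" and p0: "sublinear p\<^sub>0"
  shows "\<exists>m. sublinear m \<and> m \<le> p\<^sub>0 \<and> (\<forall>p\<in>\<C>. m \<le> p)"
proof (cases "\<C> = {}")
  case False
  have bdd: "bdd_below ((\<lambda>p. p x) ` \<C>)" for x
  proof (rule bdd_belowI2)
    fix p assume "p \<in> \<C>"
    hence "- p\<^sub>0 (- x) \<le> - p (- x)" using below by (simp add: le_fun_def)
    also have "\<dots> \<le> p x" using \<open>p \<in> \<C>\<close> by (intro sublinear_minus sub)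
    finally show "- p\<^sub>0 (- x) \<le> p x" .
  qed
  define m where "m = (\<lambda>x. INF p\<in>\<C>. p x)"
  have lower: "m \<le> p" if "p \<in> \<C>" for p
    unfolding m_def le_fun_def using that by (auto intro: cINF_lower[OF bdd])
  have "sublinear m"
    unfolding m_def
  proof (rule sublinear_INF[OF False bdd])
    fix p q x y assume "p \<in> \<C>" "q \<in> \<C>"
    then obtain r where "r \<in> \<C>" "r \<le> p" "r \<le> q" using chain by (metis order_refl)
    hence "r (x + y) \<le> p x + q y"
      using sublinear_add[OF sub[OF \<open>r \<in> \<C>\<close>], of x y] by (smt (verit) le_fun_def)
    thus "\<exists>k\<in>\<C>. k (x + y) \<le> p x + q y" using \<open>r \<in> \<C>\<close> by blast
  qed (use sub in \<open>auto simp: sublinear_zero sublinear_scale intro!: bexI\<close>)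
  moreover obtain p where "p \<in> \<C>" using False by blast
  hence "m \<le> p\<^sub>0" using lower below order.trans by blast
  ultimately show ?thesis using lower by blast
qed (use p0 in auto)

lemma exists_minimal_sublinear:
  fixes p\<^sub>0 :: "'a::real_vector \<Rightarrow> real"
  assumes "sublinear p\<^sub>0"
  shows "\<exists>m. sublinear m \<and> m \<le> p\<^sub>0 \<and> (\<forall>q. sublinear q \<longrightarrow> q \<le> m \<longrightarrow> q = m)"
proof -
  define S where "S = {p. sublinear p \<and> p \<le> p\<^sub>0}"
  have "\<exists>m\<in>S. \<forall>q\<in>S. m \<ge> q \<longrightarrow> q = m"
  proof (rule predicate_Zorn)
    show "partial_order_on S (relation_of (\<ge>) S)"
      by (rule partial_order_on_relation_ofI) auto
    fix \<C> assume "\<C> \<in> Chains (relation_of (\<ge>) S)"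
    hence "\<exists>m. sublinear m \<and> m \<le> p\<^sub>0 \<and> (\<forall>p\<in>\<C>. m \<le> p)"
      by (intro chain_of_sublinear_lower_bound assms) (auto simp: Chains_def relation_of_def S_def)
    thus "\<exists>m\<in>S. \<forall>p\<in>\<C>. p \<ge> m" by (auto simp: S_def)
  qed
  then obtain m where m: "sublinear m" "m \<le> p\<^sub>0" and min: "\<forall>q\<in>S. q \<le> m \<longrightarrow> q = m"
    unfolding S_def by blast
  have "q = m" if "sublinear q" "q \<le> m" for q
    using min that order.trans[OF that(2) m(2)] unfolding S_def by blast
  thus ?thesis using m by blast
qed

definition sublinear_tilt :: "('a::real_vector \<Rightarrow> real) \<Rightarrow> 'a \<Rightarrow> 'a \<Rightarrow> real" where
  "sublinear_tilt p y = (\<lambda>x. INF t\<in>{0..}. p (x + t *\<^sub>R y) - t * p y)"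

lemma
  assumes p: "sublinear p"
  shows sublinear_sublinear_tilt: "sublinear (sublinear_tilt p y)"
    and sublinear_tilt_le: "sublinear_tilt p y \<le> p"
    and sublinear_tilt_minus_le: "sublinear_tilt p y (- y) \<le> - p y"
proof -
  let ?F = "\<lambda>t x. p (x + t *\<^sub>R y) - t * p y"
  have bdd: "bdd_below ((\<lambda>t. ?F t x) ` {0..})" for x
  proof (rule bdd_belowI2)
    fix t :: real assume "t \<in> {0..}"
    hence "t * p y = p ((x + t *\<^sub>R y) + (- x))" using p by (simp add: sublinear_scale)
    also have "\<dots> \<le> p (x + t *\<^sub>R y) + p (- x)" by (rule sublinear_add[OF p])
    finally show "- p (- x) \<le> ?F t x" by simp
  qed
  have lower: "sublinear_tilt p y x \<le> ?F t x" if "0 \<le> t" for t x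
    unfolding sublinear_tilt_def by (rule cINF_lower[OF bdd]) (use that in simp)
  show "sublinear_tilt p y \<le> p" using lower[of 0] by (simp add: le_fun_def)
  show "sublinear_tilt p y (- y) \<le> - p y" using lower[of 1 "- y"] sublinear_zero[OF p] by simp
  show "sublinear (sublinear_tilt p y)"
    unfolding sublinear_tilt_def
  proof (rule sublinear_INF[OF _ bdd])
    show "\<exists>r\<in>{0..}. ?F r (x + z) \<le> ?F s x + ?F t z" if "s \<in> {0..}" "t \<in> {0..}" for s t x z
    proof (rule bexI)
      have "(x + z) + (s + t) *\<^sub>R y = (x + s *\<^sub>R y) + (z + t *\<^sub>R y)" by (simp add: algebra_simps)
      thus "?F (s + t) (x + z) \<le> ?F s x + ?F t z"
        using sublinear_add[OF p, of "x + s *\<^sub>R y" "z + t *\<^sub>R y"] by (simp add: algebra_simps)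
    qed (use that in simp)
    show "\<exists>r\<in>{0..}. ?F r (c *\<^sub>R x) \<le> c * ?F t x" if "t \<in> {0..}" "0 < c" for t c x
    proof (rule bexI)
      have "c *\<^sub>R x + (c * t) *\<^sub>R y = c *\<^sub>R (x + t *\<^sub>R y)" by (simp add: algebra_simps)
      thus "?F (c * t) (c *\<^sub>R x) \<le> c * ?F t x"
        using \<open>0 < c\<close> p by (simp add: sublinear_scale right_diff_distrib mult.assoc)
    qed (use that in simp)
  qed (use p in \<open>auto simp: sublinear_scale\<close>)
qed

lemma minimal_sublinear_imp_linear:
  assumes m: "sublinear m" and min: "\<And>q. sublinear q \<Longrightarrow> q \<le> m \<Longrightarrow> q = m"
  shows "linear m"
proof (rule linearI)
  have minus: "m (- y) = - m y" for y
  proof -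
    have "sublinear_tilt m y = m"
      by (intro min sublinear_sublinear_tilt sublinear_tilt_le m)
    hence "m (- y) \<le> - m y" using sublinear_tilt_minus_le[OF m, of y] by simp
    thus ?thesis using sublinear_minus[OF m, of y] by simp
  qed
  show "m (x + y) = m x + m y" for x y
    using sublinear_add[OF m, of x y] sublinear_add[OF m, of "x + y" "- y"] minus[of y] by simp
  show "m (c *\<^sub>R x) = c *\<^sub>R m x" for c x
  proof (cases "0 \<le> c")
    case False
    have "m (c *\<^sub>R x) = - m ((- c) *\<^sub>R x)" by (simp flip: minus)
    thus ?thesis using False m by (simp only: sublinear_scale) simp
  qed (use m in \<open>simp add: sublinear_scale\<close>)
qed

lemma exists_linear_below_sublinear:
  fixes p :: "'a::real_vector \<Rightarrow> real"
  assumes "sublinear p"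
  shows "\<exists>u. linear u \<and> u \<le> p"
  using exists_minimal_sublinear[OF assms] minimal_sublinear_imp_linear by blast

lemma exists_real_norming_functional:
  fixes x :: "'a::real_normed_vector"
  shows "\<exists>u. bounded_linear u \<and> u x = norm x \<and> onorm u \<le> 1"
proof -
  obtain u where u: "linear u" "u \<le> sublinear_tilt norm x"
    using exists_linear_below_sublinear[OF sublinear_sublinear_tilt[OF sublinear_norm]] by blast
  have upper: "u y \<le> norm y" for y
    using u(2) sublinear_tilt_le[OF sublinear_norm, of x] by (meson le_fun_def order.trans)
  have abs_le: "\<bar>u y\<bar> \<le> norm y" for y
    using upper[of y] upper[of "- y"] linear_neg[OF u(1), of y] by simp
  have "u (- x) \<le> - norm x"
    using u(2) sublinear_tilt_minus_le[OF sublinear_norm, of x] by (meson le_fun_def order.trans)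
  hence "u x = norm x" using upper[of x] linear_neg[OF u(1), of x] by simp
  moreover have "bounded_linear u"
    using u(1) abs_le by (intro bounded_linear_intro[of u 1]) (auto simp: linear_add linear_scale)
  moreover have "onorm u \<le> 1" using abs_le by (intro onorm_bound) auto
  ultimately show ?thesis by blast
qed

section \<open>Complex scalars and the dual space\<close>

lemma cscale_minus_one: "cscale (- 1) x = - x"
  using cscale_of_real[of "- 1" x] by simp

lemma cscale_scaleR: "cscale c (r *\<^sub>R x) = r *\<^sub>R cscale c x"
  by (metis cscale_of_real cscale_cscale mult.commute)

lemma scaleR_cscale: "cscale (r *\<^sub>R c) x = r *\<^sub>R cscale c x"
  by (metis cscale_of_real cscale_cscale scaleR_conv_of_real)

lemma bounded_bilinear_cscale: "bounded_bilinear cscale"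
  by standard
    (auto simp: cscale_add_right cscale_add_left cscale_scaleR scaleR_cscale norm_cscale
       intro!: exI[of _ 1])

interpretation cscale: bounded_bilinear cscale
  by (rule bounded_bilinear_cscale)

lemma cscale_inverse_eq: "c \<noteq> 0 \<Longrightarrow> y = cscale c x \<Longrightarrow> x = cscale (1 / c) y"
  by (simp add: cscale_cscale cscale_one)

lemma cscale_eq_Re_Im: "cscale c x = Re c *\<^sub>R x + Im c *\<^sub>R cscale \<i> x"
  by (metis complex_eq cscale_add_left cscale_cscale cscale_of_real mult.commute)

lemma dual_bounded_linear: "\<phi> \<in> dual_space \<Longrightarrow> bounded_linear \<phi>"
  and dual_cscale: "\<phi> \<in> dual_space \<Longrightarrow> \<phi> (cscale c x) = c * \<phi> x"
  by (auto simp: dual_space_def)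

lemma dual_diff: "\<phi> \<in> dual_space \<Longrightarrow> \<phi> (x - y) = \<phi> x - \<phi> y"
  and dual_scaleR: "\<phi> \<in> dual_space \<Longrightarrow> \<phi> (r *\<^sub>R x) = r *\<^sub>R \<phi> x"
  using dual_bounded_linear[of \<phi>]
  by (auto simp: bounded_linear.linear linear_diff linear_scale)

lemma dual_bound: "\<phi> \<in> dual_space \<Longrightarrow> cmod (\<phi> x) \<le> onorm \<phi> * norm x"
  by (rule onorm[OF dual_bounded_linear])

lemma dual_onorm_nonneg: "\<phi> \<in> dual_space \<Longrightarrow> 0 \<le> onorm \<phi>"
  by (rule onorm_pos_le[OF dual_bounded_linear])

definition complexify :: "('a::complex_banach \<Rightarrow> real) \<Rightarrow> 'a \<Rightarrow> complex" where
  "complexify u x = Complex (u x) (- u (cscale \<i> x))"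

lemma complexify_cscale:
  assumes "linear u"
  shows "complexify u (cscale c x) = c * complexify u x"
proof -
  have "cscale \<i> (cscale c x) = Re c *\<^sub>R cscale \<i> x - Im c *\<^sub>R x"
    by (simp add: cscale_eq_Re_Im[of c] cscale_add_right cscale_scaleR cscale_cscale
        cscale_minus_one)
  thus ?thesis
    using assms
    by (simp add: complexify_def cscale_eq_Re_Im[of c] linear_add linear_diff linear_scale
        complex_eq_iff)
qed

(* Rotate x until the functional is real there; this gives the constant 1. *)
lemma cmod_complexify_le:
  assumes u: "bounded_linear u"
  shows "cmod (complexify u x) \<le> onorm u * norm x"
proof -
  obtain c where c: "cmod c = 1" "c * complexify u x = of_real (cmod (complexify u x))"
  proof (cases "complexify u x = 0")
    case False
    show ?thesis
    proof (rule that)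
      let ?c = "cnj (complexify u x) / of_real (cmod (complexify u x))"
      show "cmod ?c = 1" using False by (simp add: norm_divide)
      have "?c * complexify u x
          = of_real ((cmod (complexify u x))\<^sup>2) / of_real (cmod (complexify u x))"
        by (simp only: complex_norm_square) (simp add: mult.commute)
      thus "?c * complexify u x = of_real (cmod (complexify u x))" by (simp add: power2_eq_square)
    qed
  qed (use that[of 1] in simp)
  have "cmod (complexify u x) = u (cscale c x)"
    using c(2) complexify_cscale[OF bounded_linear.linear[OF u], of c x]
    by (simp add: complexify_def complex_eq_iff)
  also have "\<dots> \<le> onorm u * norm (cscale c x)" using onorm[OF u, of "cscale c x"] by simp
  finally show ?thesis by (simp add: norm_cscale c(1))
qed

lemma
  assumes u: "bounded_linear u"
  shows complexify_in_dual_space: "complexify u \<in> dual_space"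
    and onorm_complexify_le: "onorm (complexify u) \<le> onorm u"
proof -
  interpret u: bounded_linear u by (rule u)
  have "bounded_linear (complexify u)"
    using cmod_complexify_le[OF u]
    by (intro bounded_linear_intro[of _ "onorm u"])
      (auto simp: complexify_def cscale_add_right cscale_scaleR u.add u.scaleR complex_eq_iff
          mult.commute)
  thus "complexify u \<in> dual_space"
    by (simp add: dual_space_def complexify_cscale u.linear_axioms)
  show "onorm (complexify u) \<le> onorm u"
    using cmod_complexify_le[OF u] by (intro onorm_bound onorm_pos_le[OF u])
qed

lemma complexify_Re:
  assumes "\<phi> \<in> dual_space"
  shows "complexify (\<lambda>x. Re (\<phi> x)) = \<phi>"
  using assms by (auto simp: complexify_def fun_eq_iff complex_eq_iff dual_cscale)

lemma exists_dual_norming: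
  fixes x :: "'a::complex_banach"
  shows "\<exists>\<phi>\<in>dual_space. onorm \<phi> \<le> 1 \<and> norm x \<le> cmod (\<phi> x)"
proof -
  obtain u where u: "bounded_linear u" "u x = norm x" "onorm u \<le> 1"
    using exists_real_norming_functional[of x] by blast
  have "norm x \<le> cmod (complexify u x)"
    using abs_Re_le_cmod[of "complexify u x"] u(2) by (simp add: complexify_def)
  thus ?thesis
    using complexify_in_dual_space[OF u(1)] onorm_complexify_le[OF u(1)] u(3)
    by (intro bexI[of _ "complexify u"]) auto
qed

lemma norm_le_by_dual:
  fixes x :: "'a::complex_banach"
  assumes bound: "\<And>\<phi>. \<phi> \<in> dual_space \<Longrightarrow> cmod (\<phi> x) \<le> onorm \<phi> * K" and "0 \<le> K"
  shows "norm x \<le> K"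
proof -
  obtain \<phi> where \<phi>: "\<phi> \<in> dual_space" "onorm \<phi> \<le> 1" "norm x \<le> cmod (\<phi> x)"
    using exists_dual_norming by blast
  have "norm x \<le> onorm \<phi> * K" using \<phi>(3) bound[OF \<phi>(1)] by simp
  also have "\<dots> \<le> 1 * K" using \<phi>(2) \<open>0 \<le> K\<close> by (intro mult_right_mono)
  finally show ?thesis by simp
qed

lemma dual_separates:
  fixes x y :: "'a::complex_banach"
  assumes "\<And>\<phi>. \<phi> \<in> dual_space \<Longrightarrow> \<phi> x = \<phi> y"
  shows "x = y"
  using norm_le_by_dual[of "x - y" 0] assms by (simp add: dual_diff)

section \<open>Uniform boundedness of lower semicontinuous seminorms\<close>

definition lsc_seminorm :: "('b::real_normed_vector \<Rightarrow> ennreal) \<Rightarrow> bool" where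
  "lsc_seminorm P \<longleftrightarrow> (\<forall>x y. P (x + y) \<le> P x + P y) \<and> (\<forall>c x. P (c *\<^sub>R x) = ennreal \<bar>c\<bar> * P x)
     \<and> (\<forall>r. closed {x. P x \<le> r})"

lemma lsc_seminorm_add: "lsc_seminorm P \<Longrightarrow> P (x + y) \<le> P x + P y"
  and lsc_seminorm_scaleR: "lsc_seminorm P \<Longrightarrow> P (c *\<^sub>R x) = ennreal \<bar>c\<bar> * P x"
  and closed_lsc_seminorm_le: "lsc_seminorm P \<Longrightarrow> closed {x. P x \<le> r}"
  by (auto simp: lsc_seminorm_def)

lemma lsc_seminorm_zero: "lsc_seminorm P \<Longrightarrow> P 0 = 0"
  using lsc_seminorm_scaleR[of P 0 0] by simp

lemma lsc_seminorm_SUP: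
  assumes P: "\<And>i. i \<in> I \<Longrightarrow> lsc_seminorm (P i)"
  shows "lsc_seminorm (\<lambda>x. SUP i\<in>I. P i x)"
  unfolding lsc_seminorm_def
proof (intro conjI allI)
  show "(SUP i\<in>I. P i (x + y)) \<le> (SUP i\<in>I. P i x) + (SUP i\<in>I. P i y)" for x y
    by (rule SUP_least) (meson P SUP_upper add_mono lsc_seminorm_add order.trans)
  show "(SUP i\<in>I. P i (c *\<^sub>R x)) = ennreal \<bar>c\<bar> * (SUP i\<in>I. P i x)" for c x
    using P by (simp add: SUP_mult_left_ennreal lsc_seminorm_scaleR)
  have "{x. (SUP i\<in>I. P i x) \<le> r} = (\<Inter>i\<in>I. {x. P i x \<le> r})" for r
    by (auto simp: SUP_le_iff)
  thus "closed {x. (SUP i\<in>I. P i x) \<le> r}" for r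
    using P by (simp add: closed_INT closed_lsc_seminorm_le)
qed

lemma lsc_seminorm_nn_integral:
  fixes f :: "'b::real_normed_vector \<Rightarrow> 'i \<Rightarrow> 'c::{real_normed_vector, second_countable_topology}"
  assumes lin: "\<And>\<omega>. bounded_linear (\<lambda>x. f x \<omega>)" and [measurable]: "\<And>x. f x \<in> borel_measurable M"
  shows "lsc_seminorm (\<lambda>x. \<integral>\<^sup>+ \<omega>. ennreal (norm (f x \<omega>)) \<partial>M)"
  unfolding lsc_seminorm_def
proof (intro conjI allI)
  let ?P = "\<lambda>x. \<integral>\<^sup>+ \<omega>. ennreal (norm (f x \<omega>)) \<partial>M"
  have f_add: "f (x + y) \<omega> = f x \<omega> + f y \<omega>" for x y \<omega>
    by (rule linear_add[OF bounded_linear.linear[OF lin]])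
  have f_scaleR: "f (c *\<^sub>R x) \<omega> = c *\<^sub>R f x \<omega>" for c x \<omega>
    by (rule linear_scale[OF bounded_linear.linear[OF lin]])
  show "?P (x + y) \<le> ?P x + ?P y" for x y
  proof -
    have "?P (x + y) \<le> (\<integral>\<^sup>+ \<omega>. ennreal (norm (f x \<omega>)) + ennreal (norm (f y \<omega>)) \<partial>M)"
      by (intro nn_integral_mono) (simp add: f_add norm_triangle_ineq flip: ennreal_plus)
    thus ?thesis by (simp add: nn_integral_add)
  qed
  show "?P (c *\<^sub>R x) = ennreal \<bar>c\<bar> * ?P x" for c x
    by (simp add: f_scaleR ennreal_mult nn_integral_cmult)
  show "closed {x. ?P x \<le> r}" for r
    unfolding closed_sequential_limits
  proof clarify
    fix X l assume X: "\<forall>n. X n \<in> {x. ?P x \<le> r}" and lim: "X \<longlonglongrightarrow> l"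
    have "ennreal (norm (f l \<omega>)) = liminf (\<lambda>n. ennreal (norm (f (X n) \<omega>)))" for \<omega>
      by (intro lim_imp_Liminf[symmetric] tendsto_ennrealI tendsto_norm
          bounded_linear.tendsto[OF lin] lim)
        simp
    hence "?P l = (\<integral>\<^sup>+ \<omega>. liminf (\<lambda>n. ennreal (norm (f (X n) \<omega>))) \<partial>M)" by simp
    also have "\<dots> \<le> liminf (\<lambda>n. ?P (X n))" by (intro nn_integral_liminf) simp
    also have "\<dots> \<le> r" using X by (intro Liminf_le) auto
    finally show "?P l \<le> r" .
  qed
qed

lemma closed_cover_interior_nonempty:
  fixes F :: "nat \<Rightarrow> 'b::banach set"
  assumes "\<And>n. closed (F n)" and "(\<Union>n. F n) = UNIV"
  shows "\<exists>n. interior (F n) \<noteq> {}"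
proof (rule ccontr)
  assume "\<nexists>n. interior (F n) \<noteq> {}"
  hence "euclidean interior_of \<Union>(range F) = {}"
    using assms(1) completely_metrizable_space_euclidean by (intro Baire_category_alt) auto
  thus False using assms(2) by simp
qed

lemma lsc_seminorm_bounded_if_bounded_on_ball:
  assumes P: "lsc_seminorm P" and "0 < e" "0 \<le> B"
    and ball: "\<And>y. norm y < e \<Longrightarrow> P y \<le> ennreal B"
  shows "P x \<le> ennreal (2 * B / e * norm x)"
proof (cases "x = 0")
  case False
  define r where "r = 2 * norm x / e"
  have "0 < r" using False \<open>0 < e\<close> by (simp add: r_def)
  have "P x = P (r *\<^sub>R (1 / r) *\<^sub>R x)" using \<open>0 < r\<close> by simp
  also have "\<dots> = ennreal r * P ((1 / r) *\<^sub>R x)"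
    unfolding lsc_seminorm_scaleR[OF P, of r] using \<open>0 < r\<close> by simp
  also have "\<dots> \<le> ennreal r * ennreal B"
    using False \<open>0 < e\<close> by (intro mult_left_mono ball) (simp_all add: r_def field_simps)
  also have "\<dots> = ennreal (r * B)" using \<open>0 < r\<close> \<open>0 \<le> B\<close> by (simp add: ennreal_mult)
  finally show ?thesis by (simp add: r_def mult_ac)
qed (simp add: lsc_seminorm_zero[OF P])

lemma lsc_seminorm_bounded:
  fixes P :: "'b::banach \<Rightarrow> ennreal"
  assumes P: "lsc_seminorm P" and fin: "\<And>x. P x < \<infinity>"
  shows "\<exists>C\<ge>0. \<forall>x. P x \<le> ennreal (C * norm x)"
proof -
  have "\<exists>n::nat. P x \<le> of_nat n" for x
    using ennreal_Ex_less_of_nat[of "P x"] fin[of x] by (auto intro: less_imp_le)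
  hence "(\<Union>n::nat. {x. P x \<le> of_nat n}) = UNIV" by auto
  then obtain n :: nat where "interior {x. P x \<le> of_nat n} \<noteq> {}"
    using closed_cover_interior_nonempty[of "\<lambda>n. {x. P x \<le> of_nat n}"] closed_lsc_seminorm_le[OF P]
    by blast
  then obtain x\<^sub>0 e where e: "0 < e" "ball x\<^sub>0 e \<subseteq> {x. P x \<le> of_nat n}"
    by (metis all_not_in_conv mem_interior)
  have "P y \<le> ennreal (2 * real n)" if "norm y < e" for y
  proof -
    have "P y = P ((x\<^sub>0 + y) + (- 1) *\<^sub>R x\<^sub>0)" by simp
    also have "\<dots> \<le> P (x\<^sub>0 + y) + P ((- 1) *\<^sub>R x\<^sub>0)" by (rule lsc_seminorm_add[OF P])
    also have "P ((- 1) *\<^sub>R x\<^sub>0) = P x\<^sub>0" unfolding lsc_seminorm_scaleR[OF P] by simp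
    also have "P (x\<^sub>0 + y) + P x\<^sub>0 \<le> of_nat n + of_nat n"
      using e that by (intro add_mono) (auto simp: subset_iff dist_norm)
    also have "\<dots> = ennreal (2 * real n)"
      by (simp add: ennreal_of_nat_eq_real_of_nat flip: ennreal_plus)
    finally show ?thesis .
  qed
  hence "P x \<le> ennreal (2 * (2 * real n) / e * norm x)" for x
    by (intro lsc_seminorm_bounded_if_bounded_on_ball[OF P e(1)]) auto
  thus ?thesis using e(1) by (intro exI[of _ "2 * (2 * real n) / e"]) auto
qed

lemma separately_lsc_seminorm_bounded:
  fixes P :: "'b::banach \<Rightarrow> 'c::banach \<Rightarrow> ennreal"
  assumes P: "\<And>u. lsc_seminorm (P u)" "\<And>x. lsc_seminorm (\<lambda>u. P u x)" and fin: "\<And>u x. P u x < \<infinity>"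
  shows "\<exists>C\<ge>0. \<forall>u x. P u x \<le> ennreal (C * norm u * norm x)"
proof -
  define Q where "Q u = (SUP x\<in>cball 0 1. P u x)" for u
  have "Q u < \<infinity>" for u
  proof -
    obtain C where C: "C \<ge> 0" "\<And>x. P u x \<le> ennreal (C * norm x)"
      using lsc_seminorm_bounded[OF P(1) fin] by blast
    have "P u x \<le> ennreal C" if "x \<in> cball 0 1" for x
      using C(1) that by (intro order.trans[OF C(2)] ennreal_leI) (simp add: mult_left_le)
    hence "Q u \<le> ennreal C" unfolding Q_def by (rule SUP_least)
    thus ?thesis by (simp add: le_less_trans)
  qed
  moreover have "lsc_seminorm Q" unfolding Q_def by (intro lsc_seminorm_SUP P)
  ultimately obtain C where C: "C \<ge> 0" "\<And>u. Q u \<le> ennreal (C * norm u)"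
    using lsc_seminorm_bounded by blast
  have "P u x \<le> ennreal (C * norm u * norm x)" for u x
  proof (cases "x = 0")
    case False
    have "P u x = P u (norm x *\<^sub>R (1 / norm x) *\<^sub>R x)" using False by simp
    also have "\<dots> = ennreal (norm x) * P u ((1 / norm x) *\<^sub>R x)"
      unfolding lsc_seminorm_scaleR[OF P(1), of u "norm x"] by simp
    also have "P u ((1 / norm x) *\<^sub>R x) \<le> Q u" unfolding Q_def by (intro SUP_upper) simp
    also note C(2)
    also have "ennreal (norm x) * ennreal (C * norm u) = ennreal (C * norm u * norm x)"
      using C(1) by (simp add: mult_ac flip: ennreal_mult)
    finally show ?thesis by (simp add: mult_left_mono)
  qed (simp add: lsc_seminorm_zero[OF P(1)])
  thus ?thesis using C(1) by blast
qed

section \<open>Resolvents on the right half-plane\<close>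

lemma open_rhp: "open rhp"
  unfolding rhp_def by (rule open_halfspace_Re_gt)

(* R z stands for the inverse of z + A, hence the sign in the resolvent identity. *)
locale resolvent_family =
  fixes R :: "complex \<Rightarrow> 'a::complex_banach \<Rightarrow> 'a"
  assumes bounded_linear_R: "0 < Re z \<Longrightarrow> bounded_linear (R z)"
    and R_cscale: "0 < Re z \<Longrightarrow> R z (cscale c x) = cscale c (R z x)"
    and resolvent_identity:
      "0 < Re z \<Longrightarrow> 0 < Re w \<Longrightarrow> R z x - R w x = cscale (w - z) (R z (R w x))"
begin

abbreviation (input) RR :: "complex \<Rightarrow> 'a \<Rightarrow> 'a" where
  "RR z x \<equiv> R z (R z x)"

lemma R_diff: "0 < Re z \<Longrightarrow> R z (x - y) = R z x - R z y"
  by (rule linear_diff[OF bounded_linear.linear[OF bounded_linear_R]])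

lemma R_scaleR: "0 < Re z \<Longrightarrow> R z (r *\<^sub>R x) = r *\<^sub>R R z x"
  by (rule linear_scale[OF bounded_linear.linear[OF bounded_linear_R]])

lemma bounded_linear_RR: "0 < Re z \<Longrightarrow> bounded_linear (\<lambda>x. RR z x)"
  by (rule bounded_linear_compose[OF bounded_linear_R bounded_linear_R])

lemma R_R_eq:
  assumes "0 < Re z" "0 < Re w" "z \<noteq> w"
  shows "R z (R w x) = cscale (1 / (w - z)) (R z x - R w x)"
  using assms by (intro cscale_inverse_eq resolvent_identity) auto

lemma R_commute:
  assumes "0 < Re z" "0 < Re w"
  shows "R z (R w x) = R w (R z x)"
proof (cases "z = w")
  case False
  have "R w (R z x) = cscale (1 / (z - w)) (R w x - R z x)" using assms False by (intro R_R_eq) auto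
  also have "1 / (z - w) = - (1 / (w - z))" using False by (simp add: divide_simps)
  also have "cscale (- (1 / (w - z))) (R w x - R z x) = cscale (1 / (w - z)) (R z x - R w x)"
    by (simp add: cscale.minus_left cscale.diff_right)
  also have "\<dots> = R z (R w x)" using assms False by (intro R_R_eq[symmetric])
  finally show ?thesis by (rule sym)
qed simp

lemma norm_R_near_le:
  assumes z: "0 < Re z" and w: "0 < Re w" and near: "cmod (z - w) * onorm (R z) \<le> 1 / 2"
  shows "norm (R w x) \<le> 2 * onorm (R z) * norm x"
proof -
  have bound: "norm (R z y) \<le> onorm (R z) * norm y" for y by (rule onorm[OF bounded_linear_R[OF z]])
  have "R w x = R z x + cscale (z - w) (R z (R w x))"
    using resolvent_identity[OF w z, of x] R_commute[OF z w, of x] by (simp add: algebra_simps)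
  hence "norm (R w x) \<le> norm (R z x) + cmod (z - w) * norm (R z (R w x))"
    by (metis norm_triangle_ineq norm_cscale)
  also have "\<dots> \<le> onorm (R z) * norm x + cmod (z - w) * (onorm (R z) * norm (R w x))"
    by (intro add_mono mult_left_mono bound) simp
  also have "cmod (z - w) * (onorm (R z) * norm (R w x)) \<le> 1 / 2 * norm (R w x)"
    using near by (metis mult.assoc mult_right_mono norm_ge_zero)
  finally show ?thesis by simp
qed

lemma R_locally_bounded:
  assumes z: "0 < Re z"
  shows "\<exists>K\<ge>0. \<forall>\<^sub>F w in at z within S. 0 < Re w \<and> (\<forall>x. norm (R w x) \<le> K * norm x)"
proof -
  have "((\<lambda>w. cmod (z - w) * onorm (R z)) \<longlongrightarrow> cmod (z - z) * onorm (R z)) (at z within S)"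
    by (intro tendsto_intros)
  hence near: "\<forall>\<^sub>F w in at z within S. cmod (z - w) * onorm (R z) < 1 / 2"
    by (rule order_tendstoD) simp
  have "(Re \<longlongrightarrow> Re z) (at z within S)" by (intro tendsto_intros)
  hence right: "\<forall>\<^sub>F w in at z within S. 0 < Re w" using z by (rule order_tendstoD)
  have "\<forall>\<^sub>F w in at z within S. 0 < Re w \<and> (\<forall>x. norm (R w x) \<le> 2 * onorm (R z) * norm x)"
    using near right
    by eventually_elim (use z in \<open>auto intro: norm_R_near_le\<close>)
  thus ?thesis using onorm_pos_le[OF bounded_linear_R[OF z]]
    by (intro exI[of _ "2 * onorm (R z)"]) auto
qed

lemma tendsto_R:
  assumes z: "0 < Re z" and v: "(v \<longlongrightarrow> y) (at z within S)"
  shows "((\<lambda>w. R w (v w)) \<longlongrightarrow> R z y) (at z within S)"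
proof -
  obtain K where bounded: "\<forall>\<^sub>F w in at z within S. 0 < Re w \<and> (\<forall>x. norm (R w x) \<le> K * norm x)"
    using R_locally_bounded[OF z] by blast
  let ?B = "\<lambda>w. K * norm (v w - y) + cmod (z - w) * (K * norm (R z y))"
  have "((\<lambda>w. R w (v w) - R z y) \<longlongrightarrow> 0) (at z within S)"
  proof (rule Lim_null_comparison)
    show "\<forall>\<^sub>F w in at z within S. norm (R w (v w) - R z y) \<le> ?B w"
      using bounded
    proof eventually_elim
      case (elim w)
      have "R w (v w) - R z y = R w (v w - y) + cscale (z - w) (R w (R z y))"
        using elim resolvent_identity[OF _ z, of w y] by (simp add: R_diff algebra_simps)
      hence "norm (R w (v w) - R z y) \<le> norm (R w (v w - y)) + cmod (z - w) * norm (R w (R z y))"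
        by (metis norm_triangle_ineq norm_cscale)
      also have "\<dots> \<le> ?B w" using elim by (intro add_mono mult_left_mono) auto
      finally show ?case .
    qed
    have "(?B \<longlongrightarrow> K * norm (y - y) + cmod (z - z) * (K * norm (R z y))) (at z within S)"
      by (intro tendsto_intros v)
    thus "(?B \<longlongrightarrow> 0) (at z within S)" by simp
  qed
  thus ?thesis by (simp add: LIM_zero_iff)
qed

lemma continuous_on_R: "continuous_on rhp v \<Longrightarrow> continuous_on rhp (\<lambda>z. R z (v z))"
  unfolding continuous_on_def by (auto simp: rhp_def intro: tendsto_R)

lemma continuous_on_RR: "continuous_on rhp (\<lambda>z. RR z x)"
  by (intro continuous_on_R continuous_on_const)

lemma continuous_on_RR_line:
  assumes "0 < \<alpha>"
  shows "continuous_on UNIV (\<lambda>\<beta>. RR (Complex \<alpha> \<beta>) x)"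
  by (rule continuous_on_compose2[OF continuous_on_RR])
    (auto intro!: continuous_intros simp: rhp_def assms Complex_eq)

lemma R_dual_has_derivative:
  assumes z: "0 < Re z" and \<phi>: "\<phi> \<in> dual_space"
  shows "((\<lambda>w. \<phi> (R w x)) has_field_derivative - \<phi> (RR z x)) (at z)"
  unfolding has_field_derivative_iff
proof (rule Lim_transform_eventually)
  have "((\<lambda>w. \<phi> (R w (R z x))) \<longlongrightarrow> \<phi> (RR z x)) (at z)"
    by (intro bounded_linear.tendsto[OF dual_bounded_linear[OF \<phi>]] tendsto_R z tendsto_const)
  thus "((\<lambda>w. - \<phi> (R w (R z x))) \<longlongrightarrow> - \<phi> (RR z x)) (at z)" by (rule tendsto_minus)
  have "\<forall>\<^sub>F w in at z. w \<in> rhp - {z}"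
    using z by (intro eventually_at_in_open open_rhp) (simp add: rhp_def)
  thus "\<forall>\<^sub>F w in at z. - \<phi> (R w (R z x)) = (\<phi> (R w x) - \<phi> (R z x)) / (w - z)"
  proof eventually_elim
    case (elim w)
    hence w: "0 < Re w" "w \<noteq> z" by (auto simp: rhp_def)
    have "\<phi> (R w x) - \<phi> (R z x) = (z - w) * \<phi> (R w (R z x))"
      using resolvent_identity[OF w(1) z, of x] \<phi> by (metis dual_diff dual_cscale)
    thus ?case using w by (simp add: field_simps)
  qed
qed

lemma holomorphic_R_dual: "\<phi> \<in> dual_space \<Longrightarrow> (\<lambda>w. \<phi> (R w x)) holomorphic_on rhp"
  by (rule holomorphic_onI)
    (auto simp: rhp_def field_differentiable_def
      intro!: exI DERIV_subset[OF R_dual_has_derivative])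

lemma holomorphic_RR_dual:
  assumes "\<phi> \<in> dual_space"
  shows "(\<lambda>w. \<phi> (RR w x)) holomorphic_on rhp"
proof -
  have "(\<lambda>w. - deriv (\<lambda>w. \<phi> (R w x)) w) holomorphic_on rhp"
    by (intro holomorphic_intros holomorphic_deriv holomorphic_R_dual open_rhp assms)
  thus ?thesis
    by (rule holomorphic_transform)
      (use DERIV_imp_deriv[OF R_dual_has_derivative[OF _ assms]] in \<open>auto simp: rhp_def\<close>)
qed

lemma dual_comp_R:
  assumes "0 < Re z" "\<phi> \<in> dual_space"
  shows "(\<lambda>x. \<phi> (R z x)) \<in> dual_space"
  using assms bounded_linear_compose[OF dual_bounded_linear bounded_linear_R]
  by (auto simp: dual_space_def R_cscale)

lemma borel_measurable_RR_line:
  assumes "0 < \<alpha>" "\<phi> \<in> dual_space"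
  shows "(\<lambda>\<beta>. \<phi> (RR (Complex \<alpha> \<beta>) x)) \<in> borel_measurable borel"
  by (intro borel_measurable_continuous_onI bounded_linear.continuous_on[OF dual_bounded_linear]
      continuous_on_RR_line assms)

(* The quantity in the integral condition of Gomilko and Shi-Feng. *)
definition gsf_seminorm :: "('a \<Rightarrow> complex) \<Rightarrow> 'a \<Rightarrow> ennreal" where
  "gsf_seminorm \<phi> x = (SUP \<alpha>\<in>{0<..}. ennreal (\<alpha> + 1) *
     (\<integral>\<^sup>+ \<beta>. ennreal (cmod (\<phi> (RR (Complex \<alpha> \<beta>) x))) \<partial>lborel))"

lemma gsf_seminorm_eq_SUP_nn_integral:
  assumes \<phi>: "\<phi> \<in> dual_space"
  shows "gsf_seminorm \<phi> x =
    (SUP \<alpha>\<in>{0<..}. \<integral>\<^sup>+ \<beta>. ennreal (cmod ((\<alpha> + 1) *\<^sub>R \<phi> (RR (Complex \<alpha> \<beta>) x))) \<partial>lborel)"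
  unfolding gsf_seminorm_def
proof (intro SUP_cong refl)
  fix \<alpha> :: real assume "\<alpha> \<in> {0<..}"
  hence "0 < \<alpha>" by simp
  note [measurable] = borel_measurable_RR_line[OF \<open>0 < \<alpha>\<close> \<phi>]
  show "ennreal (\<alpha> + 1) * (\<integral>\<^sup>+ \<beta>. ennreal (cmod (\<phi> (RR (Complex \<alpha> \<beta>) x))) \<partial>lborel) =
      (\<integral>\<^sup>+ \<beta>. ennreal (cmod ((\<alpha> + 1) *\<^sub>R \<phi> (RR (Complex \<alpha> \<beta>) x))) \<partial>lborel)"
    using \<open>0 < \<alpha>\<close> by (subst nn_integral_cmult[symmetric]) (auto simp: ennreal_mult)
qed

lemma lsc_gsf_seminorm:
  assumes \<phi>: "\<phi> \<in> dual_space"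
  shows "lsc_seminorm (gsf_seminorm \<phi>)"
  unfolding gsf_seminorm_eq_SUP_nn_integral[OF \<phi>]
proof (intro lsc_seminorm_SUP lsc_seminorm_nn_integral)
  fix \<alpha> \<beta> :: real and x assume "\<alpha> \<in> {0<..}"
  thus "(\<lambda>\<beta>. (\<alpha> + 1) *\<^sub>R \<phi> (RR (Complex \<alpha> \<beta>) x)) \<in> borel_measurable lborel"
    using borel_measurable_RR_line[OF _ \<phi>, of \<alpha> x] by simp
  show "bounded_linear (\<lambda>x. (\<alpha> + 1) *\<^sub>R \<phi> (RR (Complex \<alpha> \<beta>) x))"
    using \<open>\<alpha> \<in> {0<..}\<close>
    by (intro bounded_linear_scaleR_right[THEN bounded_linear_compose]
        bounded_linear_compose[OF dual_bounded_linear[OF \<phi>]] bounded_linear_RR) simp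
qed

lemma bounded_linear_complexify_blinfun:
  "bounded_linear (\<lambda>u. complexify (blinfun_apply u) x)"
proof -
  have "bounded_linear
      (\<lambda>u. of_real (blinfun_apply u x) - \<i> * of_real (blinfun_apply u (cscale \<i> x)))"
    by (intro bounded_linear_sub bounded_linear_const_mult blinfun.bounded_linear_left
        bounded_linear_compose[OF bounded_linear_of_real blinfun.bounded_linear_left])
  thus ?thesis by (simp add: complexify_def[abs_def] Complex_eq)
qed

lemma lsc_gsf_seminorm_functional:
  "lsc_seminorm (\<lambda>u. gsf_seminorm (complexify (blinfun_apply u)) x)"
proof -
  have \<phi>: "complexify (blinfun_apply u) \<in> dual_space" for u
    by (rule complexify_in_dual_space[OF blinfun.bounded_linear_right])
  show ?thesis
    unfolding gsf_seminorm_eq_SUP_nn_integral[OF \<phi>]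
  proof (intro lsc_seminorm_SUP lsc_seminorm_nn_integral)
    fix \<alpha> \<beta> :: real and u :: "'a \<Rightarrow>\<^sub>L real" assume "\<alpha> \<in> {0<..}"
    thus "(\<lambda>\<beta>. (\<alpha> + 1) *\<^sub>R complexify (blinfun_apply u) (RR (Complex \<alpha> \<beta>) x))
        \<in> borel_measurable lborel"
      using borel_measurable_RR_line[OF _ \<phi>, of \<alpha> u x] by simp
    show "bounded_linear (\<lambda>u. (\<alpha> + 1) *\<^sub>R complexify (blinfun_apply u) (RR (Complex \<alpha> \<beta>) x))"
      by (intro bounded_linear_scaleR_right[THEN bounded_linear_compose]
          bounded_linear_complexify_blinfun)
  qed
qed

lemma gsf_seminorm_bounded:
  assumes fin: "\<And>\<phi> x. \<phi> \<in> dual_space \<Longrightarrow> gsf_seminorm \<phi> x < \<infinity>"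
  shows "\<exists>C\<ge>0. \<forall>\<phi>\<in>dual_space. \<forall>x. gsf_seminorm \<phi> x \<le> ennreal (C * onorm \<phi> * norm x)"
proof -
  obtain C where C: "C \<ge> 0"
      "\<And>u x. gsf_seminorm (complexify (blinfun_apply u)) x \<le> ennreal (C * norm u * norm x)"
    using separately_lsc_seminorm_bounded[OF lsc_gsf_seminorm lsc_gsf_seminorm_functional]
      fin complexify_in_dual_space[OF blinfun.bounded_linear_right] by metis
  have "gsf_seminorm \<phi> x \<le> ennreal (C * onorm \<phi> * norm x)" if \<phi>: "\<phi> \<in> dual_space" for \<phi> x
  proof -
    have "bounded_linear (\<lambda>x. Re (\<phi> x))"
      by (rule bounded_linear_compose[OF bounded_linear_Re dual_bounded_linear[OF \<phi>]])
    then obtain u where u: "blinfun_apply u = (\<lambda>x. Re (\<phi> x))"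
      using bounded_linear_Blinfun_apply by blast
    have "norm u \<le> onorm \<phi>"
    proof (rule norm_blinfun_bound)
      show "norm (blinfun_apply u x) \<le> onorm \<phi> * norm x" for x
        unfolding u using abs_Re_le_cmod[of "\<phi> x"] dual_bound[OF \<phi>, of x] by simp
    qed (rule dual_onorm_nonneg[OF \<phi>])
    hence "C * norm u * norm x \<le> C * onorm \<phi> * norm x"
      using C(1) by (intro mult_right_mono mult_left_mono) auto
    moreover have "complexify (blinfun_apply u) = \<phi>" by (simp add: u complexify_Re[OF \<phi>])
    ultimately show ?thesis using C(2)[of u x] by (metis ennreal_leI order.trans)
  qed
  thus ?thesis using C(1) by blast
qed

end

section \<open>Uniform resolvent bounds\<close>

lemma integral_bound_of_nn_integral:
  fixes f :: "'b \<Rightarrow> 'c::{banach, second_countable_topology}"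
  assumes f: "f \<in> borel_measurable M" and bound: "(\<integral>\<^sup>+ x. ennreal (norm (f x)) \<partial>M) \<le> ennreal B"
    and "0 \<le> B"
  shows "integrable M f" and "(LINT x|M. norm (f x)) \<le> B" and "norm (LINT x|M. f x) \<le> B"
proof -
  show int: "integrable M f"
    using bound by (intro integrableI_bounded f) (simp add: le_less_trans)
  have "ennreal (LINT x|M. norm (f x)) = (\<integral>\<^sup>+ x. ennreal (norm (f x)) \<partial>M)"
    using int by (intro nn_integral_eq_integral[symmetric] integrable_norm) auto
  thus "(LINT x|M. norm (f x)) \<le> B" using bound \<open>0 \<le> B\<close> by (simp flip: ennreal_le_iff)
  with integral_norm_bound[of M f] show "norm (LINT x|M. f x) \<le> B" by (rule order.trans)
qed

lemma variation_le_nn_integral_deriv: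
  fixes f f' :: "real \<Rightarrow> 'b::euclidean_space"
  assumes der: "\<And>x. (f has_vector_derivative f' x) (at x)" and cont: "continuous_on UNIV f'"
    and bound: "(\<integral>\<^sup>+ x. ennreal (norm (f' x)) \<partial>lborel) \<le> ennreal B" and "0 \<le> B"
  shows "norm (f b - f a) \<le> B"
proof -
  have "f' \<in> borel_measurable lborel"
    using borel_measurable_continuous_onI[OF cont] by simp
  note f' = integral_bound_of_nn_integral[OF this bound \<open>0 \<le> B\<close>]
  have ordered: "norm (f b - f a) \<le> B" if "a \<le> b" for a b
  proof -
    have "(f' has_integral (f b - f a)) {a..b}"
      by (rule fundamental_theorem_of_calculus[OF that has_vector_derivative_at_within[OF der]])
    moreover have set_int: "set_integrable lborel {a..b} f'"
      unfolding set_integrable_def using f'(1) by (intro integrable_mult_indicator) auto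
    ultimately have "f b - f a = (LINT x:{a..b}|lborel. f' x)"
      using set_borel_integral_eq_integral(2)[OF set_int] by (simp add: integral_unique)
    also have "norm \<dots> \<le> (LINT x|lborel. norm (indicator {a..b} x *\<^sub>R f' x))"
      unfolding set_lebesgue_integral_def by (rule integral_norm_bound)
    also have "\<dots> \<le> (LINT x|lborel. norm (f' x))"
      using f'(1) set_int unfolding set_integrable_def
      by (intro integral_mono integrable_norm) (auto simp: indicator_def)
    finally show ?thesis using f'(2) by simp
  qed
  show ?thesis
    using ordered[of a b] ordered[of b a] by (cases "a \<le> b") (auto simp: norm_minus_commute)
qed

lemma has_vector_derivative_vertical_line:
  assumes "(F has_field_derivative D) (at (Complex a b))"
  shows "((\<lambda>b. F (Complex a b)) has_vector_derivative \<i> * D) (at b)"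
proof -
  have "((\<lambda>b. of_real a + \<i> * of_real b) has_vector_derivative \<i>) (at b)"
    by (auto intro!: derivative_eq_intros
        simp: has_vector_derivative_def fun_eq_iff scaleR_conv_of_real mult.commute)
  moreover have "(F has_field_derivative D) (at (of_real a + \<i> * of_real b))"
    using assms by (simp add: Complex_eq)
  ultimately have "((F \<circ> (\<lambda>b. of_real a + \<i> * of_real b)) has_vector_derivative \<i> * D) (at b)"
    by (rule field_vector_diff_chain_at)
  thus ?thesis by (simp add: o_def Complex_eq)
qed

locale gsf_resolvent = resolvent_family R for R :: "complex \<Rightarrow> 'a::complex_banach \<Rightarrow> 'a" +
  fixes C :: real
  assumes C_nonneg: "0 \<le> C"
    and dense_range: "closure (range (R 1)) = UNIV"
    and gsf: "0 < \<alpha> \<Longrightarrow> \<phi> \<in> dual_space \<Longrightarrow>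
      (\<integral>\<^sup>+ \<beta>. ennreal (cmod (\<phi> (RR (Complex \<alpha> \<beta>) x))) \<partial>lborel)
        \<le> ennreal (C * onorm \<phi> * norm x / (\<alpha> + 1))"
begin

lemma R_vertical_variation:
  assumes "0 < \<alpha>" and \<phi>: "\<phi> \<in> dual_space"
  shows "cmod (\<phi> (R (Complex \<alpha> b) x) - \<phi> (R (Complex \<alpha> a) x)) \<le> C * onorm \<phi> * norm x / (\<alpha> + 1)"
proof (rule variation_le_nn_integral_deriv[where f = "\<lambda>\<beta>. \<phi> (R (Complex \<alpha> \<beta>) x)"])
  show "((\<lambda>\<beta>. \<phi> (R (Complex \<alpha> \<beta>) x)) has_vector_derivative
      \<i> * - \<phi> (RR (Complex \<alpha> \<beta>) x)) (at \<beta>)" for \<beta>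
    using \<open>0 < \<alpha>\<close> by (intro has_vector_derivative_vertical_line R_dual_has_derivative \<phi>) simp
  show "continuous_on UNIV (\<lambda>\<beta>. \<i> * - \<phi> (RR (Complex \<alpha> \<beta>) x))"
    by (intro continuous_intros bounded_linear.continuous_on[OF dual_bounded_linear[OF \<phi>]]
        continuous_on_RR_line \<open>0 < \<alpha>\<close>)
  show "(\<integral>\<^sup>+ \<beta>. ennreal (cmod (\<i> * - \<phi> (RR (Complex \<alpha> \<beta>) x))) \<partial>lborel)
      \<le> ennreal (C * onorm \<phi> * norm x / (\<alpha> + 1))"
    using gsf[OF assms, of x] by (simp add: norm_mult)
qed (use \<open>0 < \<alpha>\<close> C_nonneg dual_onorm_nonneg[OF \<phi>] in simp)

lemma R_bounded_on_line:
  assumes "0 < \<alpha>"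
  shows "norm (R (Complex \<alpha> \<beta>) x) \<le> norm (R (Complex \<alpha> 0) x) + C * norm x"
proof (rule norm_le_by_dual)
  fix \<phi> :: "'a \<Rightarrow> complex" assume \<phi>: "\<phi> \<in> dual_space"
  have "C * onorm \<phi> * norm x / (\<alpha> + 1) \<le> C * onorm \<phi> * norm x / 1"
    using \<open>0 < \<alpha>\<close> C_nonneg dual_onorm_nonneg[OF \<phi>] by (intro divide_left_mono) auto
  hence "cmod (\<phi> (R (Complex \<alpha> \<beta>) x)) \<le> cmod (\<phi> (R (Complex \<alpha> 0) x)) + C * onorm \<phi> * norm x"
    using R_vertical_variation[OF \<open>0 < \<alpha>\<close> \<phi>, of \<beta> x 0]
      norm_triangle_ineq2[of "\<phi> (R (Complex \<alpha> \<beta>) x)" "\<phi> (R (Complex \<alpha> 0) x)"] by simp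
  also have "\<dots> \<le> onorm \<phi> * norm (R (Complex \<alpha> 0) x) + C * onorm \<phi> * norm x"
    using dual_bound[OF \<phi>] by simp
  finally show "cmod (\<phi> (R (Complex \<alpha> \<beta>) x)) \<le> onorm \<phi> * (norm (R (Complex \<alpha> 0) x) + C * norm x)"
    by (simp add: algebra_simps)
qed (use C_nonneg in simp)

lemma norm_R_R1:
  assumes "0 < Re z"
  shows "cmod (z - 1) * norm (R z (R 1 x)) = norm (R z x - R 1 x)"
  using assms by (simp add: resolvent_identity norm_cscale norm_minus_commute)

lemma R_R1_tendsto_zero:
  assumes "0 < \<alpha>"
  shows "((\<lambda>\<beta>. R (Complex \<alpha> \<beta>) (R 1 x)) \<longlongrightarrow> 0) at_top"
proof (rule Lim_null_comparison)
  define K where "K = norm (R (Complex \<alpha> 0) x) + C * norm x + norm (R 1 x)"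
  show "\<forall>\<^sub>F \<beta> in at_top. norm (R (Complex \<alpha> \<beta>) (R 1 x)) \<le> K / \<beta>"
    using eventually_gt_at_top[of 0]
  proof eventually_elim
    case (elim \<beta>)
    let ?z = "Complex \<alpha> \<beta>"
    have "\<beta> * norm (R ?z (R 1 x)) \<le> cmod (?z - 1) * norm (R ?z (R 1 x))"
      using abs_Im_le_cmod[of "?z - 1"] by (intro mult_right_mono) auto
    also have "\<dots> = norm (R ?z x - R 1 x)" using \<open>0 < \<alpha>\<close> by (intro norm_R_R1) simp
    also have "\<dots> \<le> K"
      unfolding K_def using R_bounded_on_line[OF \<open>0 < \<alpha>\<close>, of \<beta> x]
      by (meson add_mono norm_triangle_ineq4 order.trans order_refl)
    finally show ?case using elim by (simp add: field_simps)
  qed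
  show "((\<lambda>\<beta>. K / \<beta>) \<longlongrightarrow> 0) at_top" by real_asymp
qed

lemma R_bound:
  assumes z: "0 < Re z"
  shows "norm (R z x) \<le> C / (Re z + 1) * norm x"
proof -
  have on_range: "norm (R z (R 1 y)) \<le> C / (Re z + 1) * norm (R 1 y)" for y
  proof (rule norm_le_by_dual)
    fix \<phi> :: "'a \<Rightarrow> complex" assume \<phi>: "\<phi> \<in> dual_space"
    let ?p = "\<lambda>\<beta>. \<phi> (R (Complex (Re z) \<beta>) (R 1 y))"
    have "(?p \<longlongrightarrow> \<phi> 0) at_top"
      by (intro bounded_linear.tendsto[OF dual_bounded_linear[OF \<phi>]] R_R1_tendsto_zero z)
    hence "((\<lambda>\<beta>. cmod (?p (Im z) - ?p \<beta>)) \<longlongrightarrow> cmod (?p (Im z) - \<phi> 0)) at_top"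
      by (intro tendsto_intros)
    hence "cmod (?p (Im z) - \<phi> 0) \<le> C * onorm \<phi> * norm (R 1 y) / (Re z + 1)"
      by (rule tendsto_upperbound)
        (use R_vertical_variation[OF z \<phi>, of "Im z" "R 1 y"] in \<open>auto intro!: always_eventually\<close>)
    thus "cmod (\<phi> (R z (R 1 y))) \<le> onorm \<phi> * (C / (Re z + 1) * norm (R 1 y))"
      by (simp add: bounded_linear.linear linear_0 dual_bounded_linear \<phi> mult_ac)
  qed (use z C_nonneg in simp)
  have "closure (range (R 1)) \<subseteq> {x. norm (R z x) \<le> C / (Re z + 1) * norm x}"
  proof (rule closure_minimal)
    show "closed {x. norm (R z x) \<le> C / (Re z + 1) * norm x}"
      by (intro closed_Collect_le continuous_intros
          bounded_linear.continuous_on[OF bounded_linear_R[OF z]])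
  qed (use on_range in auto)
  thus ?thesis using dense_range by auto
qed

lemma R_uniform_bound:
  assumes z: "0 < Re z"
  shows "norm (R z x) \<le> C * norm x"
proof -
  have "C / (Re z + 1) \<le> C / 1" using z C_nonneg by (intro divide_left_mono) auto
  thus ?thesis using R_bound[OF z, of x] by (smt (verit) div_by_1 mult_right_mono norm_ge_zero)
qed

lemma R_R1_decay:
  assumes z: "0 < Re z"
  shows "norm (R z (R 1 x)) \<le> 2 * C * (C + 1) * norm x / (1 + cmod z)"
proof -
  let ?n = "norm (R z (R 1 x))"
  have "?n \<le> C * norm (R 1 x)" by (rule R_uniform_bound[OF z])
  also have "\<dots> \<le> C * (C * norm x)" using C_nonneg by (intro mult_left_mono R_uniform_bound) auto
  finally have small: "?n \<le> C * (C * norm x)" .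
  have "cmod (z - 1) * ?n \<le> norm (R z x) + norm (R 1 x)"
    unfolding norm_R_R1[OF z] by (rule norm_triangle_ineq4)
  also have "\<dots> \<le> 2 * (C * norm x)"
    using R_uniform_bound[OF z, of x] R_uniform_bound[of 1 x] by simp
  finally have far: "cmod (z - 1) * ?n \<le> 2 * (C * norm x)" .
  have "(1 + cmod z) * ?n \<le> (2 + cmod (z - 1)) * ?n"
    using norm_triangle_ineq2[of z 1] by (intro mult_right_mono) auto
  also have "\<dots> \<le> 2 * C * (C + 1) * norm x" using small far by (simp add: algebra_simps)
  finally show ?thesis by (simp add: field_simps add_pos_nonneg)
qed

definition core_bound :: real where
  "core_bound = (2 * C * (C + 1))\<^sup>2"

lemma core_bound_nonneg: "0 \<le> core_bound"
  by (simp add: core_bound_def)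

lemma RR_core_decay:
  assumes z: "0 < Re z"
  shows "norm (RR z (RR 1 x)) \<le> core_bound * norm x / (1 + cmod z)\<^sup>2"
proof -
  have "RR z (RR 1 x) = R z (R 1 (R z (R 1 x)))"
    using z by (subst R_commute[of z 1 "R 1 x"]) auto
  also have "norm \<dots> \<le> 2 * C * (C + 1) * norm (R z (R 1 x)) / (1 + cmod z)"
    by (rule R_R1_decay[OF z])
  also have "\<dots> \<le> 2 * C * (C + 1) * (2 * C * (C + 1) * norm x / (1 + cmod z)) / (1 + cmod z)"
    using C_nonneg by (intro divide_right_mono mult_left_mono R_R1_decay z) auto
  finally show ?thesis by (simp add: core_bound_def power2_eq_square)
qed

lemma closure_R1_image:
  assumes "closure S = UNIV"
  shows "closure (R 1 ` S) = UNIV"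
proof -
  have "R 1 ` closure S \<subseteq> closure (R 1 ` S)"
    by (intro image_closure_subset)
      (auto intro: bounded_linear.continuous_on[OF bounded_linear_R] closure_subset[THEN subsetD])
  hence "range (R 1) \<subseteq> closure (R 1 ` S)" using assms by simp
  hence "closure (range (R 1)) \<subseteq> closure (R 1 ` S)" by (rule closure_minimal) simp
  thus ?thesis using dense_range by auto
qed

lemma dense_range_RR1: "closure (range (\<lambda>x. RR 1 x)) = UNIV"
  using closure_R1_image[OF dense_range] by (simp add: image_comp o_def)

lemma dense_range_RR1_RR1: "closure (range (\<lambda>x. RR 1 (RR 1 x))) = UNIV"
  using closure_R1_image[OF closure_R1_image[OF dense_range_RR1]] by (simp add: image_comp o_def)

end

section \<open>Weakly represented operators and weak integrals\<close>

lemma weakly_represented_closure: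
  fixes J :: "('a::complex_banach \<Rightarrow> complex) \<Rightarrow> 'a \<Rightarrow> complex"
  assumes diff: "\<And>\<phi> x y. \<phi> \<in> dual_space \<Longrightarrow> J \<phi> (x - y) = J \<phi> x - J \<phi> y"
    and bound: "\<And>\<phi> x. \<phi> \<in> dual_space \<Longrightarrow> cmod (J \<phi> x) \<le> onorm \<phi> * (K * norm x)" and "0 \<le> K"
    and repr: "\<And>x. x \<in> S \<Longrightarrow> \<exists>v. \<forall>\<phi>\<in>dual_space. \<phi> v = J \<phi> x"
    and "x \<in> closure S"
  shows "\<exists>v. \<forall>\<phi>\<in>dual_space. \<phi> v = J \<phi> x"
proof -
  obtain s where s: "\<And>k. s k \<in> S" "s \<longlonglongrightarrow> x" using \<open>x \<in> closure S\<close> by (metis closure_sequential)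
  obtain v where v: "\<And>k \<phi>. \<phi> \<in> dual_space \<Longrightarrow> \<phi> (v k) = J \<phi> (s k)"
    using repr[OF s(1)] by metis
  have norm_diff_le: "norm (v k - v l) \<le> K * norm (s k - s l)" for k l
    using v bound[of _ "s k - s l"] \<open>0 \<le> K\<close> by (intro norm_le_by_dual) (auto simp: dual_diff diff)
  have "Cauchy v"
  proof (rule metric_CauchyI)
    fix e :: real assume "0 < e"
    hence "0 < e / (K + 1)" using \<open>0 \<le> K\<close> by simp
    then obtain M where M: "\<And>m n. M \<le> m \<Longrightarrow> M \<le> n \<Longrightarrow> norm (s m - s n) < e / (K + 1)"
      using LIMSEQ_imp_Cauchy[OF s(2)] unfolding Cauchy_def dist_norm by blast
    have "dist (v m) (v n) < e" if "M \<le> m" "M \<le> n" for m n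
    proof -
      have "K * norm (s m - s n) \<le> (K + 1) * norm (s m - s n)" by (simp add: algebra_simps)
      also have "\<dots> < e" using M[OF that] \<open>0 \<le> K\<close> by (simp add: field_simps)
      finally show ?thesis using norm_diff_le[of m n] by (simp add: dist_norm)
    qed
    thus "\<exists>M. \<forall>m\<ge>M. \<forall>n\<ge>M. dist (v m) (v n) < e" by blast
  qed
  then obtain w where w: "v \<longlonglongrightarrow> w" using Cauchy_convergent convergent_def by blast
  have "\<phi> w = J \<phi> x" if \<phi>: "\<phi> \<in> dual_space" for \<phi>
  proof (rule LIMSEQ_unique)
    show "(\<lambda>k. \<phi> (v k)) \<longlonglongrightarrow> \<phi> w"
      by (rule bounded_linear.tendsto[OF dual_bounded_linear[OF \<phi>] w])
    have "(\<lambda>k. J \<phi> (s k) - J \<phi> x) \<longlonglongrightarrow> 0"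
    proof (rule Lim_null_comparison)
      show "\<forall>\<^sub>F k in sequentially. cmod (J \<phi> (s k) - J \<phi> x) \<le> onorm \<phi> * (K * norm (s k - x))"
        using bound[OF \<phi>] by (simp add: diff[OF \<phi>, symmetric])
      have "(\<lambda>k. onorm \<phi> * (K * norm (s k - x))) \<longlonglongrightarrow> onorm \<phi> * (K * norm (x - x))"
        by (intro tendsto_intros s(2))
      thus "(\<lambda>k. onorm \<phi> * (K * norm (s k - x))) \<longlonglongrightarrow> 0" by simp
    qed
    thus "(\<lambda>k. \<phi> (v k)) \<longlonglongrightarrow> J \<phi> x" by (simp add: v[OF \<phi>] LIM_zero_iff)
  qed
  thus ?thesis by blast
qed

lemma exists_weakly_represented_operator:
  fixes J :: "('a::complex_banach \<Rightarrow> complex) \<Rightarrow> 'a \<Rightarrow> complex"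
  assumes diff: "\<And>\<phi> x y. \<phi> \<in> dual_space \<Longrightarrow> J \<phi> (x - y) = J \<phi> x - J \<phi> y"
    and scale: "\<And>\<phi> r x. \<phi> \<in> dual_space \<Longrightarrow> J \<phi> (r *\<^sub>R x) = r *\<^sub>R J \<phi> x"
    and bound: "\<And>\<phi> x. \<phi> \<in> dual_space \<Longrightarrow> cmod (J \<phi> x) \<le> onorm \<phi> * (K * norm x)" and "0 \<le> K"
    and repr: "\<And>x. x \<in> S \<Longrightarrow> \<exists>v. \<forall>\<phi>\<in>dual_space. \<phi> v = J \<phi> x"
    and dense: "closure S = UNIV"
  shows "\<exists>T. bounded_linear T \<and> (\<forall>x. \<forall>\<phi>\<in>dual_space. \<phi> (T x) = J \<phi> x) \<and> onorm T \<le> K"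
proof -
  have "\<exists>v. \<forall>\<phi>\<in>dual_space. \<phi> v = J \<phi> x" for x
    by (rule weakly_represented_closure[OF diff bound \<open>0 \<le> K\<close> repr]) (use dense in auto)
  then obtain T where T: "\<And>x \<phi>. \<phi> \<in> dual_space \<Longrightarrow> \<phi> (T x) = J \<phi> x" by metis
  have T_bound: "norm (T x) \<le> K * norm x" for x
    using T bound \<open>0 \<le> K\<close> by (intro norm_le_by_dual) auto
  have T_diff: "T (x - y) = T x - T y" for x y
    by (rule dual_separates) (simp add: T dual_diff diff)
  have T_scale: "T (r *\<^sub>R x) = r *\<^sub>R T x" for r x
    by (rule dual_separates) (simp add: T dual_scaleR scale)
  have "T (x + y) = T x + T y" for x y
    using T_diff[of x "- y"] T_scale[of "- 1" y] by simp
  hence "bounded_linear T"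
    using T_scale T_bound by (intro bounded_linear_intro[of T K]) (auto simp: mult_ac)
  moreover have "onorm T \<le> K" using T_bound \<open>0 \<le> K\<close> by (intro onorm_bound)
  ultimately show ?thesis using T by blast
qed

(* A limit of gauge integrals, because the Bochner integral needs a second countable range. *)
lemma integral_exhaustion_convergent:
  fixes H :: "'e::euclidean_space \<Rightarrow> 'a::banach"
  assumes Q: "incseq Q" "\<And>n. Q n \<in> sets lborel" and H: "\<And>n. H integrable_on Q n"
    and abs: "set_integrable lborel (\<Union>n. Q n) (\<lambda>p. norm (H p))"
  shows "convergent (\<lambda>n. integral (Q n) H)"
proof -
  define J where "J n = (LINT p:Q n|lborel. norm (H p))" for n
  have set_int: "set_integrable lborel (Q n) (\<lambda>p. norm (H p))" for n
    using abs by (rule set_integrable_subset) (use Q(2) in auto)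
  have increment: "norm (integral (Q n) H - integral (Q m) H) \<le> J n - J m" if "m \<le> n" for m n
  proof -
    have "Q m \<subseteq> Q n" using Q(1) that by (simp add: incseq_def)
    hence negl: "negligible (Q m - Q n)" by simp
    note norm_int = set_borel_integral_eq_integral[OF set_int]
    note setdiff = integrable_setdiff[OF integrable_integral integrable_integral negl]
    have "norm (integral (Q n - Q m) H) \<le> integral (Q n - Q m) (\<lambda>p. norm (H p))"
      by (intro integral_norm_bound_integral setdiff H norm_int) simp
    thus ?thesis
      by (simp add: J_def integral_setdiff[OF _ _ negl] H norm_int)
  qed
  have dist_le: "dist (integral (Q m) H) (integral (Q n) H) \<le> dist (J m) (J n)" for m n
    using increment[of m n] increment[of n m]
    by (cases "m \<le> n") (auto simp: dist_norm norm_minus_commute)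
  have "J \<longlonglongrightarrow> (LINT p:(\<Union>n. Q n)|lborel. norm (H p))"
    unfolding J_def by (intro set_integral_cont_up Q abs)
  hence "Cauchy J" by (rule LIMSEQ_imp_Cauchy)
  hence "Cauchy (\<lambda>n. integral (Q n) H)"
    unfolding Cauchy_def by (meson dist_le le_less_trans)
  thus ?thesis by (rule Cauchy_convergent)
qed

lemma exists_weak_integral:
  fixes H :: "'e::euclidean_space \<Rightarrow> 'a::banach"
  assumes Q: "incseq Q" "\<And>n. Q n \<in> sets lborel" and H: "\<And>n. H integrable_on Q n"
    and abs: "set_integrable lborel (\<Union>n. Q n) (\<lambda>p. norm (H p))"
  shows "\<exists>v. \<forall>\<psi> :: 'a \<Rightarrow> 'b::euclidean_space. bounded_linear \<psi> \<longrightarrow>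
    set_integrable lborel (\<Union>n. Q n) (\<lambda>p. \<psi> (H p)) \<longrightarrow> \<psi> v = (LINT p:(\<Union>n. Q n)|lborel. \<psi> (H p))"
proof -
  obtain v where v: "(\<lambda>n. integral (Q n) H) \<longlonglongrightarrow> v"
    using integral_exhaustion_convergent[OF assms] unfolding convergent_def by blast
  have "\<psi> v = (LINT p:(\<Union>n. Q n)|lborel. \<psi> (H p))"
    if \<psi>: "bounded_linear \<psi>" and int: "set_integrable lborel (\<Union>n. Q n) (\<lambda>p. \<psi> (H p))"
    for \<psi> :: "'a \<Rightarrow> 'b"
  proof (rule LIMSEQ_unique)
    have "set_integrable lborel (Q n) (\<lambda>p. \<psi> (H p))" for n
      using int by (rule set_integrable_subset) (use Q(2) in auto)
    hence "(LINT p:Q n|lborel. \<psi> (H p)) = \<psi> (integral (Q n) H)" for n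
      using integral_linear[OF H \<psi>, of n] by (simp add: set_borel_integral_eq_integral o_def)
    thus "(\<lambda>n. LINT p:Q n|lborel. \<psi> (H p)) \<longlonglongrightarrow> \<psi> v"
      using bounded_linear.tendsto[OF \<psi> v] by simp
    show "(\<lambda>n. LINT p:Q n|lborel. \<psi> (H p)) \<longlonglongrightarrow> (LINT p:(\<Union>n. Q n)|lborel. \<psi> (H p))"
      by (intro set_integral_cont_up Q int)
  qed
  thus ?thesis by blast
qed

section \<open>The weak formula and its representing operator\<close>

lemma nn_integral_reflect:
  fixes f :: "real \<Rightarrow> ennreal"
  assumes "f \<in> borel_measurable borel"
  shows "(\<integral>\<^sup>+ x. f (- x) \<partial>lborel) = (\<integral>\<^sup>+ x. f x \<partial>lborel)"
  using nn_integral_real_affine[OF assms, of "- 1" 0] by simp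

lemma has_bochner_integral_poisson_kernel:
  assumes "0 < a"
  shows "has_bochner_integral lborel (\<lambda>x::real. a / (a\<^sup>2 + x\<^sup>2)) pi"
proof -
  have "has_bochner_integral lborel (\<lambda>x::real. inverse (1 + x\<^sup>2)) pi"
    using integrable_inverse_1_plus_square LBINT_inverse_1_plus_square
    by (simp add: has_bochner_integral_iff set_integrable_def interval_lebesgue_integral_def
        set_lebesgue_integral_def)
  hence "has_bochner_integral lborel (\<lambda>x. inverse (1 + (0 + inverse a * x)\<^sup>2)) (pi /\<^sub>R \<bar>inverse a\<bar>)"
    using assms by (subst lborel_has_bochner_integral_real_affine_iff[symmetric]) auto
  hence "has_bochner_integral lborel (\<lambda>x. inverse a * inverse (1 + (0 + inverse a * x)\<^sup>2))
      (inverse a * (pi /\<^sub>R \<bar>inverse a\<bar>))"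
    by (rule has_bochner_integral_mult_right)
  moreover have "inverse a * inverse (1 + (0 + inverse a * x)\<^sup>2) = a / (a\<^sup>2 + x\<^sup>2)" for x
    using assms by (simp add: field_simps power2_eq_square add_pos_nonneg)
  ultimately show ?thesis using assms by (simp flip: mult.assoc)
qed

lemma nn_integral_poisson_kernel:
  assumes "0 < a"
  shows "(\<integral>\<^sup>+ x. ennreal (a / (a\<^sup>2 + x\<^sup>2)) \<partial>lborel) = ennreal pi"
  using has_bochner_integral_poisson_kernel[OF assms] assms
  by (simp add: has_bochner_integral_iff nn_integral_eq_integral)

abbreviation (input) half_plane :: "(real \<times> real) set" where
  "half_plane \<equiv> {0<..} \<times> UNIV"

lemma sets_half_plane [measurable]: "half_plane \<in> sets borel"
  by (intro borel_open open_Times) auto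

definition half_plane_box :: "nat \<Rightarrow> (real \<times> real) set" where
  "half_plane_box n = cbox (1 / real (Suc n), - real (Suc n)) (real (Suc n), real (Suc n))"

lemma incseq_half_plane_box: "incseq half_plane_box"
proof (rule incseq_SucI)
  have "1 / real (Suc (Suc n)) \<le> 1 / real (Suc n)" for n by (simp add: frac_le)
  thus "half_plane_box n \<subseteq> half_plane_box (Suc n)" for n
    unfolding half_plane_box_def cbox_Pair_eq by (intro Sigma_mono) (auto intro: order.trans)
qed

lemma Union_half_plane_box: "(\<Union>n. half_plane_box n) = half_plane"
proof (intro equalityI subsetI)
  fix p assume "p \<in> (\<Union>n. half_plane_box n)"
  then obtain n where "1 / real (Suc n) \<le> fst p" by (auto simp: half_plane_box_def cbox_Pair_eq)
  moreover have "0 < 1 / real (Suc n)" by simp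
  ultimately have "0 < fst p" by linarith
  thus "p \<in> half_plane" by (cases p) auto
next
  fix p :: "real \<times> real" assume "p \<in> half_plane"
  hence "0 < fst p" by auto
  obtain n :: nat where n: "max (fst p) (max \<bar>snd p\<bar> (1 / fst p)) \<le> real n"
    using real_arch_simple by blast
  hence "1 / fst p \<le> real (Suc n)" by simp
  hence "1 / real (Suc n) \<le> fst p" using \<open>0 < fst p\<close> by (simp add: field_simps)
  hence "p \<in> half_plane_box n" using n by (cases p) (auto simp: half_plane_box_def cbox_Pair_eq)
  thus "p \<in> (\<Union>n. half_plane_box n)" by blast
qed

definition deriv_sup :: "(complex \<Rightarrow> complex) \<Rightarrow> real \<Rightarrow> ennreal" where
  "deriv_sup f \<alpha> = (SUP \<beta>. ennreal (cmod (deriv f (Complex \<alpha> \<beta>))))"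

definition B0_norm :: "(complex \<Rightarrow> complex) \<Rightarrow> ennreal" where
  "B0_norm f = (\<integral>\<^sup>+ \<alpha>. indicator {0<..} \<alpha> * deriv_sup f \<alpha> \<partial>lborel)"

definition weighted_B0_norm :: "real \<Rightarrow> (complex \<Rightarrow> complex) \<Rightarrow> ennreal" where
  "weighted_B0_norm t f =
     (\<integral>\<^sup>+ \<alpha>. ennreal (\<alpha> / (\<alpha> + t)) * (indicator {0<..} \<alpha> * deriv_sup f \<alpha>) \<partial>lborel)"

lemma deriv_sup_upper: "ennreal (cmod (deriv f (Complex \<alpha> \<beta>))) \<le> deriv_sup f \<alpha>"
  unfolding deriv_sup_def by (rule SUP_upper) simp

lemma continuous_on_deriv_rhp: "f holomorphic_on rhp \<Longrightarrow> continuous_on rhp (deriv f)"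
  by (intro holomorphic_on_imp_continuous_on holomorphic_deriv open_rhp)

lemma continuous_on_deriv_half_plane:
  "f holomorphic_on rhp \<Longrightarrow> continuous_on half_plane (\<lambda>p. deriv f (Complex (fst p) (snd p)))"
  by (rule continuous_on_compose2[OF continuous_on_deriv_rhp])
    (auto intro!: continuous_intros simp: rhp_def Complex_eq)

lemma borel_measurable_deriv_half_plane:
  "f holomorphic_on rhp \<Longrightarrow>
    (\<lambda>p. indicator half_plane p *\<^sub>R deriv f (Complex (fst p) (snd p))) \<in> borel_measurable borel"
  by (intro borel_measurable_continuous_on_indicator continuous_on_deriv_half_plane sets_half_plane)

lemma deriv_sup_eq_SUP_Rats:
  assumes f: "f holomorphic_on rhp" and "0 < \<alpha>"
  shows "deriv_sup f \<alpha> = (SUP \<beta>\<in>\<rat>. ennreal (cmod (deriv f (Complex \<alpha> \<beta>))))"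
proof (rule antisym)
  let ?c = "SUP \<beta>\<in>\<rat>. ennreal (cmod (deriv f (Complex \<alpha> \<beta>)))"
  have "continuous_on UNIV (\<lambda>\<beta>. ennreal (cmod (deriv f (Complex \<alpha> \<beta>))))"
    by (intro continuous_on_ennreal continuous_on_norm
        continuous_on_compose2[OF continuous_on_deriv_rhp[OF f]])
      (auto intro!: continuous_intros simp: rhp_def \<open>0 < \<alpha>\<close> Complex_eq)
  hence "closure \<rat> \<subseteq> {\<beta>. ennreal (cmod (deriv f (Complex \<alpha> \<beta>))) \<le> ?c}"
    by (intro closure_minimal closed_Collect_le continuous_on_const) (auto intro: SUP_upper)
  thus "deriv_sup f \<alpha> \<le> ?c"
    unfolding deriv_sup_def Rats_closure_real by (intro SUP_least) auto
  show "?c \<le> deriv_sup f \<alpha>" by (intro SUP_least deriv_sup_upper)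
qed

lemma borel_measurable_deriv_sup:
  assumes f: "f holomorphic_on rhp"
  shows "(\<lambda>\<alpha>. indicator {0<..} \<alpha> * deriv_sup f \<alpha>) \<in> borel_measurable borel"
proof -
  have "(\<lambda>\<alpha>. indicator {0<..} \<alpha> *\<^sub>R deriv f (Complex \<alpha> \<beta>)) \<in> borel_measurable borel" for \<beta>
    by (rule borel_measurable_continuous_on_indicator)
      (auto intro!: continuous_on_compose2[OF continuous_on_deriv_rhp[OF f]] continuous_intros
        simp: rhp_def Complex_eq)
  hence "(\<lambda>\<alpha>. SUP \<beta>\<in>\<rat>. ennreal (cmod (indicator {0<..} \<alpha> *\<^sub>R deriv f (Complex \<alpha> \<beta>))))
      \<in> borel_measurable borel"
    by (intro borel_measurable_SUP countable_rat measurable_compose[OF _ measurable_ennreal]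
        measurable_compose[OF _ borel_measurable_norm])
  also have "(\<lambda>\<alpha>. SUP \<beta>\<in>\<rat>. ennreal (cmod (indicator {0<..} \<alpha> *\<^sub>R deriv f (Complex \<alpha> \<beta>)))) =
      (\<lambda>\<alpha>. indicator {0<..} \<alpha> * deriv_sup f \<alpha>)"
    by (auto simp: fun_eq_iff indicator_def deriv_sup_eq_SUP_Rats[OF f] Rats_def)
  finally show ?thesis .
qed

lemma weighted_deriv_sup_le:
  assumes "0 \<le> t"
  shows "ennreal (\<alpha> / (\<alpha> + t)) * (indicator {0<..} \<alpha> * deriv_sup f \<alpha>)
    \<le> indicator {0<..} \<alpha> * deriv_sup f \<alpha>"
proof (cases "0 < \<alpha>")
  case True
  hence "ennreal (\<alpha> / (\<alpha> + t)) \<le> 1" using assms by (simp add: divide_le_eq ennreal_le_1)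
  from mult_right_mono[OF this] show ?thesis by simp
qed simp

lemma weighted_B0_norm_le_B0_norm: "0 \<le> t \<Longrightarrow> weighted_B0_norm t f \<le> B0_norm f"
  unfolding weighted_B0_norm_def B0_norm_def by (intro nn_integral_mono weighted_deriv_sup_le)

lemma nn_integral_deriv_half_plane_le:
  fixes g :: "real \<times> real \<Rightarrow> ennreal"
  assumes f: "f holomorphic_on rhp" and g: "g \<in> borel_measurable borel"
    and inner_le: "\<And>\<alpha>. 0 < \<alpha> \<Longrightarrow> (\<integral>\<^sup>+ \<beta>. g (\<alpha>, \<beta>) \<partial>lborel) \<le> w \<alpha>"
  shows "(\<integral>\<^sup>+ p. g p * ennreal (cmod (indicator half_plane p *\<^sub>R deriv f (Complex (fst p) (snd p))))
        \<partial>lborel)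
    \<le> (\<integral>\<^sup>+ \<alpha>. w \<alpha> * (indicator {0<..} \<alpha> * deriv_sup f \<alpha>) \<partial>lborel)"
proof -
  let ?d = "\<lambda>p. ennreal (cmod (indicator half_plane p *\<^sub>R deriv f (Complex (fst p) (snd p))))"
  have g_pair [measurable]: "g \<in> borel_measurable (lborel \<Otimes>\<^sub>M lborel)"
    using g by (simp add: lborel_prod)
  have "(\<lambda>p. indicator half_plane p *\<^sub>R deriv f (Complex (fst p) (snd p)))
      \<in> borel_measurable (lborel \<Otimes>\<^sub>M lborel)"
    using borel_measurable_deriv_half_plane[OF f] by (simp add: lborel_prod)
  hence [measurable]: "?d \<in> borel_measurable (lborel \<Otimes>\<^sub>M lborel)" by measurable
  have "(\<integral>\<^sup>+ p. g p * ?d p \<partial>lborel) = (\<integral>\<^sup>+ p. g p * ?d p \<partial>(lborel \<Otimes>\<^sub>M lborel))"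
    by (simp only: lborel_prod)
  also have "\<dots> = (\<integral>\<^sup>+ \<alpha>. \<integral>\<^sup>+ \<beta>. g (\<alpha>, \<beta>) * ?d (\<alpha>, \<beta>) \<partial>lborel \<partial>lborel)"
    by (rule lborel.nn_integral_fst[symmetric]) measurable
  also have "\<dots> \<le> (\<integral>\<^sup>+ \<alpha>. w \<alpha> * (indicator {0<..} \<alpha> * deriv_sup f \<alpha>) \<partial>lborel)"
  proof (rule nn_integral_mono)
    fix \<alpha> :: real
    show "(\<integral>\<^sup>+ \<beta>. g (\<alpha>, \<beta>) * ?d (\<alpha>, \<beta>) \<partial>lborel) \<le> w \<alpha> * (indicator {0<..} \<alpha> * deriv_sup f \<alpha>)"
    proof (cases "0 < \<alpha>")
      case True
      have "(\<integral>\<^sup>+ \<beta>. g (\<alpha>, \<beta>) * ?d (\<alpha>, \<beta>) \<partial>lborel) \<le> (\<integral>\<^sup>+ \<beta>. g (\<alpha>, \<beta>) * deriv_sup f \<alpha> \<partial>lborel)"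
        using True by (intro nn_integral_mono mult_left_mono) (auto simp: deriv_sup_upper)
      also have "\<dots> = (\<integral>\<^sup>+ \<beta>. g (\<alpha>, \<beta>) \<partial>lborel) * deriv_sup f \<alpha>"
        by (rule nn_integral_multc) measurable
      also have "\<dots> \<le> w \<alpha> * deriv_sup f \<alpha>" by (intro mult_right_mono inner_le True) simp
      finally show ?thesis using True by simp
    qed simp
  qed
  finally show ?thesis .
qed

context gsf_resolvent
begin

definition B_integrand :: "(complex \<Rightarrow> complex) \<Rightarrow> 'a \<Rightarrow> real \<times> real \<Rightarrow> 'a" where
  "B_integrand f x p =
     cscale (of_real (fst p) * deriv f (Complex (fst p) (snd p)))
       (RR (Complex (fst p) (- snd p)) x)"

definition B_form :: "(complex \<Rightarrow> complex) \<Rightarrow> ('a \<Rightarrow> complex) \<Rightarrow> 'a \<Rightarrow> complex" where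
  "B_form f \<phi> x = (LINT \<alpha>:{0<..}|lborel. of_real \<alpha> *
     (LINT \<beta>|lborel. \<phi> (RR (Complex \<alpha> (- \<beta>)) x) * deriv f (Complex \<alpha> \<beta>)))"

lemma dual_B_integrand:
  "\<phi> \<in> dual_space \<Longrightarrow> \<phi> (B_integrand f x p) =
     of_real (fst p) * (\<phi> (RR (Complex (fst p) (- snd p)) x) * deriv f (Complex (fst p) (snd p)))"
  by (simp add: B_integrand_def dual_cscale mult_ac)

lemma B_integrand_diff:
  "p \<in> half_plane \<Longrightarrow> B_integrand f (x - y) p = B_integrand f x p - B_integrand f y p"
  by (auto simp: B_integrand_def R_diff cscale.diff_right)

lemma B_integrand_scaleR:
  "p \<in> half_plane \<Longrightarrow> B_integrand f (r *\<^sub>R x) p = r *\<^sub>R B_integrand f x p"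
  by (auto simp: B_integrand_def R_scaleR cscale_scaleR)

lemma continuous_on_RR_half_plane:
  "continuous_on half_plane (\<lambda>p. RR (Complex (fst p) (- snd p)) x)"
  by (rule continuous_on_compose2[OF continuous_on_RR])
    (auto intro!: continuous_intros simp: rhp_def Complex_eq)

lemma continuous_on_B_integrand:
  "f holomorphic_on rhp \<Longrightarrow> continuous_on half_plane (B_integrand f x)"
  unfolding B_integrand_def
  by (intro cscale.continuous_on continuous_intros continuous_on_deriv_half_plane
      continuous_on_RR_half_plane)

lemma nn_integral_B_integrand_le:
  assumes f: "f holomorphic_on rhp" and g: "continuous_on UNIV g" "\<And>v. 0 \<le> g v"
    and g_cscale: "\<And>c v. g (cscale c v) = cmod c * g v"
    and line_le: "\<And>\<alpha>. 0 < \<alpha> \<Longrightarrow> ennreal \<alpha> * (\<integral>\<^sup>+ \<beta>. ennreal (g (RR (Complex \<alpha> \<beta>) x)) \<partial>lborel) \<le> w \<alpha>"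
  shows "(\<integral>\<^sup>+ p. ennreal (indicator half_plane p *\<^sub>R g (B_integrand f x p)) \<partial>lborel)
    \<le> (\<integral>\<^sup>+ \<alpha>. w \<alpha> * (indicator {0<..} \<alpha> * deriv_sup f \<alpha>) \<partial>lborel)"
proof -
  let ?G = "\<lambda>p. ennreal (indicator half_plane p *\<^sub>R (fst p * g (RR (Complex (fst p) (- snd p)) x)))"
  have "continuous_on half_plane (\<lambda>p. fst p * g (RR (Complex (fst p) (- snd p)) x))"
    by (intro continuous_intros continuous_on_compose2[OF g(1) continuous_on_RR_half_plane]) auto
  hence G_meas: "?G \<in> borel_measurable borel"
    by (intro measurable_compose[OF _ measurable_ennreal] borel_measurable_continuous_on_indicator
        sets_half_plane)
  have G_le: "(\<integral>\<^sup>+ \<beta>. ?G (\<alpha>, \<beta>) \<partial>lborel) \<le> w \<alpha>" if "0 < \<alpha>" for \<alpha>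
  proof -
    have "continuous_on UNIV (\<lambda>\<beta>. g (RR (Complex \<alpha> \<beta>) x))"
      using continuous_on_RR_line[OF that] by (intro continuous_on_compose2[OF g(1)]) auto
    hence [measurable]: "(\<lambda>\<beta>. g (RR (Complex \<alpha> \<beta>) x)) \<in> borel_measurable borel"
      by (rule borel_measurable_continuous_onI)
    have [measurable]: "(\<lambda>\<beta>. g (RR (Complex \<alpha> (- \<beta>)) x)) \<in> borel_measurable borel"
      by (rule measurable_compose[of uminus borel borel]) simp_all
    have "(\<integral>\<^sup>+ \<beta>. ?G (\<alpha>, \<beta>) \<partial>lborel)
        = (\<integral>\<^sup>+ \<beta>. ennreal \<alpha> * ennreal (g (RR (Complex \<alpha> (- \<beta>)) x)) \<partial>lborel)"
      using that by (intro nn_integral_cong) (simp add: ennreal_mult g(2))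
    also have "\<dots> = ennreal \<alpha> * (\<integral>\<^sup>+ \<beta>. ennreal (g (RR (Complex \<alpha> (- \<beta>)) x)) \<partial>lborel)"
      by (rule nn_integral_cmult) measurable
    also have "(\<integral>\<^sup>+ \<beta>. ennreal (g (RR (Complex \<alpha> (- \<beta>)) x)) \<partial>lborel)
        = (\<integral>\<^sup>+ \<beta>. ennreal (g (RR (Complex \<alpha> \<beta>) x)) \<partial>lborel)"
      by (rule nn_integral_reflect) measurable
    finally show ?thesis using line_le[OF that] by simp
  qed
  have "ennreal (indicator half_plane p *\<^sub>R g (B_integrand f x p)) =
      ?G p * ennreal (cmod (indicator half_plane p *\<^sub>R deriv f (Complex (fst p) (snd p))))" for p
    by (auto simp: indicator_def B_integrand_def g_cscale g(2) norm_mult mult_ac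
        simp flip: ennreal_mult)
  thus ?thesis using nn_integral_deriv_half_plane_le[OF f G_meas G_le] by simp
qed

lemma nn_integral_dual_B_integrand_le:
  assumes f: "f holomorphic_on rhp" and \<phi>: "\<phi> \<in> dual_space"
    and W: "weighted_B0_norm 1 f \<le> ennreal W" "0 \<le> W"
  shows "(\<integral>\<^sup>+ p. ennreal (indicator half_plane p *\<^sub>R cmod (\<phi> (B_integrand f x p))) \<partial>lborel)
    \<le> ennreal (onorm \<phi> * (C * W * norm x))"
proof -
  define c where "c = C * onorm \<phi> * norm x"
  have "0 \<le> c" using C_nonneg dual_onorm_nonneg[OF \<phi>] by (simp add: c_def)
  have line_le: "ennreal \<alpha> * (\<integral>\<^sup>+ \<beta>. ennreal (cmod (\<phi> (RR (Complex \<alpha> \<beta>) x))) \<partial>lborel)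
      \<le> ennreal c * ennreal (\<alpha> / (\<alpha> + 1))" if "0 < \<alpha>" for \<alpha>
  proof -
    have "ennreal \<alpha> * (\<integral>\<^sup>+ \<beta>. ennreal (cmod (\<phi> (RR (Complex \<alpha> \<beta>) x))) \<partial>lborel)
        \<le> ennreal \<alpha> * ennreal (c / (\<alpha> + 1))"
      unfolding c_def by (intro mult_left_mono gsf that \<phi>) simp
    thus ?thesis using that \<open>0 \<le> c\<close> by (simp add: mult.commute flip: ennreal_mult)
  qed
  have "(\<integral>\<^sup>+ p. ennreal (indicator half_plane p *\<^sub>R cmod (\<phi> (B_integrand f x p))) \<partial>lborel)
      \<le> (\<integral>\<^sup>+ \<alpha>. ennreal c * ennreal (\<alpha> / (\<alpha> + 1)) * (indicator {0<..} \<alpha> * deriv_sup f \<alpha>) \<partial>lborel)"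
    by (rule nn_integral_B_integrand_le[where g = "\<lambda>v. cmod (\<phi> v)", OF f _ _ _ line_le])
      (auto intro!: continuous_intros bounded_linear.continuous_on[OF dual_bounded_linear[OF \<phi>]]
        simp: dual_cscale[OF \<phi>] norm_mult)
  also have "\<dots> = ennreal c * weighted_B0_norm 1 f"
    using borel_measurable_deriv_sup[OF f] unfolding weighted_B0_norm_def
    by (simp add: mult.assoc nn_integral_cmult)
  also have "\<dots> \<le> ennreal c * ennreal W" by (intro mult_left_mono W) simp
  also have "\<dots> = ennreal (onorm \<phi> * (C * W * norm x))"
    using \<open>0 \<le> c\<close> W(2) by (simp add: c_def mult_ac flip: ennreal_mult)
  finally show ?thesis .
qed

lemma
  assumes f: "f holomorphic_on rhp" and \<phi>: "\<phi> \<in> dual_space"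
    and W: "weighted_B0_norm 1 f \<le> ennreal W" "0 \<le> W"
  shows set_integrable_dual_B_integrand:
      "set_integrable lborel half_plane (\<lambda>p. \<phi> (B_integrand f x p))"
    and cmod_integral_dual_B_integrand_le:
      "cmod (LINT p:half_plane|lborel. \<phi> (B_integrand f x p)) \<le> onorm \<phi> * (C * W * norm x)"
proof -
  let ?k = "\<lambda>p. indicator half_plane p *\<^sub>R \<phi> (B_integrand f x p)"
  have k_meas: "?k \<in> borel_measurable lborel"
    using borel_measurable_continuous_on_indicator[OF sets_half_plane
        bounded_linear.continuous_on[OF dual_bounded_linear[OF \<phi>] continuous_on_B_integrand[OF f]]]
    by simp
  have bound: "(\<integral>\<^sup>+ p. ennreal (cmod (?k p)) \<partial>lborel) \<le> ennreal (onorm \<phi> * (C * W * norm x))"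
    using nn_integral_dual_B_integrand_le[OF assms] by (simp add: indicator_def)
  have "0 \<le> onorm \<phi> * (C * W * norm x)" using C_nonneg W(2) dual_onorm_nonneg[OF \<phi>] by simp
  note k_int = integral_bound_of_nn_integral[OF k_meas bound this]
  show "set_integrable lborel half_plane (\<lambda>p. \<phi> (B_integrand f x p))"
    unfolding set_integrable_def by (rule k_int)
  show "cmod (LINT p:half_plane|lborel. \<phi> (B_integrand f x p)) \<le> onorm \<phi> * (C * W * norm x)"
    unfolding set_lebesgue_integral_def by (rule k_int)
qed

lemma nn_integral_norm_RR_core_le:
  assumes "0 < \<alpha>"
  shows "ennreal \<alpha> * (\<integral>\<^sup>+ \<beta>. ennreal (norm (RR (Complex \<alpha> \<beta>) (RR 1 x))) \<partial>lborel)
    \<le> ennreal (core_bound * norm x * pi)"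
proof -
  define c where "c = core_bound * norm x"
  have "0 \<le> c" by (simp add: c_def core_bound_nonneg)
  have "\<alpha> * norm (RR (Complex \<alpha> \<beta>) (RR 1 x)) \<le> c * (\<alpha> / (\<alpha>\<^sup>2 + \<beta>\<^sup>2))" for \<beta>
  proof -
    let ?z = "Complex \<alpha> \<beta>"
    have "\<alpha>\<^sup>2 + \<beta>\<^sup>2 = (cmod ?z)\<^sup>2" by (simp add: cmod_def)
    also have "\<dots> \<le> (1 + cmod ?z)\<^sup>2" by (intro power_mono) auto
    finally have "c / (1 + cmod ?z)\<^sup>2 \<le> c / (\<alpha>\<^sup>2 + \<beta>\<^sup>2)"
      using \<open>0 \<le> c\<close> \<open>0 < \<alpha>\<close>
      by (intro divide_left_mono mult_pos_pos zero_less_power add_pos_nonneg) auto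
    hence "norm (RR ?z (RR 1 x)) \<le> c / (\<alpha>\<^sup>2 + \<beta>\<^sup>2)"
      using RR_core_decay[of ?z x] \<open>0 < \<alpha>\<close> by (simp add: c_def)
    from mult_left_mono[OF this, of \<alpha>] show ?thesis using \<open>0 < \<alpha>\<close> by (simp add: mult_ac)
  qed
  hence pointwise: "ennreal \<alpha> * ennreal (norm (RR (Complex \<alpha> \<beta>) (RR 1 x)))
      \<le> ennreal c * ennreal (\<alpha> / (\<alpha>\<^sup>2 + \<beta>\<^sup>2))" for \<beta>
    using \<open>0 < \<alpha>\<close> \<open>0 \<le> c\<close> by (simp add: ennreal_leI flip: ennreal_mult)
  have "(\<lambda>\<beta>. norm (RR (Complex \<alpha> \<beta>) (RR 1 x))) \<in> borel_measurable borel"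
    by (intro borel_measurable_continuous_onI continuous_on_norm continuous_on_RR_line assms)
  hence "ennreal \<alpha> * (\<integral>\<^sup>+ \<beta>. ennreal (norm (RR (Complex \<alpha> \<beta>) (RR 1 x))) \<partial>lborel)
      = (\<integral>\<^sup>+ \<beta>. ennreal \<alpha> * ennreal (norm (RR (Complex \<alpha> \<beta>) (RR 1 x))) \<partial>lborel)"
    by (intro nn_integral_cmult[symmetric]) simp
  also have "\<dots> \<le> (\<integral>\<^sup>+ \<beta>. ennreal c * ennreal (\<alpha> / (\<alpha>\<^sup>2 + \<beta>\<^sup>2)) \<partial>lborel)"
    by (intro nn_integral_mono pointwise)
  also have "\<dots> = ennreal (c * pi)"
    using \<open>0 \<le> c\<close> by (simp add: nn_integral_cmult nn_integral_poisson_kernel assms ennreal_mult)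
  finally show ?thesis by (simp add: c_def)
qed

lemma set_integrable_norm_B_integrand_core:
  assumes f: "f holomorphic_on rhp" and fin: "B0_norm f < \<infinity>"
  shows "set_integrable lborel half_plane (\<lambda>p. norm (B_integrand f (RR 1 x) p))"
  unfolding set_integrable_def
proof (rule integrableI_bounded)
  let ?N = "\<lambda>p. indicator half_plane p *\<^sub>R norm (B_integrand f (RR 1 x) p)"
  let ?c = "ennreal (core_bound * norm x * pi)"
  show "?N \<in> borel_measurable lborel"
    using borel_measurable_continuous_on_indicator[OF sets_half_plane
        continuous_on_norm[OF continuous_on_B_integrand[OF f]]] by simp
  have "(\<integral>\<^sup>+ p. ennreal (norm (?N p)) \<partial>lborel) = (\<integral>\<^sup>+ p. ennreal (?N p) \<partial>lborel)" by simp
  also have "\<dots> \<le> (\<integral>\<^sup>+ \<alpha>. ?c * (indicator {0<..} \<alpha> * deriv_sup f \<alpha>) \<partial>lborel)"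
    by (rule nn_integral_B_integrand_le[where g = norm, OF f _ _ _ nn_integral_norm_RR_core_le])
      (auto intro!: continuous_intros simp: norm_cscale)
  also have "\<dots> = ?c * B0_norm f"
    using borel_measurable_deriv_sup[OF f] unfolding B0_norm_def by (intro nn_integral_cmult) simp
  also have "\<dots> < \<infinity>" using fin by (simp add: ennreal_mult_less_top)
  finally show "(\<integral>\<^sup>+ p. ennreal (norm (?N p)) \<partial>lborel) < \<infinity>" .
qed

lemma B_form_eq_half_plane_integral:
  assumes \<phi>: "\<phi> \<in> dual_space"
    and int: "set_integrable lborel half_plane (\<lambda>p. \<phi> (B_integrand f x p))"
  shows "B_form f \<phi> x = (LINT p:half_plane|lborel. \<phi> (B_integrand f x p))"
proof -
  let ?K = "\<lambda>p. indicator half_plane p *\<^sub>R \<phi> (B_integrand f x p)"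
  have "integrable (lborel \<Otimes>\<^sub>M lborel) ?K"
    using int unfolding set_integrable_def by (simp only: lborel_prod)
  hence "(LINT \<alpha>|lborel. LINT \<beta>|lborel. ?K (\<alpha>, \<beta>)) = (LINT p|(lborel \<Otimes>\<^sub>M lborel). ?K p)"
    by (rule lborel_pair.integral_fst')
  moreover have "(LINT \<beta>|lborel. ?K (\<alpha>, \<beta>)) = indicator {0<..} \<alpha> *\<^sub>R (of_real \<alpha> *
     (LINT \<beta>|lborel. \<phi> (RR (Complex \<alpha> (- \<beta>)) x) * deriv f (Complex \<alpha> \<beta>)))" for \<alpha>
    by (simp add: dual_B_integrand[OF \<phi>] indicator_def)
  ultimately show ?thesis by (simp add: B_form_def set_lebesgue_integral_def lborel_prod)
qed

lemma B_form_represented_on_core: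
  assumes f: "f holomorphic_on rhp" and fin: "B0_norm f < \<infinity>"
    and int: "\<And>\<phi>. \<phi> \<in> dual_space \<Longrightarrow>
      set_integrable lborel half_plane (\<lambda>p. \<phi> (B_integrand f (RR 1 x) p))"
  shows "\<exists>v. \<forall>\<phi>\<in>dual_space. \<phi> v = B_form f \<phi> (RR 1 x)"
proof -
  let ?H = "B_integrand f (RR 1 x)"
  have H: "?H integrable_on half_plane_box n" for n
    unfolding half_plane_box_def
    using continuous_on_B_integrand[OF f] Union_half_plane_box unfolding half_plane_box_def
    by (intro integrable_continuous) (rule continuous_on_subset, auto)
  have "half_plane_box n \<in> sets lborel" for n by (simp add: half_plane_box_def)
  from exists_weak_integral[OF incseq_half_plane_box this H, where 'b = complex,
      unfolded Union_half_plane_box, OF set_integrable_norm_B_integrand_core[OF f fin]]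
  obtain v where v: "\<phi> v = (LINT p:half_plane|lborel. \<phi> (?H p))"
    if "bounded_linear \<phi>" "set_integrable lborel half_plane (\<lambda>p. \<phi> (?H p))" for \<phi> :: "'a \<Rightarrow> complex"
    by blast
  have "\<phi> v = B_form f \<phi> (RR 1 x)" if \<phi>: "\<phi> \<in> dual_space" for \<phi>
    unfolding B_form_eq_half_plane_integral[OF \<phi> int[OF \<phi>]]
    by (rule v[OF dual_bounded_linear[OF \<phi>] int[OF \<phi>]])
  thus ?thesis by blast
qed

lemma B_form_operator_exists:
  assumes f: "f holomorphic_on rhp" and fin: "B0_norm f < \<infinity>"
    and W: "weighted_B0_norm 1 f \<le> ennreal W" "0 \<le> W"
  shows "\<exists>T. bounded_linear T \<and> (\<forall>x. \<forall>\<phi>\<in>dual_space. \<phi> (T x) = B_form f \<phi> x) \<and> onorm T \<le> C * W"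
proof (rule exists_weakly_represented_operator[where S = "range (\<lambda>x. RR 1 x)"])
  note int = set_integrable_dual_B_integrand[OF f _ W]
  note B_form_eq = B_form_eq_half_plane_integral[OF _ int]
  show "B_form f \<phi> (x - y) = B_form f \<phi> x - B_form f \<phi> y" if \<phi>: "\<phi> \<in> dual_space" for \<phi> x y
  proof -
    have "(LINT p:half_plane|lborel. \<phi> (B_integrand f (x - y) p)) =
        (LINT p:half_plane|lborel. \<phi> (B_integrand f x p) - \<phi> (B_integrand f y p))"
      by (intro set_lebesgue_integral_cong) (use \<phi> in \<open>auto simp: B_integrand_diff dual_diff\<close>)
    thus ?thesis by (simp add: B_form_eq \<phi> int set_integral_diff)
  qed
  show "B_form f \<phi> (r *\<^sub>R x) = r *\<^sub>R B_form f \<phi> x" if \<phi>: "\<phi> \<in> dual_space" for \<phi> r x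
  proof -
    have "(LINT p:half_plane|lborel. \<phi> (B_integrand f (r *\<^sub>R x) p)) =
        (LINT p:half_plane|lborel. r *\<^sub>R \<phi> (B_integrand f x p))"
      by (intro set_lebesgue_integral_cong) (use \<phi> in \<open>auto simp: B_integrand_scaleR dual_scaleR\<close>)
    thus ?thesis by (simp add: B_form_eq \<phi>)
  qed
  show "cmod (B_form f \<phi> x) \<le> onorm \<phi> * (C * W * norm x)" if \<phi>: "\<phi> \<in> dual_space" for \<phi> x
    unfolding B_form_eq[OF \<phi> \<phi>] by (rule cmod_integral_dual_B_integrand_le[OF f \<phi> W])
  show "\<exists>v. \<forall>\<phi>\<in>dual_space. \<phi> v = B_form f \<phi> x" if "x \<in> range (\<lambda>x. RR 1 x)" for x
    using that B_form_represented_on_core[OF f fin int] by auto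
qed (use C_nonneg W(2) dense_range_RR1 in auto)

end

section \<open>Integrals along vertical lines\<close>

definition vertical_integral :: "real \<Rightarrow> (complex \<Rightarrow> complex) \<Rightarrow> complex" where
  "vertical_integral a F = (LINT \<beta>|lborel. F (Complex a \<beta>))"

lemma continuous_on_vertical_line:
  assumes "continuous_on {z. Re z = a} F"
  shows "continuous_on UNIV (\<lambda>\<beta>. F (Complex a \<beta>))"
proof -
  have "continuous_on UNIV (Complex a)" by (auto intro!: continuous_intros simp: Complex_eq)
  thus ?thesis by (intro continuous_on_compose2[OF assms]) auto
qed

lemma tendsto_truncated_integral:
  fixes g :: "real \<Rightarrow> 'b::euclidean_space"
  assumes g: "integrable lborel g"
  shows "(\<lambda>n. integral {- real n..real n} g) \<longlonglongrightarrow> (LINT x|lborel. g x)"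
proof -
  have set_int: "set_integrable lborel A g" if "A \<in> sets lborel" for A
    unfolding set_integrable_def using g that by (rule integrable_mult_indicator[rotated])
  have "(\<Union>n. {- real n..real n}) = UNIV"
  proof (intro equalityI subsetI UNIV_I)
    fix x :: real
    obtain n :: nat where "\<bar>x\<bar> \<le> real n" using real_arch_simple by blast
    hence "x \<in> {- real n..real n}" by auto
    thus "x \<in> (\<Union>n. {- real n..real n})" by blast
  qed
  moreover have "(\<lambda>n. LINT x:{- real n..real n}|lborel. g x)
      \<longlonglongrightarrow> (LINT x:(\<Union>n. {- real n..real n})|lborel. g x)"
    by (intro set_integral_cont_up set_int) (auto simp: incseq_def)
  ultimately show ?thesis
    by (simp add: set_borel_integral_eq_integral set_int set_lebesgue_integral_def[of _ UNIV])
qed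

lemma
  assumes F: "continuous_on {z. Re z = a} F"
    and bound: "\<And>\<beta>. cmod (F (Complex a \<beta>)) \<le> K / (1 + \<beta>\<^sup>2)"
  shows integrable_vertical_line: "integrable lborel (\<lambda>\<beta>. F (Complex a \<beta>))"
    and cmod_vertical_integral_le: "cmod (vertical_integral a F) \<le> pi * K"
proof -
  have "0 \<le> K" using order.trans[OF norm_ge_zero bound[of 0]] by simp
  have meas: "(\<lambda>\<beta>. F (Complex a \<beta>)) \<in> borel_measurable lborel"
    using borel_measurable_continuous_onI[OF continuous_on_vertical_line[OF F]] by simp
  have "(\<integral>\<^sup>+ \<beta>. ennreal (cmod (F (Complex a \<beta>))) \<partial>lborel)
      \<le> (\<integral>\<^sup>+ \<beta>. ennreal K * ennreal (1 / (1\<^sup>2 + \<beta>\<^sup>2)) \<partial>lborel)"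
    using bound \<open>0 \<le> K\<close> by (intro nn_integral_mono) (simp flip: ennreal_mult)
  also have "\<dots> = ennreal K * (\<integral>\<^sup>+ \<beta>. ennreal (1 / (1\<^sup>2 + \<beta>\<^sup>2)) \<partial>lborel)"
    by (rule nn_integral_cmult) simp
  also have "\<dots> = ennreal (pi * K)"
    using \<open>0 \<le> K\<close>
    by (subst nn_integral_poisson_kernel) (simp_all add: mult.commute flip: ennreal_mult)
  finally have nn_le: "(\<integral>\<^sup>+ \<beta>. ennreal (cmod (F (Complex a \<beta>))) \<partial>lborel) \<le> ennreal (pi * K)" .
  have "0 \<le> pi * K" using \<open>0 \<le> K\<close> by simp
  show "integrable lborel (\<lambda>\<beta>. F (Complex a \<beta>))" "cmod (vertical_integral a F) \<le> pi * K"
    unfolding vertical_integral_def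
    by (rule integral_bound_of_nn_integral[OF meas nn_le \<open>0 \<le> pi * K\<close>])+
qed

lemma contour_integral_rectpath_vertical_sides:
  assumes "a < b" "0 < N"
    and F: "continuous_on (path_image (rectpath (Complex a (- N)) (Complex b N))) F"
    and bound: "\<And>z. a \<le> Re z \<Longrightarrow> Re z \<le> b \<Longrightarrow> \<bar>Im z\<bar> = N \<Longrightarrow> cmod (F z) \<le> e"
  shows "cmod (contour_integral (rectpath (Complex a (- N)) (Complex b N)) F -
      \<i> * (integral {- N..N} (\<lambda>\<beta>. F (Complex b \<beta>)) - integral {- N..N} (\<lambda>\<beta>. F (Complex a \<beta>))))
    \<le> 2 * e * (b - a)"
proof -
  define p q r s
    where "p = Complex a (- N)" and "q = Complex b (- N)" and "r = Complex b N" and "s = Complex a N"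
  have "0 \<le> e" using order.trans[OF norm_ge_zero bound[of p]] \<open>a < b\<close> \<open>0 < N\<close> by (simp add: p_def)
  have rect: "rectpath p r = linepath p q +++ linepath q r +++ linepath r s +++ linepath s p"
    by (simp add: rectpath_def p_def q_def r_def s_def Let_def)
  have sides: "continuous_on (closed_segment p q) F" "continuous_on (closed_segment q r) F"
      "continuous_on (closed_segment r s) F" "continuous_on (closed_segment s p) F"
    using F[folded p_def r_def] unfolding rect
    by (auto simp: path_image_join elim!: continuous_on_subset)
  note int = sides[THEN contour_integrable_continuous_linepath]
  have "contour_integral (rectpath p r) F
      = contour_integral (linepath p q) F + contour_integral (linepath q r) F
      + contour_integral (linepath r s) F + contour_integral (linepath s p) F"
    unfolding rect using int by simp
  also have "contour_integral (linepath q r) F = \<i> * integral {- N..N} (\<lambda>\<beta>. F (Complex b \<beta>))"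
    using \<open>0 < N\<close> by (intro contour_integral_linepath_same_Re) (auto simp: q_def r_def)
  also have "contour_integral (linepath s p) F = - (\<i> * integral {- N..N} (\<lambda>\<beta>. F (Complex a \<beta>)))"
    using \<open>0 < N\<close> unfolding contour_integral_reverse_linepath[OF sides(4)]
    by (intro arg_cong[where f = uminus] contour_integral_linepath_same_Re) (auto simp: p_def s_def)
  finally have "contour_integral (rectpath p r) F -
      \<i> * (integral {- N..N} (\<lambda>\<beta>. F (Complex b \<beta>)) - integral {- N..N} (\<lambda>\<beta>. F (Complex a \<beta>))) =
      contour_integral (linepath p q) F + contour_integral (linepath r s) F"
    by (simp add: algebra_simps)
  also have "cmod \<dots> \<le> e * cmod (q - p) + e * cmod (s - r)"
  proof (intro norm_triangle_mono contour_integral_bound_linepath int \<open>0 \<le> e\<close>)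
    show "cmod (F z) \<le> e" if "z \<in> closed_segment p q" for z
      using that \<open>a < b\<close> \<open>0 < N\<close>
      by (intro bound) (auto simp: p_def q_def closed_segment_same_Im closed_segment_eq_real_ivl)
    show "cmod (F z) \<le> e" if "z \<in> closed_segment r s" for z
      using that \<open>a < b\<close> \<open>0 < N\<close>
      by (intro bound) (auto simp: r_def s_def closed_segment_same_Im closed_segment_eq_real_ivl)
  qed
  also have "\<dots> = 2 * e * (b - a)" using \<open>a < b\<close> by (simp add: p_def q_def r_def s_def cmod_def)
  finally show ?thesis by (simp add: p_def r_def)
qed

lemma vertical_integral_diff_eq_contour_integral:
  assumes "a < b" and e: "(e \<longlongrightarrow> 0) at_top"
    and int: "integrable lborel (\<lambda>\<beta>. F (Complex a \<beta>))" "integrable lborel (\<lambda>\<beta>. F (Complex b \<beta>))"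
    and cont: "\<And>N. r < N \<Longrightarrow> continuous_on (path_image (rectpath (Complex a (- N)) (Complex b N))) F"
    and contour: "\<And>N. r < N \<Longrightarrow> contour_integral (rectpath (Complex a (- N)) (Complex b N)) F = I"
    and bound: "\<And>z. a \<le> Re z \<Longrightarrow> Re z \<le> b \<Longrightarrow> r < \<bar>Im z\<bar> \<Longrightarrow> cmod (F z) \<le> e \<bar>Im z\<bar>"
  shows "\<i> * (vertical_integral b F - vertical_integral a F) = I"
proof -
  define D where "D n = \<i> * (integral {- real n..real n} (\<lambda>\<beta>. F (Complex b \<beta>))
      - integral {- real n..real n} (\<lambda>\<beta>. F (Complex a \<beta>)))" for n
  have "D \<longlonglongrightarrow> \<i> * (vertical_integral b F - vertical_integral a F)"
    unfolding D_def vertical_integral_def by (intro tendsto_intros tendsto_truncated_integral int)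
  moreover have "(\<lambda>n. I - D n) \<longlonglongrightarrow> 0"
  proof (rule Lim_null_comparison)
    show "\<forall>\<^sub>F n in sequentially. cmod (I - D n) \<le> 2 * e (real n) * (b - a)"
      using eventually_gt_at_top[of "nat \<lceil>max r 0\<rceil>"]
    proof eventually_elim
      case (elim n)
      hence n: "r < real n" "0 < real n" by linarith+
      show ?case
        unfolding D_def contour[OF n(1), symmetric]
        using n(1) bound
        by (intro contour_integral_rectpath_vertical_sides \<open>a < b\<close> n(2) cont[OF n(1)]) force+
    qed
    have "(\<lambda>n. 2 * e (real n) * (b - a)) \<longlonglongrightarrow> 2 * 0 * (b - a)"
      by (intro tendsto_intros filterlim_compose[OF e filterlim_real_sequentially])
    thus "(\<lambda>n. 2 * e (real n) * (b - a)) \<longlonglongrightarrow> 0" by simp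
  qed
  hence "D \<longlonglongrightarrow> I" using Lim_transform2[of "\<lambda>_. I" I sequentially D] by simp
  ultimately show ?thesis by (rule LIMSEQ_unique)
qed

lemma path_image_rectpath_subset_strip:
  assumes "a < b" "0 < N"
  shows "path_image (rectpath (Complex a (- N)) (Complex b N)) \<subseteq> {z. a \<le> Re z \<and> Re z \<le> b}"
  using assms by (auto simp: path_image_rectpath)

lemma convex_vertical_strip: "convex {z. a \<le> Re z \<and> Re z \<le> b}"
proof -
  have "{z. a \<le> Re z \<and> Re z \<le> b} = {z. Re z \<ge> a} \<inter> {z. Re z \<le> b}" by auto
  thus ?thesis by (simp add: convex_Int convex_halfspace_Re_ge convex_halfspace_Re_le)
qed

lemma vertical_integral_shift:
  assumes "a \<le> b" and F: "F holomorphic_on {z. a \<le> Re z \<and> Re z \<le> b}"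
    and bound: "\<And>z. a \<le> Re z \<Longrightarrow> Re z \<le> b \<Longrightarrow> cmod (F z) \<le> K / (1 + (Im z)\<^sup>2)"
  shows "vertical_integral b F = vertical_integral a F"
proof (cases "a = b")
  case False
  hence "a < b" using \<open>a \<le> b\<close> by simp
  have cont: "continuous_on {z. a \<le> Re z \<and> Re z \<le> b} F"
    by (rule holomorphic_on_imp_continuous_on[OF F])
  have int: "integrable lborel (\<lambda>\<beta>. F (Complex c \<beta>))" if "a \<le> c" "c \<le> b" for c
  proof (rule integrable_vertical_line)
    show "continuous_on {z. Re z = c} F" by (rule continuous_on_subset[OF cont]) (use that in auto)
    show "cmod (F (Complex c \<beta>)) \<le> K / (1 + \<beta>\<^sup>2)" for \<beta> using bound[of "Complex c \<beta>"] that by simp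
  qed
  have "\<i> * (vertical_integral b F - vertical_integral a F) = 0"
  proof (rule vertical_integral_diff_eq_contour_integral[where r = 0])
    fix N :: real assume "0 < N"
    note subset = path_image_rectpath_subset_strip[OF \<open>a < b\<close> \<open>0 < N\<close>]
    show "continuous_on (path_image (rectpath (Complex a (- N)) (Complex b N))) F"
      by (rule continuous_on_subset[OF cont subset])
    show "contour_integral (rectpath (Complex a (- N)) (Complex b N)) F = 0"
      by (intro contour_integral_unique
          Cauchy_theorem_convex_simple[OF F convex_vertical_strip _ subset]) auto
  next
    show "((\<lambda>y. K / (1 + y\<^sup>2)) \<longlongrightarrow> 0) at_top" by real_asymp
  qed (use \<open>a < b\<close> int bound in auto)
  thus ?thesis by simp
qed simp

lemma vertical_integral_eq_zero:
  assumes F: "F holomorphic_on {z. Re z \<le> a}"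
    and bound: "\<And>z. Re z \<le> a \<Longrightarrow> cmod (F z) \<le> k (Re z) / (1 + (Im z)\<^sup>2)"
    and k_le: "\<And>x. x \<le> a \<Longrightarrow> k x \<le> k a" and k: "(k \<longlongrightarrow> 0) at_bot"
  shows "vertical_integral a F = 0"
proof -
  have "cmod (vertical_integral a F) \<le> pi * k x" if "x \<le> a" for x
  proof -
    have "vertical_integral a F = vertical_integral x F"
    proof (rule vertical_integral_shift[OF that])
      show "F holomorphic_on {z. x \<le> Re z \<and> Re z \<le> a}" by (rule holomorphic_on_subset[OF F]) auto
      show "cmod (F z) \<le> k a / (1 + (Im z)\<^sup>2)" if "Re z \<le> a" for z
        using bound[OF that] divide_right_mono[OF k_le[OF that], of "1 + (Im z)\<^sup>2"] by simp
    qed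
    also have "cmod \<dots> \<le> pi * k x"
    proof (rule cmod_vertical_integral_le)
      show "continuous_on {z. Re z = x} F"
        by (rule continuous_on_subset[OF holomorphic_on_imp_continuous_on[OF F]]) (use that in auto)
      show "cmod (F (Complex x \<beta>)) \<le> k x / (1 + \<beta>\<^sup>2)" for \<beta>
        using bound[of "Complex x \<beta>"] that by simp
    qed
    finally show ?thesis .
  qed
  hence "\<forall>\<^sub>F x in at_bot. cmod (vertical_integral a F) \<le> pi * k x"
    by (rule eventually_mono[OF eventually_le_at_bot[of a]])
  moreover have "((\<lambda>x. pi * k x) \<longlongrightarrow> pi * 0) at_bot" by (intro tendsto_intros k)
  ultimately have "cmod (vertical_integral a F) \<le> pi * 0" by (intro tendsto_lowerbound) auto
  thus ?thesis by simp
qed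

lemma contour_integral_rectpath_cauchy_formula:
  assumes "convex S" and h: "h holomorphic_on S" and "cbox p q \<subseteq> S" and z: "z \<in> box p q"
  shows "contour_integral (rectpath p q) (\<lambda>w. h w / (w - z)) = 2 * pi * \<i> * h z"
proof -
  have "Re p \<le> Re q" "Im p \<le> Im q" using z by (auto simp: in_box_complex_iff)
  hence image: "path_image (rectpath p q) \<subseteq> S - {z}"
    using path_image_rectpath_subset_cbox[of p q] path_image_rectpath_inter_box[of p q]
      \<open>cbox p q \<subseteq> S\<close> z
    by blast
  have "box p q \<subseteq> S" using box_subset_cbox \<open>cbox p q \<subseteq> S\<close> by (rule order.trans)
  hence "z \<in> interior S" using z by (intro interiorI[OF open_box])
  hence "((\<lambda>w. h w / (w - z)) has_contour_integral
      (2 * pi * \<i> * winding_number (rectpath p q) z * h z)) (rectpath p q)"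
    by (intro Cauchy_integral_formula_convex_simple[OF \<open>convex S\<close> h _ _ image]) auto
  thus ?thesis by (simp add: contour_integral_unique winding_number_rectpath[OF z])
qed

lemma cauchy_kernel_decay:
  assumes "0 < d" "d \<le> \<bar>Re w - Re z\<bar>" "0 \<le> K" and "cmod u \<le> K / (1 + (Im w)\<^sup>2)"
  shows "cmod (u / (w - z)) \<le> K / d / (1 + (Im w)\<^sup>2)"
proof -
  have "d \<le> cmod (w - z)" using assms(2) abs_Re_le_cmod[of "w - z"] by simp
  hence "cmod (u / (w - z)) \<le> K / (1 + (Im w)\<^sup>2) / d"
    unfolding norm_divide using assms by (intro frac_le) auto
  thus ?thesis by (simp add: mult.commute)
qed

lemma vertical_integral_cauchy_kernel_eq_zero:
  assumes h: "h holomorphic_on {w. Re w \<le> a}" and "a < Re z"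
    and bound: "\<And>w. Re w \<le> a \<Longrightarrow> cmod (h w) \<le> K / (1 + (Im w)\<^sup>2)"
  shows "vertical_integral a (\<lambda>w. h w / (w - z)) = 0"
proof (rule vertical_integral_eq_zero[where k = "\<lambda>x. K / (Re z - x)"])
  have "0 \<le> K" using order.trans[OF norm_ge_zero bound[of "of_real a"]] by simp
  show "(\<lambda>w. h w / (w - z)) holomorphic_on {w. Re w \<le> a}"
    by (intro holomorphic_intros h) (use \<open>a < Re z\<close> in auto)
  show "cmod (h w / (w - z)) \<le> K / (Re z - Re w) / (1 + (Im w)\<^sup>2)" if "Re w \<le> a" for w
    using that \<open>a < Re z\<close> \<open>0 \<le> K\<close> by (intro cauchy_kernel_decay bound) auto
  show "K / (Re z - x) \<le> K / (Re z - a)" if "x \<le> a" for x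
    using that \<open>a < Re z\<close> \<open>0 \<le> K\<close> by (intro divide_left_mono) auto
  show "((\<lambda>x. K / (Re z - x)) \<longlongrightarrow> 0) at_bot" by real_asymp
qed

lemma integrable_vertical_cauchy_kernel:
  assumes h: "h holomorphic_on {w. Re w \<le> b}"
    and bound: "\<And>w. Re w \<le> b \<Longrightarrow> cmod (h w) \<le> K / (1 + (Im w)\<^sup>2)"
    and c: "c \<le> b" "c \<noteq> Re z"
  shows "integrable lborel (\<lambda>\<beta>. h (Complex c \<beta>) / (Complex c \<beta> - z))"
proof (rule integrable_vertical_line[where F = "\<lambda>w. h w / (w - z)"])
  show "continuous_on {w. Re w = c} (\<lambda>w. h w / (w - z))"
    using c
    by (intro continuous_intros continuous_on_subset[OF holomorphic_on_imp_continuous_on[OF h]]) auto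
  have "0 \<le> K" using order.trans[OF norm_ge_zero bound[of "of_real b"]] by simp
  thus "cmod (h (Complex c \<beta>) / (Complex c \<beta> - z)) \<le> K / \<bar>c - Re z\<bar> / (1 + \<beta>\<^sup>2)" for \<beta>
    using cauchy_kernel_decay[of "\<bar>c - Re z\<bar>" "Complex c \<beta>" z K] bound[of "Complex c \<beta>"] c by simp
qed

lemma vertical_integral_cauchy_formula:
  assumes h: "h holomorphic_on {w. Re w \<le> b}" and "Re z < b"
    and bound: "\<And>w. Re w \<le> b \<Longrightarrow> cmod (h w) \<le> K / (1 + (Im w)\<^sup>2)"
  shows "vertical_integral b (\<lambda>w. h w / (w - z)) = of_real (2 * pi) * h z"
proof -
  define a where "a = Re z - 1"
  have a: "a < Re z" "a < b" using \<open>Re z < b\<close> by (auto simp: a_def)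
  let ?F = "\<lambda>w. h w / (w - z)"
  have "0 \<le> K" using order.trans[OF norm_ge_zero bound[of "of_real b"]] by simp
  have cont: "continuous_on ({w. Re w \<le> b} - {z}) ?F"
    by (intro continuous_intros
        continuous_on_subset[OF holomorphic_on_imp_continuous_on[OF h]]) auto
  have int: "integrable lborel (\<lambda>\<beta>. ?F (Complex c \<beta>))" if "c \<le> b" "c \<noteq> Re z" for c
    by (rule integrable_vertical_cauchy_kernel[OF h bound that])
  have "\<i> * (vertical_integral b ?F - vertical_integral a ?F) = 2 * pi * \<i> * h z"
  proof (rule vertical_integral_diff_eq_contour_integral[where
        r = "\<bar>Im z\<bar>" and e = "\<lambda>y. K / (y - \<bar>Im z\<bar>)"])
    show "((\<lambda>y. K / (y - \<bar>Im z\<bar>)) \<longlongrightarrow> 0) at_top" by real_asymp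
    show "cmod (?F w) \<le> K / (\<bar>Im w\<bar> - \<bar>Im z\<bar>)" if "Re w \<le> b" "\<bar>Im z\<bar> < \<bar>Im w\<bar>" for w
    proof -
      have "K / (1 + (Im w)\<^sup>2) \<le> K / 1"
        using \<open>0 \<le> K\<close> by (intro divide_left_mono) (auto intro: add_pos_nonneg)
      hence "cmod (h w) \<le> K" using bound[OF that(1)] by simp
      moreover have "\<bar>Im w\<bar> - \<bar>Im z\<bar> \<le> cmod (w - z)" using abs_Im_le_cmod[of "w - z"] by simp
      ultimately show ?thesis unfolding norm_divide using that(2) \<open>0 \<le> K\<close> by (intro frac_le) auto
    qed
  next
    fix N assume N: "\<bar>Im z\<bar> < N"
    have "path_image (rectpath (Complex a (- N)) (Complex b N)) \<subseteq> {w. Re w \<le> b} - {z}"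
      using N a \<open>Re z < b\<close> by (auto simp: path_image_rectpath)
    thus "continuous_on (path_image (rectpath (Complex a (- N)) (Complex b N))) ?F"
      by (rule continuous_on_subset[OF cont])
    show "contour_integral (rectpath (Complex a (- N)) (Complex b N)) ?F = 2 * pi * \<i> * h z"
      using N a \<open>Re z < b\<close>
      by (intro contour_integral_rectpath_cauchy_formula[OF convex_halfspace_Re_le h])
        (auto simp: in_box_complex_iff in_cbox_complex_iff)
  qed (use a \<open>Re z < b\<close> in \<open>auto intro: int\<close>)
  moreover have "vertical_integral a ?F = 0"
    using a by (intro vertical_integral_cauchy_kernel_eq_zero[where K = K]
        holomorphic_on_subset[OF h] bound) auto
  ultimately show ?thesis by simp
qed

lemma vertical_integral_deriv_eq_zero:
  assumes der: "\<And>\<beta>. (F has_field_derivative F' (Complex a \<beta>)) (at (Complex a \<beta>))"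
    and bound: "\<And>\<beta>. cmod (F (Complex a \<beta>)) \<le> K / (1 + \<beta>\<^sup>2)"
    and int: "integrable lborel (\<lambda>\<beta>. F' (Complex a \<beta>))"
  shows "vertical_integral a F' = 0"
proof -
  have "((\<lambda>\<beta>. \<i> * F' (Complex a \<beta>)) has_integral
      (F (Complex a (real n)) - F (Complex a (- real n)))) {- real n..real n}" for n
    by (rule fundamental_theorem_of_calculus[OF _
        has_vector_derivative_at_within[OF has_vector_derivative_vertical_line[OF der]]]) simp
  hence "integral {- real n..real n} (\<lambda>\<beta>. \<i> * F' (Complex a \<beta>)) =
      F (Complex a (real n)) - F (Complex a (- real n))" for n by (rule integral_unique)
  moreover have "integrable lborel (\<lambda>\<beta>. \<i> * F' (Complex a \<beta>))" using int by simp
  ultimately have "(\<lambda>n. F (Complex a (real n)) - F (Complex a (- real n)))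
      \<longlonglongrightarrow> (LINT \<beta>|lborel. \<i> * F' (Complex a \<beta>))"
    using tendsto_truncated_integral[of "\<lambda>\<beta>. \<i> * F' (Complex a \<beta>)"] by simp
  moreover have "(\<lambda>n. F (Complex a (real n)) - F (Complex a (- real n))) \<longlonglongrightarrow> 0"
  proof (rule Lim_null_comparison)
    have "cmod (F (Complex a (real n)) - F (Complex a (- real n)))
        \<le> K / (1 + (real n)\<^sup>2) + K / (1 + (real n)\<^sup>2)" for n
      using bound[of "real n"] bound[of "- real n"]
      by (intro order.trans[OF norm_triangle_ineq4] add_mono) auto
    thus "\<forall>\<^sub>F n in sequentially. cmod (F (Complex a (real n)) - F (Complex a (- real n)))
        \<le> K / (1 + (real n)\<^sup>2) + K / (1 + (real n)\<^sup>2)" by simp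
    show "(\<lambda>n. K / (1 + (real n)\<^sup>2) + K / (1 + (real n)\<^sup>2)) \<longlonglongrightarrow> 0" by real_asymp
  qed
  ultimately have "(LINT \<beta>|lborel. \<i> * F' (Complex a \<beta>)) = 0" by (rule LIMSEQ_unique)
  thus ?thesis by (simp add: vertical_integral_def)
qed

section \<open>Weighted exponential integrals along vertical lines\<close>

(* The factor 1 / (z - 1)^2 comes from the vectors (1 + A)^-2 x and makes the integrals converge
   absolutely. *)
definition exp_weight :: "real \<Rightarrow> complex \<Rightarrow> complex" where
  "exp_weight t z = exp (of_real t * z) / (z - 1)\<^sup>2"

definition exp_line :: "real \<Rightarrow> real \<Rightarrow> (complex \<Rightarrow> complex) \<Rightarrow> complex" where
  "exp_line a t q = vertical_integral a (\<lambda>z. exp_weight t z * q z)"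

definition exp_line_integrable :: "real \<Rightarrow> real \<Rightarrow> (complex \<Rightarrow> complex) \<Rightarrow> bool" where
  "exp_line_integrable a t q \<longleftrightarrow> integrable lborel (\<lambda>\<beta>. exp_weight t (Complex a \<beta>) * q (Complex a \<beta>))"

definition bounded_on_line :: "real \<Rightarrow> (complex \<Rightarrow> complex) \<Rightarrow> bool" where
  "bounded_on_line a q \<longleftrightarrow> continuous_on {z. Re z = a} q \<and> (\<exists>Q. \<forall>z. Re z = a \<longrightarrow> cmod (q z) \<le> Q)"

definition inverse_square_const :: "real \<Rightarrow> real" where
  "inverse_square_const a = 1 / min 1 ((1 - a)\<^sup>2)"

lemma inverse_square_const_pos: "a < 1 \<Longrightarrow> 0 < inverse_square_const a"
  by (simp add: inverse_square_const_def)

lemma inverse_square_decay: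
  assumes "Re z \<le> a" "a < 1"
  shows "1 / (cmod (z - 1))\<^sup>2 \<le> inverse_square_const a / (1 + (Im z)\<^sup>2)"
proof -
  define m where "m = min 1 ((1 - a)\<^sup>2)"
  have m: "0 < m" "m \<le> 1" "m \<le> (1 - a)\<^sup>2" using assms by (auto simp: m_def)
  have "(1 - a)\<^sup>2 \<le> (Re z - 1)\<^sup>2" using assms by (subst power2_commute, intro power_mono) auto
  moreover have "m * (Im z)\<^sup>2 \<le> (Im z)\<^sup>2" using m by (simp add: mult_left_le_one_le)
  ultimately have "m * (1 + (Im z)\<^sup>2) \<le> (Re z - 1)\<^sup>2 + (Im z)\<^sup>2"
    using m(3) by (simp add: distrib_left)
  also have "\<dots> = (cmod (z - 1))\<^sup>2" by (simp add: cmod_def)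
  finally have "m * (1 + (Im z)\<^sup>2) \<le> (cmod (z - 1))\<^sup>2" .
  moreover have "0 < m * (1 + (Im z)\<^sup>2)" using m by (simp add: add_pos_nonneg)
  ultimately have "1 / (cmod (z - 1))\<^sup>2 \<le> 1 / (m * (1 + (Im z)\<^sup>2))"
    by (intro divide_left_mono) (auto intro!: mult_pos_pos)
  thus ?thesis by (simp add: inverse_square_const_def m_def)
qed

lemma exp_weight_decay:
  assumes "Re z \<le> a" "a < 1"
  shows "cmod (exp_weight t z) \<le> exp (t * Re z) * inverse_square_const a / (1 + (Im z)\<^sup>2)"
proof -
  have "cmod (exp_weight t z) = exp (t * Re z) * (1 / (cmod (z - 1))\<^sup>2)"
    by (simp add: exp_weight_def norm_divide norm_power)
  also have "\<dots> \<le> exp (t * Re z) * (inverse_square_const a / (1 + (Im z)\<^sup>2))"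
    by (intro mult_left_mono inverse_square_decay assms) simp
  finally show ?thesis by simp
qed

lemma holomorphic_exp_weight: "1 \<notin> S \<Longrightarrow> exp_weight t holomorphic_on S"
  unfolding exp_weight_def by (intro holomorphic_intros) auto

lemma continuous_on_exp_weight: "1 \<notin> S \<Longrightarrow> continuous_on S (exp_weight t)"
  by (intro holomorphic_on_imp_continuous_on holomorphic_exp_weight)

lemma exp_weight_mult: "exp_weight t z * exp_weight s z = exp_weight (t + s) z * (1 / (z - 1)) ^ 2"
  by (simp add: exp_weight_def distrib_right exp_add power_divide)

lemma bounded_on_lineI:
  assumes "continuous_on {z. Re z = a} q" "\<And>z. Re z = a \<Longrightarrow> cmod (q z) \<le> Q"
  shows "bounded_on_line a q"
  using assms unfolding bounded_on_line_def by blast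

lemma bounded_on_lineE:
  assumes "bounded_on_line a q"
  obtains Q where "0 \<le> Q" "\<And>z. Re z = a \<Longrightarrow> cmod (q z) \<le> Q"
proof -
  obtain Q where Q: "\<And>z. Re z = a \<Longrightarrow> cmod (q z) \<le> Q"
    using assms unfolding bounded_on_line_def by blast
  have "0 \<le> Q" using order.trans[OF norm_ge_zero Q[of "of_real a"]] by simp
  thus thesis using Q that by blast
qed

lemma bounded_on_line_continuous: "bounded_on_line a q \<Longrightarrow> continuous_on {z. Re z = a} q"
  by (simp add: bounded_on_line_def)

lemma bounded_on_line_const: "bounded_on_line a (\<lambda>_. c)"
  by (rule bounded_on_lineI[where Q = "cmod c"]) auto

lemma bounded_on_line_diff:
  assumes "bounded_on_line a p" "bounded_on_line a q"
  shows "bounded_on_line a (\<lambda>z. p z - q z)"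
proof -
  obtain P Q where "\<And>z. Re z = a \<Longrightarrow> cmod (p z) \<le> P" "\<And>z. Re z = a \<Longrightarrow> cmod (q z) \<le> Q"
    using assms by (metis bounded_on_lineE)
  hence "cmod (p z - q z) \<le> P + Q" if "Re z = a" for z
    using that by (intro order.trans[OF norm_triangle_ineq4 add_mono])
  moreover have "continuous_on {z. Re z = a} (\<lambda>z. p z - q z)"
    using assms by (intro continuous_intros bounded_on_line_continuous)
  ultimately show ?thesis by (intro bounded_on_lineI)
qed

lemma bounded_on_line_mult:
  assumes "bounded_on_line a p" "bounded_on_line a q"
  shows "bounded_on_line a (\<lambda>z. p z * q z)"
proof -
  obtain P Q where "0 \<le> P" "\<And>z. Re z = a \<Longrightarrow> cmod (p z) \<le> P" "\<And>z. Re z = a \<Longrightarrow> cmod (q z) \<le> Q"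
    using assms by (metis bounded_on_lineE)
  hence "cmod (p z * q z) \<le> P * Q" if "Re z = a" for z
    using that unfolding norm_mult by (intro mult_mono) auto
  moreover have "continuous_on {z. Re z = a} (\<lambda>z. p z * q z)"
    using assms by (intro continuous_intros bounded_on_line_continuous)
  ultimately show ?thesis by (intro bounded_on_lineI)
qed

lemma bounded_on_line_inverse:
  assumes "Re w \<noteq> a"
  shows "bounded_on_line a (\<lambda>z. 1 / (z - w))"
proof (rule bounded_on_lineI)
  show "continuous_on {z. Re z = a} (\<lambda>z. 1 / (z - w))"
    by (intro continuous_intros) (use assms in auto)
  show "cmod (1 / (z - w)) \<le> 1 / \<bar>a - Re w\<bar>" if "Re z = a" for z
    using that assms abs_Re_le_cmod[of "z - w"]
    unfolding norm_divide norm_one by (intro divide_left_mono) (auto intro!: mult_pos_pos)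
qed

lemma bounded_on_line_power: "bounded_on_line a q \<Longrightarrow> bounded_on_line a (\<lambda>z. q z ^ n)"
  by (induction n) (auto intro: bounded_on_line_mult bounded_on_line_const)

lemma bounded_on_line_exp_weight:
  assumes "a < 1"
  shows "bounded_on_line a (exp_weight t)"
proof (rule bounded_on_lineI)
  let ?k = "inverse_square_const a"
  show "cmod (exp_weight t z) \<le> exp (t * a) * ?k" if "Re z = a" for z
  proof -
    have "exp (t * a) * ?k / (1 + (Im z)\<^sup>2) \<le> exp (t * a) * ?k / 1"
      using inverse_square_const_pos[OF assms]
      by (intro divide_left_mono) (auto intro: add_pos_nonneg)
    thus ?thesis using exp_weight_decay[of z a t] that assms by simp
  qed
qed (use assms in \<open>auto intro: continuous_on_exp_weight\<close>)

lemma exp_weight_mult_decay: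
  assumes "a < 1" "bounded_on_line a q"
  shows "\<exists>K\<ge>0. \<forall>\<beta>. cmod (exp_weight t (Complex a \<beta>) * q (Complex a \<beta>)) \<le> K / (1 + \<beta>\<^sup>2)"
proof -
  let ?k = "inverse_square_const a"
  have "0 < ?k" by (rule inverse_square_const_pos[OF assms(1)])
  obtain Q where "0 \<le> Q" and Q: "\<And>z. Re z = a \<Longrightarrow> cmod (q z) \<le> Q"
    using bounded_on_lineE[OF assms(2)] by blast
  have "cmod (exp_weight t (Complex a \<beta>) * q (Complex a \<beta>))
      \<le> exp (t * a) * ?k * Q / (1 + \<beta>\<^sup>2)" for \<beta>
  proof -
    have "cmod (exp_weight t (Complex a \<beta>) * q (Complex a \<beta>)) \<le> exp (t * a) * ?k / (1 + \<beta>\<^sup>2) * Q"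
      unfolding norm_mult
      using exp_weight_decay[of "Complex a \<beta>" a t] Q[of "Complex a \<beta>"] \<open>0 < ?k\<close> assms(1)
      by (intro mult_mono) auto
    thus ?thesis by simp
  qed
  thus ?thesis using \<open>0 < ?k\<close> \<open>0 \<le> Q\<close> by (intro exI[of _ "exp (t * a) * ?k * Q"]) auto
qed

lemma continuous_on_exp_weight_mult:
  assumes "a < 1" "bounded_on_line a q"
  shows "continuous_on {z. Re z = a} (\<lambda>z. exp_weight t z * q z)"
  using assms by (intro continuous_intros continuous_on_exp_weight bounded_on_line_continuous) auto

lemma bounded_on_line_exp_line_integrable:
  assumes "a < 1" "bounded_on_line a q"
  shows "exp_line_integrable a t q"
  unfolding exp_line_integrable_def
  using exp_weight_mult_decay[OF assms, of t] continuous_on_exp_weight_mult[OF assms, of t]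
    integrable_vertical_line by blast

lemma exp_line_cong:
  assumes "\<And>z. Re z = a \<Longrightarrow> p z = q z"
  shows "exp_line a t p = exp_line a t q"
  unfolding exp_line_def vertical_integral_def
  by (simp only: assms[of "Complex a _", OF complex.sel(1)])

lemma exp_line_diff:
  assumes "exp_line_integrable a t p" "exp_line_integrable a t q"
  shows "exp_line a t (\<lambda>z. p z - q z) = exp_line a t p - exp_line a t q"
  using assms unfolding exp_line_def vertical_integral_def exp_line_integrable_def right_diff_distrib
  by (rule Bochner_Integration.integral_diff)

lemma exp_line_cmult: "exp_line a t (\<lambda>z. c * q z) = c * exp_line a t q"
  unfolding exp_line_def vertical_integral_def mult.left_commute[of _ c]
  by (rule integral_mult_right_zero)

lemma exp_line_weight_mult:
  "exp_line a t (\<lambda>z. exp_weight s z * q z) = exp_line a (t + s) (\<lambda>z. (1 / (z - 1)) ^ 2 * q z)"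
  unfolding exp_line_def by (simp only: exp_weight_mult flip: mult.assoc)

(* For t > 0 the contour can be closed to the left. *)
lemma exp_line_eq_zero:
  assumes "0 < t" "a < 1" and q: "q holomorphic_on {z. Re z \<le> a}"
    and Q: "\<And>z. Re z \<le> a \<Longrightarrow> cmod (q z) \<le> Q"
  shows "exp_line a t q = 0"
proof -
  let ?k = "inverse_square_const a"
  have "0 < ?k" by (rule inverse_square_const_pos[OF \<open>a < 1\<close>])
  have "0 \<le> Q" using order.trans[OF norm_ge_zero Q[of "of_real a"]] by simp
  show ?thesis
    unfolding exp_line_def
  proof (rule vertical_integral_eq_zero[where k = "\<lambda>x. exp (t * x) * ?k * Q"])
    show "(\<lambda>z. exp_weight t z * q z) holomorphic_on {z. Re z \<le> a}"
      using \<open>a < 1\<close> by (intro holomorphic_intros holomorphic_exp_weight q) simp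
    show "cmod (exp_weight t z * q z) \<le> exp (t * Re z) * ?k * Q / (1 + (Im z)\<^sup>2)"
      if "Re z \<le> a" for z
    proof -
      have "cmod (exp_weight t z * q z) \<le> exp (t * Re z) * ?k / (1 + (Im z)\<^sup>2) * Q"
        unfolding norm_mult using \<open>0 < ?k\<close>
        by (intro mult_mono exp_weight_decay Q that \<open>a < 1\<close>) auto
      thus ?thesis by simp
    qed
    show "exp (t * x) * ?k * Q \<le> exp (t * a) * ?k * Q" if "x \<le> a" for x
      using that \<open>0 < t\<close> \<open>0 < ?k\<close> \<open>0 \<le> Q\<close> by (intro mult_right_mono) auto
    show "((\<lambda>x. exp (t * x) * ?k * Q) \<longlongrightarrow> 0) at_bot" using \<open>0 < t\<close> by real_asymp
  qed
qed

lemma exp_line_const: "0 < t \<Longrightarrow> a < 1 \<Longrightarrow> exp_line a t (\<lambda>_. c) = 0"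
  by (rule exp_line_eq_zero[where Q = "cmod c"]) auto

lemma exp_line_inverse_power:
  assumes "0 < t" "a < 1" "a < Re w"
  shows "exp_line a t (\<lambda>z. (1 / (z - w)) ^ n) = 0"
proof (rule exp_line_eq_zero[where Q = "(1 / (Re w - a)) ^ n"])
  show "(\<lambda>z. (1 / (z - w)) ^ n) holomorphic_on {z. Re z \<le> a}"
    using assms by (intro holomorphic_intros) auto
  show "cmod ((1 / (z - w)) ^ n) \<le> (1 / (Re w - a)) ^ n" if "Re z \<le> a" for z
  proof -
    have "Re w - a \<le> cmod (z - w)" using that abs_Re_le_cmod[of "z - w"] by simp
    thus ?thesis
      unfolding norm_power norm_divide norm_one
      using assms by (intro power_mono divide_left_mono) (auto intro!: mult_pos_pos)
  qed
qed (use assms in auto)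

lemma exp_line_cauchy_kernel:
  assumes "0 \<le> t" "Re z < b" "b < 1"
  shows "exp_line b t (\<lambda>w. 1 / (w - z)) = of_real (2 * pi) * exp_weight t z"
proof -
  let ?k = "inverse_square_const b"
  have "0 < ?k" by (rule inverse_square_const_pos[OF \<open>b < 1\<close>])
  have "vertical_integral b (\<lambda>w. exp_weight t w / (w - z)) = of_real (2 * pi) * exp_weight t z"
  proof (rule vertical_integral_cauchy_formula[OF _ \<open>Re z < b\<close>])
    show "exp_weight t holomorphic_on {w. Re w \<le> b}"
      using \<open>b < 1\<close> by (intro holomorphic_exp_weight) simp
    show "cmod (exp_weight t w) \<le> exp (t * b) * ?k / (1 + (Im w)\<^sup>2)" if "Re w \<le> b" for w
    proof (rule order.trans[OF exp_weight_decay[OF that \<open>b < 1\<close>]])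
      show "exp (t * Re w) * ?k / (1 + (Im w)\<^sup>2) \<le> exp (t * b) * ?k / (1 + (Im w)\<^sup>2)"
        using that \<open>0 \<le> t\<close> \<open>0 < ?k\<close>
        by (intro divide_right_mono mult_right_mono) (auto intro: mult_left_mono)
    qed
  qed
  thus ?thesis by (simp add: exp_line_def)
qed

lemma integrable_product_decay:
  fixes f :: "real \<times> real \<Rightarrow> 'b::{banach, second_countable_topology}"
  assumes f: "continuous_on UNIV f" and "0 \<le> K"
    and bound: "\<And>x y. norm (f (x, y)) \<le> K / ((1 + x\<^sup>2) * (1 + y\<^sup>2))"
  shows "integrable (lborel \<Otimes>\<^sub>M lborel) f"
proof (rule integrableI_bounded)
  show [measurable]: "f \<in> borel_measurable (lborel \<Otimes>\<^sub>M lborel)"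
    using borel_measurable_continuous_onI[OF f] by (simp add: lborel_prod)
  let ?u = "\<lambda>x::real. ennreal (1 / (1\<^sup>2 + x\<^sup>2))"
  have "(\<integral>\<^sup>+ p. ennreal (norm (f p)) \<partial>(lborel \<Otimes>\<^sub>M lborel))
      = (\<integral>\<^sup>+ x. \<integral>\<^sup>+ y. ennreal (norm (f (x, y))) \<partial>lborel \<partial>lborel)"
    by (rule lborel.nn_integral_fst[symmetric]) measurable
  also have "\<dots> \<le> (\<integral>\<^sup>+ x. \<integral>\<^sup>+ y. (ennreal K * ?u x) * ?u y \<partial>lborel \<partial>lborel)"
  proof (intro nn_integral_mono)
    fix x y :: real
    have "ennreal (norm (f (x, y))) \<le> ennreal (K / ((1 + x\<^sup>2) * (1 + y\<^sup>2)))"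
      by (intro ennreal_leI bound)
    also have "\<dots> = (ennreal K * ?u x) * ?u y" using \<open>0 \<le> K\<close> by (simp flip: ennreal_mult)
    finally show "ennreal (norm (f (x, y))) \<le> (ennreal K * ?u x) * ?u y" .
  qed
  also have "\<dots> = ennreal K * ennreal pi * ennreal pi"
    by (simp add: nn_integral_cmult nn_integral_multc nn_integral_poisson_kernel[of 1, simplified])
  also have "\<dots> < \<infinity>" by (simp add: ennreal_mult_less_top)
  finally show "(\<integral>\<^sup>+ p. ennreal (norm (f p)) \<partial>(lborel \<Otimes>\<^sub>M lborel)) < \<infinity>" .
qed

lemma exp_weight_kernel_integrable:
  assumes "a < 1" "b < 1"
    and Q: "continuous_on ({z. Re z = a} \<times> {w. Re w = b}) (\<lambda>p. Q (fst p) (snd p))"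
    and bound: "\<And>z w. Re z = a \<Longrightarrow> Re w = b \<Longrightarrow> cmod (Q z w) \<le> B"
  shows "integrable (lborel \<Otimes>\<^sub>M lborel) (\<lambda>(\<beta>, \<gamma>).
    exp_weight t (Complex a \<beta>) * (exp_weight s (Complex b \<gamma>) * Q (Complex a \<beta>) (Complex b \<gamma>)))"
  unfolding case_prod_beta
proof -
  obtain K L where "0 \<le> K" "0 \<le> L" and K: "\<And>\<beta>. cmod (exp_weight t (Complex a \<beta>)) \<le> K / (1 + \<beta>\<^sup>2)"
      and L: "\<And>\<gamma>. cmod (exp_weight s (Complex b \<gamma>)) \<le> L / (1 + \<gamma>\<^sup>2)"
    using exp_weight_mult_decay[OF \<open>a < 1\<close> bounded_on_line_const[of a 1], of t]
      exp_weight_mult_decay[OF \<open>b < 1\<close> bounded_on_line_const[of b 1], of s] by auto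
  have "0 \<le> B" using order.trans[OF norm_ge_zero bound[of "of_real a" "of_real b"]] by simp
  let ?k = "\<lambda>p. exp_weight t (Complex a (fst p)) *
    (exp_weight s (Complex b (snd p)) * Q (Complex a (fst p)) (Complex b (snd p)))"
  have weight: "continuous_on UNIV (\<lambda>\<beta>. exp_weight r (Complex c \<beta>))" if "c < 1" for r c
    using that by (intro continuous_on_vertical_line continuous_on_exp_weight) auto
  have "continuous_on UNIV (\<lambda>p. (Complex a (fst p), Complex b (snd p)))"
    unfolding Complex_eq by (intro continuous_intros)
  from continuous_on_compose2[OF Q this, unfolded fst_conv snd_conv]
  have "continuous_on UNIV (\<lambda>p. Q (Complex a (fst p)) (Complex b (snd p)))" by force
  hence "continuous_on UNIV ?k"
    by (intro continuous_on_mult continuous_on_compose2[OF weight continuous_on_fst]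
        continuous_on_compose2[OF weight continuous_on_snd] continuous_on_id assms) auto
  thus "integrable (lborel \<Otimes>\<^sub>M lborel) ?k"
  proof (rule integrable_product_decay)
    show "0 \<le> K * (L * B)" using \<open>0 \<le> K\<close> \<open>0 \<le> L\<close> \<open>0 \<le> B\<close> by simp
    fix \<beta> \<gamma> :: real
    have "cmod (?k (\<beta>, \<gamma>)) \<le> K / (1 + \<beta>\<^sup>2) * (L / (1 + \<gamma>\<^sup>2) * B)"
      unfolding fst_conv snd_conv norm_mult using K[of \<beta>] L[of \<gamma>] \<open>0 \<le> K\<close> \<open>0 \<le> L\<close> \<open>0 \<le> B\<close>
      by (intro mult_mono bound) auto
    thus "cmod (?k (\<beta>, \<gamma>)) \<le> K * (L * B) / ((1 + \<beta>\<^sup>2) * (1 + \<gamma>\<^sup>2))" by simp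
  qed
qed

lemma
  assumes "a < 1" "b < 1"
    and Q: "continuous_on ({z. Re z = a} \<times> {w. Re w = b}) (\<lambda>p. Q (fst p) (snd p))"
    and bound: "\<And>z w. Re z = a \<Longrightarrow> Re w = b \<Longrightarrow> cmod (Q z w) \<le> B"
  shows exp_line_swap: "exp_line a t (\<lambda>z. exp_line b s (Q z))
      = exp_line b s (\<lambda>w. exp_line a t (\<lambda>z. Q z w))"
    and exp_line_integrable_exp_line: "exp_line_integrable a t (\<lambda>z. exp_line b s (Q z))"
proof -
  let ?k = "\<lambda>\<beta> \<gamma>. exp_weight t (Complex a \<beta>) *
        (exp_weight s (Complex b \<gamma>) * Q (Complex a \<beta>) (Complex b \<gamma>))"
  note int = exp_weight_kernel_integrable[OF assms, of t s]
  have inner: "exp_weight t (Complex a \<beta>) * exp_line b s (Q (Complex a \<beta>))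
      = (LINT \<gamma>|lborel. ?k \<beta> \<gamma>)" for \<beta>
    by (simp add: exp_line_def vertical_integral_def)
  have outer: "exp_weight s (Complex b \<gamma>) * exp_line a t (\<lambda>z. Q z (Complex b \<gamma>))
      = (LINT \<beta>|lborel. ?k \<beta> \<gamma>)" for \<gamma>
    by (simp add: exp_line_def vertical_integral_def mult.left_commute[of "exp_weight t _"])
  show "exp_line a t (\<lambda>z. exp_line b s (Q z)) = exp_line b s (\<lambda>w. exp_line a t (\<lambda>z. Q z w))"
    unfolding exp_line_def[of a t "\<lambda>z. exp_line b s (Q z)"]
      exp_line_def[of b s "\<lambda>w. exp_line a t (\<lambda>z. Q z w)"]
      vertical_integral_def inner outer
    by (rule lborel_pair.Fubini_integral[OF int, symmetric])
  show "exp_line_integrable a t (\<lambda>z. exp_line b s (Q z))"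
    unfolding exp_line_integrable_def inner by (rule lborel_pair.integrable_fst[OF int])
qed

lemma
  assumes "a < b" "b < 1" and p: "bounded_on_line b p"
  shows exp_line_cauchy_transform_integrable:
      "exp_line_integrable a t (\<lambda>z. exp_line b s (\<lambda>w. p w * (1 / (w - z))))"
    and exp_line_cauchy_transform_eq_zero:
      "0 < t \<Longrightarrow> 0 < s \<Longrightarrow> exp_line a t (\<lambda>z. exp_line b s (\<lambda>w. p w * (1 / (w - z)))) = 0"
proof -
  have "a < 1" using assms by simp
  let ?Q = "\<lambda>z w. p w * (1 / (w - z))"
  obtain P where "0 \<le> P" and P: "\<And>w. Re w = b \<Longrightarrow> cmod (p w) \<le> P"
    using bounded_on_lineE[OF p] by blast
  have cont: "continuous_on ({z. Re z = a} \<times> {w. Re w = b}) (\<lambda>x. ?Q (fst x) (snd x))"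
    using \<open>a < b\<close>
    by (intro continuous_intros
        continuous_on_compose2[OF bounded_on_line_continuous[OF p] continuous_on_snd])
      auto
  have bound: "cmod (?Q z w) \<le> P * (1 / (b - a))" if "Re z = a" "Re w = b" for z w
  proof -
    have "b - a \<le> cmod (w - z)" using that abs_Re_le_cmod[of "w - z"] by simp
    hence "1 / cmod (w - z) \<le> 1 / (b - a)"
      using \<open>a < b\<close> by (intro divide_left_mono) (auto intro!: mult_pos_pos)
    thus ?thesis unfolding norm_mult norm_divide norm_one
      using \<open>0 \<le> P\<close> by (intro mult_mono P that) auto
  qed
  show "exp_line_integrable a t (\<lambda>z. exp_line b s (?Q z))"
    by (rule exp_line_integrable_exp_line[OF \<open>a < 1\<close> \<open>b < 1\<close> cont bound])
  assume "0 < t" "0 < s"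
  have "exp_line a t (\<lambda>z. exp_line b s (?Q z)) = exp_line b s (\<lambda>w. exp_line a t (\<lambda>z. ?Q z w))"
    by (rule exp_line_swap[OF \<open>a < 1\<close> \<open>b < 1\<close> cont bound])
  also have "\<dots> = exp_line b s (\<lambda>_. 0)"
  proof (rule exp_line_cong)
    fix w assume "Re w = b"
    have "?Q z w = - p w * (1 / (z - w)) ^ 1" for z by (simp add: divide_simps algebra_simps)
    thus "exp_line a t (\<lambda>z. ?Q z w) = 0"
      using exp_line_inverse_power[OF \<open>0 < t\<close> \<open>a < 1\<close>, of w 1] \<open>Re w = b\<close> \<open>a < b\<close>
      by (simp only: exp_line_cmult) simp
  qed
  also have "\<dots> = 0" by (rule exp_line_const[OF \<open>0 < s\<close> \<open>b < 1\<close>])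
  finally show "exp_line a t (\<lambda>z. exp_line b s (?Q z)) = 0" .
qed

(* The scalar form of the multiplicativity of the Dunford calculus: in the application
   (p z - p w) / (w - z) is the product of two resolvents. *)
lemma exp_line_resolvent_product:
  assumes "0 < t" "0 < s" "a < b" "b < 1" and p: "bounded_on_line a p" "bounded_on_line b p"
  shows "exp_line a t (\<lambda>z. exp_line b s (\<lambda>w. (p z - p w) / (w - z))) =
    of_real (2 * pi) * exp_line a (t + s) (\<lambda>z. (1 / (z - 1)) ^ 2 * p z)"
proof -
  have "a < 1" using assms by simp
  let ?g = "\<lambda>z. exp_line b s (\<lambda>w. p w * (1 / (w - z)))"
  let ?h = "\<lambda>z. of_real (2 * pi) * (exp_weight s z * p z)"
  have "exp_line b s (\<lambda>w. (p z - p w) / (w - z)) = ?h z - ?g z" if "Re z = a" for z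
  proof -
    have "bounded_on_line b (\<lambda>w. 1 / (w - z))"
      using that \<open>a < b\<close> by (intro bounded_on_line_inverse) simp
    hence "exp_line b s (\<lambda>w. p z * (1 / (w - z)) - p w * (1 / (w - z))) =
        p z * exp_line b s (\<lambda>w. 1 / (w - z)) - ?g z"
      using \<open>b < 1\<close> unfolding exp_line_cmult[symmetric]
      by (intro exp_line_diff bounded_on_line_exp_line_integrable bounded_on_line_mult
          bounded_on_line_const p)
    also have "exp_line b s (\<lambda>w. 1 / (w - z)) = of_real (2 * pi) * exp_weight s z"
      using that assms by (intro exp_line_cauchy_kernel) auto
    finally show ?thesis by (simp add: diff_divide_distrib mult_ac)
  qed
  hence "exp_line a t (\<lambda>z. exp_line b s (\<lambda>w. (p z - p w) / (w - z)))
      = exp_line a t (\<lambda>z. ?h z - ?g z)"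
    by (rule exp_line_cong)
  also have "\<dots> = exp_line a t ?h - exp_line a t ?g"
    using \<open>a < 1\<close>
    by (intro exp_line_diff exp_line_cauchy_transform_integrable bounded_on_line_exp_line_integrable
        bounded_on_line_mult bounded_on_line_const bounded_on_line_exp_weight assms)
  also have "exp_line a t ?g = 0" by (intro exp_line_cauchy_transform_eq_zero assms)
  finally show ?thesis by (simp add: exp_line_cmult exp_line_weight_mult)
qed

section \<open>The exponential functions in the calculus\<close>

abbreviation (input) exp_neg :: "real \<Rightarrow> complex \<Rightarrow> complex" where
  "exp_neg t \<equiv> \<lambda>z. exp (- (of_real t * z))"

lemma deriv_exp_neg: "deriv (exp_neg t) z = - of_real t * exp_neg t z"
  by (rule DERIV_imp_deriv) (auto intro!: derivative_eq_intros)

lemma set_integral_id_times_exp: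
  fixes c :: real
  assumes "0 < c"
  shows "(LINT x:{0<..}|lborel. x * exp (- (c * x))) = 1 / c\<^sup>2"
proof -
  let ?f = "\<lambda>x::real. x * exp (- x) * indicator {0<..} x"
  have "1 = \<bar>c\<bar> *\<^sub>R (LINT x|lborel. ?f (0 + c * x))"
    using has_bochner_integral_I0i_power_exp_m[of 1] lborel_integral_real_affine[of c ?f 0] assms
    by (simp add: has_bochner_integral_integral_eq)
  also have "(LINT x|lborel. ?f (0 + c * x))
      = (LINT x|lborel. c * (indicator {0<..} x *\<^sub>R (x * exp (- (c * x)))))"
    using assms by (intro Bochner_Integration.integral_cong)
      (auto simp: indicator_def zero_less_mult_iff)
  also have "\<dots> = c * (LINT x:{0<..}|lborel. x * exp (- (c * x)))"
    unfolding set_lebesgue_integral_def by (rule integral_mult_right_zero)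
  finally show ?thesis using assms by (simp add: field_simps power2_eq_square)
qed

context gsf_resolvent
begin

lemma bounded_on_line_R:
  assumes "0 < a" and \<phi>: "\<phi> \<in> dual_space"
  shows "bounded_on_line a (\<lambda>z. \<phi> (R z x))"
proof (rule bounded_on_lineI)
  show "continuous_on {z. Re z = a} (\<lambda>z. \<phi> (R z x))"
    by (rule continuous_on_subset[OF holomorphic_on_imp_continuous_on[OF holomorphic_R_dual[OF \<phi>]]])
      (use \<open>0 < a\<close> in \<open>auto simp: rhp_def\<close>)
  show "cmod (\<phi> (R z x)) \<le> onorm \<phi> * (C * norm x)" if "Re z = a" for z
    using that assms
    by (intro order.trans[OF dual_bound[OF \<phi>]] mult_left_mono R_uniform_bound
        dual_onorm_nonneg) auto
qed

lemma dual_R_core: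
  assumes z: "0 < Re z" "z \<noteq> 1" and \<phi>: "\<phi> \<in> dual_space"
  shows "\<phi> (R z (RR 1 x)) = (\<phi> (R z x) - \<phi> (R 1 x)) / (z - 1)\<^sup>2 + \<phi> (RR 1 x) / (z - 1)"
proof -
  have dual_R_R1: "\<phi> (R z (R 1 v)) = (\<phi> (R 1 v) - \<phi> (R z v)) / (z - 1)" for v
  proof -
    have "\<phi> (R z (R 1 v)) = 1 / (1 - z) * (\<phi> (R z v) - \<phi> (R 1 v))"
      using z \<phi> R_R_eq[of z 1 v] by (simp add: dual_cscale dual_diff)
    thus ?thesis using z by (simp add: divide_simps) (simp add: algebra_simps)
  qed
  show ?thesis
    unfolding dual_R_R1[of "R 1 x"] dual_R_R1[of x]
    by (simp add: diff_divide_distrib power2_eq_square)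
qed

lemma cmod_dual_RR_core_le:
  assumes z: "0 < Re z" and \<phi>: "\<phi> \<in> dual_space"
  shows "cmod (\<phi> (RR z (RR 1 x))) \<le> onorm \<phi> * (core_bound * norm x) / (1 + (Im z)\<^sup>2)"
proof -
  have "(Im z)\<^sup>2 \<le> (cmod z)\<^sup>2"
    using abs_Im_le_cmod[of z] by (metis abs_norm_cancel abs_le_square_iff)
  moreover have "(1 + cmod z)\<^sup>2 = 1 + 2 * cmod z + (cmod z)\<^sup>2" by (simp add: power2_sum)
  ultimately have "1 + (Im z)\<^sup>2 \<le> (1 + cmod z)\<^sup>2" using norm_ge_zero[of z] by linarith
  hence "core_bound * norm x / (1 + cmod z)\<^sup>2 \<le> core_bound * norm x / (1 + (Im z)\<^sup>2)"
    by (intro divide_left_mono mult_nonneg_nonneg mult_pos_pos zero_less_power core_bound_nonneg)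
      (auto intro: add_pos_nonneg)
  with RR_core_decay[OF z] have "norm (RR z (RR 1 x)) \<le> core_bound * norm x / (1 + (Im z)\<^sup>2)"
    by (rule order.trans)
  from mult_left_mono[OF this dual_onorm_nonneg[OF \<phi>]] dual_bound[OF \<phi>, of "RR z (RR 1 x)"]
  show ?thesis by simp
qed

lemma cmod_exp_dual_RR_core_le:
  assumes "0 < Re z" "Re z \<le> b" "0 \<le> t" and \<phi>: "\<phi> \<in> dual_space"
  shows "cmod (exp (of_real t * z) * \<phi> (RR z (RR 1 x)))
    \<le> exp (t * b) * (onorm \<phi> * (core_bound * norm x)) / (1 + (Im z)\<^sup>2)"
proof -
  have "cmod (exp (of_real t * z) * \<phi> (RR z (RR 1 x))) = exp (t * Re z) * cmod (\<phi> (RR z (RR 1 x)))"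
    by (simp add: norm_mult)
  also have "\<dots> \<le> exp (t * b) * (onorm \<phi> * (core_bound * norm x) / (1 + (Im z)\<^sup>2))"
    using assms by (intro mult_mono cmod_dual_RR_core_le) (auto intro: mult_left_mono)
  finally show ?thesis by simp
qed

lemma holomorphic_exp_dual_RR:
  "\<phi> \<in> dual_space \<Longrightarrow> (\<lambda>z. exp (of_real t * z) * \<phi> (RR z x)) holomorphic_on rhp"
  by (intro holomorphic_intros holomorphic_RR_dual)

lemma vertical_integral_exp_RR_core_independent:
  assumes "0 < a" "0 < b" "0 \<le> t" and \<phi>: "\<phi> \<in> dual_space"
  shows "vertical_integral a (\<lambda>z. exp (of_real t * z) * \<phi> (RR z (RR 1 x))) =
    vertical_integral b (\<lambda>z. exp (of_real t * z) * \<phi> (RR z (RR 1 x)))"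
proof -
  have shift: "vertical_integral b (\<lambda>z. exp (of_real t * z) * \<phi> (RR z (RR 1 x))) =
      vertical_integral a (\<lambda>z. exp (of_real t * z) * \<phi> (RR z (RR 1 x)))" if "0 < a" "a \<le> b" for a b
  proof (rule vertical_integral_shift[OF \<open>a \<le> b\<close>])
    show "(\<lambda>z. exp (of_real t * z) * \<phi> (RR z (RR 1 x))) holomorphic_on {z. a \<le> Re z \<and> Re z \<le> b}"
      by (rule holomorphic_on_subset[OF holomorphic_exp_dual_RR[OF \<phi>]])
        (use \<open>0 < a\<close> in \<open>auto simp: rhp_def\<close>)
    show "cmod (exp (of_real t * z) * \<phi> (RR z (RR 1 x)))
        \<le> exp (t * b) * (onorm \<phi> * (core_bound * norm x)) / (1 + (Im z)\<^sup>2)"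
      if "a \<le> Re z" "Re z \<le> b" for z
      using that \<open>0 < a\<close> by (intro cmod_exp_dual_RR_core_le \<open>0 \<le> t\<close> \<phi>) auto
  qed
  show ?thesis using shift[of a b] shift[of b a] assms by (cases "a \<le> b") auto
qed

lemma integrable_exp_RR_core:
  assumes "0 < a" "0 \<le> t" and \<phi>: "\<phi> \<in> dual_space"
  shows "integrable lborel (\<lambda>\<beta>. exp (of_real t * Complex a \<beta>) * \<phi> (RR (Complex a \<beta>) (RR 1 x)))"
proof (rule integrable_vertical_line[where F = "\<lambda>z. exp (of_real t * z) * \<phi> (RR z (RR 1 x))"])
  show "continuous_on {z. Re z = a} (\<lambda>z. exp (of_real t * z) * \<phi> (RR z (RR 1 x)))"
    by (rule continuous_on_subset[OF
        holomorphic_on_imp_continuous_on[OF holomorphic_exp_dual_RR[OF \<phi>]]])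
      (use \<open>0 < a\<close> in \<open>auto simp: rhp_def\<close>)
  show "cmod (exp (of_real t * Complex a \<beta>) * \<phi> (RR (Complex a \<beta>) (RR 1 x)))
      \<le> exp (t * a) * (onorm \<phi> * (core_bound * norm x)) / (1 + \<beta>\<^sup>2)" for \<beta>
    using cmod_exp_dual_RR_core_le[of "Complex a \<beta>" a t \<phi> x] assms by simp
qed

lemma exp_dual_R_core_has_derivative:
  assumes z: "0 < Re z" "z \<noteq> 1" and \<phi>: "\<phi> \<in> dual_space"
  shows "((\<lambda>z. exp (of_real t * z) * (\<phi> (R z (RR 1 x)) - \<phi> (RR 1 x) / (z - 1))) has_field_derivative
    of_real t * (exp_weight t z * (\<phi> (R z x) - \<phi> (R 1 x))) - exp (of_real t * z) * \<phi> (RR z (RR 1 x))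
      + \<phi> (RR 1 x) * exp_weight t z) (at z)"
proof -
  define y where "y = RR 1 x"
  have "((\<lambda>z. exp (of_real t * z) * (\<phi> (R z y) - \<phi> y / (z - 1))) has_field_derivative
      of_real t * exp (of_real t * z) * (\<phi> (R z y) - \<phi> y / (z - 1))
      + (- \<phi> (RR z y) + \<phi> y / (z - 1)\<^sup>2) * exp (of_real t * z)) (at z)"
    using z by (auto intro!: derivative_eq_intros R_dual_has_derivative \<phi> simp: power2_eq_square)
  moreover have "\<phi> (R z y) - \<phi> y / (z - 1) = (\<phi> (R z x) - \<phi> (R 1 x)) / (z - 1)\<^sup>2"
    by (simp add: y_def dual_R_core[OF z \<phi>])
  ultimately show ?thesis by (simp add: y_def exp_weight_def algebra_simps)
qed

(* Integration by parts on the line, applied to phi (R z y) minus its part phi y / (z - 1) that does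
   not decay fast enough; the contribution of that part vanishes. *)
lemma vertical_integral_exp_RR_core:
  assumes "0 < t" and a: "0 < a" "a < 1" and \<phi>: "\<phi> \<in> dual_space"
  shows "vertical_integral a (\<lambda>z. exp (of_real t * z) * \<phi> (RR z (RR 1 x)))
    = of_real t * exp_line a t (\<lambda>z. \<phi> (R z x))"
proof -
  define y where "y = RR 1 x"
  let ?q = "\<lambda>z. \<phi> (R z x) - \<phi> (R 1 x)"
  let ?E = "\<lambda>z. exp (of_real t * z) * \<phi> (RR z y)"
  let ?F = "\<lambda>z. exp (of_real t * z) * (\<phi> (R z y) - \<phi> y / (z - 1))"
  let ?F' = "\<lambda>z. of_real t * (exp_weight t z * ?q z) - ?E z + \<phi> y * exp_weight t z"
  have q: "bounded_on_line a ?q"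
    by (intro bounded_on_line_diff bounded_on_line_R bounded_on_line_const a \<phi>)
  have int: "integrable lborel (\<lambda>\<beta>. ?E (Complex a \<beta>))"
      "integrable lborel (\<lambda>\<beta>. exp_weight t (Complex a \<beta>) * ?q (Complex a \<beta>))"
      "integrable lborel (\<lambda>\<beta>. exp_weight t (Complex a \<beta>))"
    using integrable_exp_RR_core[OF a(1) less_imp_le[OF \<open>0 < t\<close>] \<phi>, of x]
      bounded_on_line_exp_line_integrable[OF a(2) q, of t]
      bounded_on_line_exp_line_integrable[OF a(2) bounded_on_line_const[of a 1], of t]
    by (simp_all add: exp_line_integrable_def y_def)
  have "vertical_integral a ?F' = 0"
  proof -
    obtain K where K: "\<And>\<beta>. cmod (exp_weight t (Complex a \<beta>) * ?q (Complex a \<beta>)) \<le> K / (1 + \<beta>\<^sup>2)"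
      using exp_weight_mult_decay[OF a(2) q] by blast
    have off_pole: "0 < Re (Complex a \<beta>)" "Complex a \<beta> \<noteq> 1" for \<beta>
      using a by (auto simp: complex_eq_iff)
    show ?thesis
    proof (rule vertical_integral_deriv_eq_zero[where F = ?F])
      show "(?F has_field_derivative ?F' (Complex a \<beta>)) (at (Complex a \<beta>))" for \<beta>
        unfolding y_def by (intro exp_dual_R_core_has_derivative off_pole \<phi>)
      show "cmod (?F (Complex a \<beta>)) \<le> K / (1 + \<beta>\<^sup>2)" for \<beta>
        using K[of \<beta>] by (simp add: y_def dual_R_core[OF off_pole \<phi>] exp_weight_def)
    qed (use int in simp)
  qed
  moreover have "vertical_integral a ?F' =
      of_real t * exp_line a t ?q - vertical_integral a ?E + \<phi> y * exp_line a t (\<lambda>_. 1)"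
    unfolding exp_line_def vertical_integral_def using int by simp
  moreover have "exp_line a t ?q = exp_line a t (\<lambda>z. \<phi> (R z x)) - exp_line a t (\<lambda>_. \<phi> (R 1 x))"
    using a by (intro exp_line_diff bounded_on_line_exp_line_integrable bounded_on_line_R
        bounded_on_line_const \<phi>)
  ultimately show ?thesis using exp_line_const[OF \<open>0 < t\<close> a(2)] by (simp add: y_def)
qed

lemma integral_RR_deriv_exp_neg:
  "(LINT \<beta>|lborel. \<phi> (RR (Complex \<alpha> (- \<beta>)) x) * deriv (exp_neg t) (Complex \<alpha> \<beta>)) =
    - of_real t * of_real (exp (- (2 * t * \<alpha>))) * vertical_integral \<alpha>
      (\<lambda>z. exp (of_real t * z) * \<phi> (RR z x))"
proof -
  have "exp (- (of_real t * Complex \<alpha> (- \<beta>))) =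
      of_real (exp (- (2 * t * \<alpha>))) * exp (of_real t * Complex \<alpha> \<beta>)" for \<beta>
  proof -
    have "- (of_real t * Complex \<alpha> (- \<beta>)) = of_real (- (2 * t * \<alpha>)) + of_real t * Complex \<alpha> \<beta>"
      by (simp add: complex_eq_iff)
    thus ?thesis by (metis exp_add exp_of_real)
  qed
  hence "\<phi> (RR (Complex \<alpha> \<beta>) x) * deriv (exp_neg t) (Complex \<alpha> (- \<beta>)) =
      - of_real t * of_real (exp (- (2 * t * \<alpha>))) *
        (exp (of_real t * Complex \<alpha> \<beta>) * \<phi> (RR (Complex \<alpha> \<beta>) x))" for \<beta>
    by (simp add: deriv_exp_neg)
  moreover have "(LINT \<beta>|lborel. \<phi> (RR (Complex \<alpha> (- \<beta>)) x) * deriv (exp_neg t) (Complex \<alpha> \<beta>)) =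
      (LINT \<beta>|lborel. \<phi> (RR (Complex \<alpha> \<beta>) x) * deriv (exp_neg t) (Complex \<alpha> (- \<beta>)))"
    by (subst lborel_integral_real_affine[where c = "- 1" and t = 0]) simp_all
  ultimately show ?thesis
    unfolding vertical_integral_def by (simp only: integral_mult_right_zero)
qed

lemma B_form_exp_core:
  assumes "0 < t" and b: "0 < b" "b < 1" and \<phi>: "\<phi> \<in> dual_space"
  shows "- of_real (2 / pi) * B_form (exp_neg t) \<phi> (RR 1 x)
    = exp_line b t (\<lambda>z. \<phi> (R z x)) / of_real (2 * pi)"
proof -
  define V where "V = vertical_integral b (\<lambda>z. exp (of_real t * z) * \<phi> (RR z (RR 1 x)))"
  have "indicator {0<..} \<alpha> *\<^sub>R (of_real \<alpha> *
      (LINT \<beta>|lborel. \<phi> (RR (Complex \<alpha> (- \<beta>)) (RR 1 x)) * deriv (exp_neg t) (Complex \<alpha> \<beta>))) =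
      - of_real t * V * of_real (indicator {0<..} \<alpha> *\<^sub>R (\<alpha> * exp (- (2 * t * \<alpha>))))" for \<alpha>
    using vertical_integral_exp_RR_core_independent[OF _ b(1) _ \<phi>, of \<alpha> t x] \<open>0 < t\<close>
    by (simp add: integral_RR_deriv_exp_neg V_def indicator_def)
  hence "B_form (exp_neg t) \<phi> (RR 1 x) =
      - of_real t * V * of_real (LINT \<alpha>:{0<..}|lborel. \<alpha> * exp (- (2 * t * \<alpha>)))"
    unfolding B_form_def set_lebesgue_integral_def
    by (simp only: integral_mult_right_zero integral_complex_of_real)
  also have "(LINT \<alpha>:{0<..}|lborel. \<alpha> * exp (- (2 * t * \<alpha>))) = 1 / (2 * t)\<^sup>2"
    using \<open>0 < t\<close> by (intro set_integral_id_times_exp) simp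
  also have "V = of_real t * exp_line b t (\<lambda>z. \<phi> (R z x))"
    unfolding V_def by (rule vertical_integral_exp_RR_core[OF \<open>0 < t\<close> b \<phi>])
  finally show ?thesis using \<open>0 < t\<close> by (simp add: field_simps power2_eq_square)
qed

end

lemma val_infty_eqI:
  assumes "(f \<longlongrightarrow> l) (filtercomap Re at_top)"
  shows "val_infty f = l"
proof -
  have "filtercomap Re at_top \<noteq> (bot :: complex filter)"
    by (intro filtercomap_neq_bot_surj) (auto simp: surj_def intro: complex.sel(1)[symmetric])
  thus ?thesis unfolding val_infty_def using assms by (rule tendsto_Lim)
qed

lemma val_infty_exp_neg:
  assumes "0 < t"
  shows "val_infty (exp_neg t) = 0"
proof (rule val_infty_eqI, rule tendsto_norm_zero_cancel)
  have "((\<lambda>x. exp (- (t * x))) \<longlongrightarrow> 0) at_top" using assms by real_asymp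
  hence "((\<lambda>z. exp (- (t * Re z))) \<longlongrightarrow> 0) (filtercomap Re at_top)"
    by (rule filterlim_compose[OF _ filterlim_filtercomap])
  thus "((\<lambda>z. cmod (exp_neg t z)) \<longlongrightarrow> 0) (filtercomap Re at_top)" by simp
qed

section \<open>The semigroup law\<close>

context gsf_resolvent
begin

definition calc_rep :: "(complex \<Rightarrow> complex) \<Rightarrow> ('a \<Rightarrow> 'a) \<Rightarrow> bool" where
  "calc_rep f T \<longleftrightarrow> bounded_linear T \<and>
     (\<forall>x. \<forall>\<phi>\<in>dual_space. \<phi> (T x) = val_infty f * \<phi> x - of_real (2 / pi) * B_form f \<phi> x)"

lemma calc_rep_bounded_linear: "calc_rep f T \<Longrightarrow> bounded_linear T"
  and calc_rep_eq:
    "calc_rep f T \<Longrightarrow> \<phi> \<in> dual_space \<Longrightarrow> \<phi> (T x) = val_infty f * \<phi> x - of_real (2 / pi) * B_form f \<phi> x"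
  unfolding calc_rep_def by blast+

lemma calc_rep_unique: "calc_rep f S \<Longrightarrow> calc_rep f T \<Longrightarrow> S = T"
  by (intro ext dual_separates) (simp only: calc_rep_eq)

lemma B_form_comp_R:
  assumes z: "0 < Re z"
  shows "B_form f (\<lambda>x. \<phi> (R z x)) x = B_form f \<phi> (R z x)"
proof -
  have "R z (RR w x) = RR w (R z x)" if "0 < Re w" for w
    using z that by (metis R_commute)
  thus ?thesis
    unfolding B_form_def set_lebesgue_integral_def
    by (intro Bochner_Integration.integral_cong refl) (auto simp: indicator_def)
qed

lemma calc_rep_commute:
  assumes T: "calc_rep f T" and z: "0 < Re z"
  shows "R z (T x) = T (R z x)"
proof (rule dual_separates)
  fix \<phi> :: "'a \<Rightarrow> complex" assume \<phi>: "\<phi> \<in> dual_space"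
  have "\<phi> (R z (T x)) = val_infty f * \<phi> (R z x) - of_real (2 / pi) * B_form f (\<lambda>x. \<phi> (R z x)) x"
    by (rule calc_rep_eq[OF T dual_comp_R[OF z \<phi>]])
  thus "\<phi> (R z (T x)) = \<phi> (T (R z x))"
    unfolding B_form_comp_R[OF z] calc_rep_eq[OF T \<phi>, of "R z x"] .
qed

lemma calc_rep_exp_core:
  assumes T: "calc_rep (exp_neg t) T" and "0 < t" and b: "0 < b" "b < 1" and \<phi>: "\<phi> \<in> dual_space"
  shows "\<phi> (T (RR 1 x)) = exp_line b t (\<lambda>z. \<phi> (R z x)) / of_real (2 * pi)"
  unfolding calc_rep_eq[OF T \<phi>] val_infty_exp_neg[OF \<open>0 < t\<close>]
    B_form_exp_core[OF \<open>0 < t\<close> b \<phi>, of x, symmetric]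
  by simp

lemma exp_line_R_core:
  assumes "0 < t" and a: "0 < a" "a < 1" and \<phi>: "\<phi> \<in> dual_space"
  shows "exp_line a t (\<lambda>z. \<phi> (R z (RR 1 x))) = exp_line a t (\<lambda>z. (1 / (z - 1)) ^ 2 * \<phi> (R z x))"
proof -
  let ?u = "\<lambda>z::complex. 1 / (z - 1)"
  have u: "bounded_on_line a (\<lambda>z. ?u z ^ n)" for n
    using a by (intro bounded_on_line_power bounded_on_line_inverse) simp
  have u_line: "exp_line a t (\<lambda>z. c * ?u z ^ n) = 0" for c n
    unfolding exp_line_cmult using exp_line_inverse_power[OF \<open>0 < t\<close> a(2), of 1 n] a(2) by simp
  have int: "exp_line_integrable a t (\<lambda>z. ?u z ^ 2 * \<phi> (R z x))"
      "exp_line_integrable a t (\<lambda>z. c * ?u z ^ n)"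
      "exp_line_integrable a t (\<lambda>z. ?u z ^ 2 * \<phi> (R z x) - c * ?u z ^ n)" for c n
    using a by (intro bounded_on_line_exp_line_integrable bounded_on_line_diff bounded_on_line_mult
        bounded_on_line_const bounded_on_line_R u \<phi>; simp)+
  have "exp_line a t (\<lambda>z. \<phi> (R z (RR 1 x))) =
      exp_line a t (\<lambda>z. ?u z ^ 2 * \<phi> (R z x) - \<phi> (R 1 x) * ?u z ^ 2 - - \<phi> (RR 1 x) * ?u z ^ 1)"
  proof (rule exp_line_cong)
    fix z assume "Re z = a"
    hence "0 < Re z" "z \<noteq> 1" using a by auto
    thus "\<phi> (R z (RR 1 x)) = ?u z ^ 2 * \<phi> (R z x) - \<phi> (R 1 x) * ?u z ^ 2 - - \<phi> (RR 1 x) * ?u z ^ 1"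
      by (simp add: dual_R_core \<phi> diff_divide_distrib power_divide)
  qed
  also have "\<dots> = exp_line a t (\<lambda>z. ?u z ^ 2 * \<phi> (R z x)) - exp_line a t (\<lambda>z. \<phi> (R 1 x) * ?u z ^ 2)
      - exp_line a t (\<lambda>z. - \<phi> (RR 1 x) * ?u z ^ 1)"
    by (simp only: exp_line_diff int)
  finally show ?thesis by (simp only: u_line) simp
qed

lemma calc_rep_exp_product_on_core:
  assumes "0 < t" "0 < s" and T: "calc_rep (exp_neg t) T" and S: "calc_rep (exp_neg s) S"
    and U: "calc_rep (exp_neg (t + s)) U"
  shows "T (S (RR 1 (RR 1 x))) = U (RR 1 (RR 1 x))"
proof (rule dual_separates)
  fix \<phi> :: "'a \<Rightarrow> complex" assume \<phi>: "\<phi> \<in> dual_space"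
  let ?p = "\<lambda>z. \<phi> (R z x)" and ?c = "of_real (2 * pi) :: complex"
  define a b :: real where "a = 1 / 3" and "b = 2 / 3"
  have ab: "0 < a" "a < b" "b < 1" "a < 1" "0 < b" by (auto simp: a_def b_def)
  have "S (RR 1 (RR 1 x)) = RR 1 (S (RR 1 x))" by (simp add: calc_rep_commute[OF S])
  hence "\<phi> (T (S (RR 1 (RR 1 x)))) = exp_line a t (\<lambda>z. \<phi> (R z (S (RR 1 x)))) / ?c"
    using calc_rep_exp_core[OF T \<open>0 < t\<close> ab(1,4) \<phi>] by simp
  also have "exp_line a t (\<lambda>z. \<phi> (R z (S (RR 1 x)))) =
      exp_line a t (\<lambda>z. (1 / ?c) * exp_line b s (\<lambda>w. (?p z - ?p w) / (w - z)))"
  proof (rule exp_line_cong)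
    fix z assume z: "Re z = a"
    have "\<phi> (R z (S (RR 1 x))) = exp_line b s (\<lambda>w. \<phi> (R z (R w x))) / ?c"
      using z ab by (intro calc_rep_exp_core[OF S \<open>0 < s\<close> ab(5,3)] dual_comp_R \<phi>) simp
    also have "exp_line b s (\<lambda>w. \<phi> (R z (R w x))) = exp_line b s (\<lambda>w. (?p z - ?p w) / (w - z))"
    proof (rule exp_line_cong)
      fix w assume "Re w = b"
      hence "R z (R w x) = cscale (1 / (w - z)) (R z x - R w x)"
        using z ab by (intro R_R_eq) auto
      thus "\<phi> (R z (R w x)) = (?p z - ?p w) / (w - z)" using \<phi> by (simp add: dual_cscale dual_diff)
    qed
    finally show "\<phi> (R z (S (RR 1 x))) = (1 / ?c) * exp_line b s (\<lambda>w. (?p z - ?p w) / (w - z))"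
      by simp
  qed
  also have "\<dots> = exp_line a (t + s) (\<lambda>z. (1 / (z - 1)) ^ 2 * ?p z)"
    unfolding exp_line_cmult
    by (subst exp_line_resolvent_product[OF \<open>0 < t\<close> \<open>0 < s\<close> ab(2,3)])
      (use ab \<phi> in \<open>auto intro: bounded_on_line_R\<close>)
  also have "\<dots> = exp_line a (t + s) (\<lambda>z. \<phi> (R z (RR 1 x)))"
    using \<open>0 < t\<close> \<open>0 < s\<close> by (intro exp_line_R_core[symmetric] ab \<phi>) simp
  also have "\<dots> / ?c = \<phi> (U (RR 1 (RR 1 x)))"
    using \<open>0 < t\<close> \<open>0 < s\<close> by (intro calc_rep_exp_core[OF U _ ab(1,4) \<phi>, symmetric]) simp
  finally show "\<phi> (T (S (RR 1 (RR 1 x)))) = \<phi> (U (RR 1 (RR 1 x)))" .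
qed

lemma calc_rep_exp_semigroup:
  assumes "0 < t" "0 < s" and T: "calc_rep (exp_neg t) T" and S: "calc_rep (exp_neg s) S"
    and U: "calc_rep (exp_neg (t + s)) U"
  shows "T (S x) = U x"
proof -
  have "closure (range (\<lambda>x. RR 1 (RR 1 x))) \<subseteq> {x. T (S x) = U x}"
  proof (rule closure_minimal)
    show "closed {x. T (S x) = U x}"
      by (intro closed_Collect_eq continuous_on_id
          bounded_linear.continuous_on[OF calc_rep_bounded_linear[OF T]]
          bounded_linear.continuous_on[OF calc_rep_bounded_linear[OF S]]
          bounded_linear.continuous_on[OF calc_rep_bounded_linear[OF U]])
  qed (use calc_rep_exp_product_on_core[OF assms] in auto)
  thus ?thesis unfolding dense_range_RR1_RR1 by auto
qed

end

section \<open>Dilations and decay\<close>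

lemma val_infty_dilate:
  assumes "0 < t"
  shows "val_infty (\<lambda>z. f (of_real t * z)) = val_infty f"
proof -
  have scale: "filterlim (\<lambda>z. of_real r * z) (filtercomap Re at_top) (filtercomap Re at_top)"
    if "0 < r" for r :: real
  proof -
    have "filterlim (\<lambda>x::real. r * x) at_top at_top" using that by real_asymp
    hence "filterlim (\<lambda>z. r * Re z) at_top (filtercomap Re at_top)"
      by (rule filterlim_compose[OF _ filterlim_filtercomap])
    thus ?thesis by (simp add: filterlim_filtercomap_iff o_def)
  qed
  have "((\<lambda>z. f (of_real t * z)) \<longlongrightarrow> l) (filtercomap Re at_top) \<longleftrightarrow>
      (f \<longlongrightarrow> l) (filtercomap Re at_top)" for l
  proof
    assume "((\<lambda>z. f (of_real t * z)) \<longlongrightarrow> l) (filtercomap Re at_top)"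
    from filterlim_compose[OF this scale[of "1 / t"]] show "(f \<longlongrightarrow> l) (filtercomap Re at_top)"
      using assms by (simp add: mult.assoc[symmetric] flip: of_real_mult)
  next
    assume "(f \<longlongrightarrow> l) (filtercomap Re at_top)"
    thus "((\<lambda>z. f (of_real t * z)) \<longlongrightarrow> l) (filtercomap Re at_top)"
      by (rule filterlim_compose[OF _ scale[OF assms]])
  qed
  thus ?thesis unfolding val_infty_def Topological_Spaces.Lim_def by simp
qed

lemma holomorphic_dilate:
  assumes f: "f holomorphic_on rhp" and "0 < t"
  shows "(\<lambda>z. f (of_real t * z)) holomorphic_on rhp"
proof -
  have "f \<circ> (\<lambda>z. of_real t * z) holomorphic_on rhp"
    using \<open>0 < t\<close>
    by (intro holomorphic_on_compose_gen[OF _ f] holomorphic_intros) (auto simp: rhp_def)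
  thus ?thesis by (simp add: o_def)
qed

lemma deriv_dilate:
  assumes f: "f holomorphic_on rhp" and "0 < t" "0 < Re z"
  shows "deriv (\<lambda>z. f (of_real t * z)) z = of_real t * deriv f (of_real t * z)"
proof (rule DERIV_imp_deriv)
  have "(f has_field_derivative deriv f (of_real t * z)) (at (of_real t * z))"
    using assms by (intro holomorphic_derivI[OF f open_rhp]) (simp add: rhp_def)
  moreover have "((\<lambda>z. of_real t * z) has_field_derivative of_real t) (at z)"
    by (auto intro!: derivative_eq_intros)
  ultimately show "((\<lambda>z. f (of_real t * z)) has_field_derivative
      of_real t * deriv f (of_real t * z)) (at z)"
    using DERIV_chain2[of f "deriv f (of_real t * z)" "\<lambda>z. of_real t * z"]
    by (simp add: mult.commute)
qed

lemma deriv_sup_dilate_le: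
  assumes f: "f holomorphic_on rhp" and "0 < t" "0 < \<alpha>"
  shows "deriv_sup (\<lambda>z. f (of_real t * z)) \<alpha> \<le> ennreal t * deriv_sup f (t * \<alpha>)"
  unfolding deriv_sup_def[of "\<lambda>z. f (of_real t * z)"]
proof (rule SUP_least)
  fix \<beta> :: real
  have "of_real t * Complex \<alpha> \<beta> = Complex (t * \<alpha>) (t * \<beta>)" by (simp add: complex_eq_iff)
  hence "cmod (deriv (\<lambda>z. f (of_real t * z)) (Complex \<alpha> \<beta>))
      = t * cmod (deriv f (Complex (t * \<alpha>) (t * \<beta>)))"
    using assms by (simp add: deriv_dilate norm_mult)
  thus "ennreal (cmod (deriv (\<lambda>z. f (of_real t * z)) (Complex \<alpha> \<beta>)))
      \<le> ennreal t * deriv_sup f (t * \<alpha>)"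
    using \<open>0 < t\<close> by (simp add: ennreal_mult mult_left_mono deriv_sup_upper)
qed

lemma nn_integral_deriv_sup_dilate_le:
  assumes f: "f holomorphic_on rhp" and "0 < t" and g: "g \<in> borel_measurable borel"
  shows "(\<integral>\<^sup>+ \<alpha>. g (t * \<alpha>) * (indicator {0<..} \<alpha> * deriv_sup (\<lambda>z. f (of_real t * z)) \<alpha>) \<partial>lborel)
    \<le> (\<integral>\<^sup>+ s. g s * (indicator {0<..} s * deriv_sup f s) \<partial>lborel)"
proof -
  let ?h = "\<lambda>s. g s * (indicator {0<..} s * deriv_sup f s)"
  have h: "?h \<in> borel_measurable borel"
    by (intro borel_measurable_times_ennreal g borel_measurable_deriv_sup f)
  have "g (t * \<alpha>) * (indicator {0<..} \<alpha> * deriv_sup (\<lambda>z. f (of_real t * z)) \<alpha>)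
      \<le> ennreal t * ?h (0 + t * \<alpha>)" for \<alpha>
  proof (cases "0 < \<alpha>")
    case True
    have "g (t * \<alpha>) * deriv_sup (\<lambda>z. f (of_real t * z)) \<alpha>
        \<le> g (t * \<alpha>) * (ennreal t * deriv_sup f (t * \<alpha>))"
      by (intro mult_left_mono deriv_sup_dilate_le f \<open>0 < t\<close> True) simp
    thus ?thesis using True \<open>0 < t\<close> by (simp add: mult_ac)
  qed simp
  hence "(\<integral>\<^sup>+ \<alpha>. g (t * \<alpha>) * (indicator {0<..} \<alpha> * deriv_sup (\<lambda>z. f (of_real t * z)) \<alpha>) \<partial>lborel)
      \<le> (\<integral>\<^sup>+ \<alpha>. ennreal t * ?h (0 + t * \<alpha>) \<partial>lborel)" by (intro nn_integral_mono)
  also have "\<dots> = ennreal t * (\<integral>\<^sup>+ \<alpha>. ?h (0 + t * \<alpha>) \<partial>lborel)"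
    by (rule nn_integral_cmult, rule measurable_compose[OF _ h]) simp
  also have "\<dots> = (\<integral>\<^sup>+ s. ?h s \<partial>lborel)"
    using nn_integral_real_affine[OF h, of t 0] \<open>0 < t\<close> by simp
  finally show ?thesis .
qed

lemma B0_norm_dilate_le:
  "f holomorphic_on rhp \<Longrightarrow> 0 < t \<Longrightarrow> B0_norm (\<lambda>z. f (of_real t * z)) \<le> B0_norm f"
  using nn_integral_deriv_sup_dilate_le[of f t "\<lambda>_. 1"] by (simp add: B0_norm_def)

lemma weighted_B0_norm_dilate_le:
  assumes "f holomorphic_on rhp" "0 < t"
  shows "weighted_B0_norm 1 (\<lambda>z. f (of_real t * z)) \<le> weighted_B0_norm t f"
proof -
  have "t * \<alpha> / (t * \<alpha> + t) = \<alpha> / (\<alpha> + 1)" for \<alpha>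
  proof -
    have "t * \<alpha> + t = t * (\<alpha> + 1)" by (simp add: algebra_simps)
    thus ?thesis using \<open>0 < t\<close> by simp
  qed
  thus ?thesis
    using nn_integral_deriv_sup_dilate_le[OF assms, of "\<lambda>s. ennreal (s / (s + t))"]
    by (simp add: weighted_B0_norm_def)
qed

lemma weighted_B0_norm_tendsto_zero:
  assumes f: "f holomorphic_on rhp" and fin: "B0_norm f < \<infinity>"
  shows "((\<lambda>t. weighted_B0_norm t f) \<longlongrightarrow> 0) at_top"
proof (rule tendsto_at_topI_sequentially)
  let ?D = "\<lambda>s. indicator {0<..} s * deriv_sup f s"
  have D [measurable]: "?D \<in> borel_measurable lborel" using borel_measurable_deriv_sup[OF f] by simp
  have D_fin: "(\<integral>\<^sup>+ s. ?D s \<partial>lborel) < \<infinity>" using fin by (simp add: B0_norm_def)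
  fix X :: "nat \<Rightarrow> real" assume X: "filterlim X at_top sequentially"
  hence "\<forall>\<^sub>F n in sequentially. 0 \<le> X n" by (simp add: filterlim_at_top)
  then obtain N where N: "\<And>n. N \<le> n \<Longrightarrow> 0 \<le> X n" by (auto simp: eventually_sequentially)
  have XN: "filterlim (\<lambda>n. X (n + N)) at_top sequentially"
    using X by (rule filterlim_compose) (rule filterlim_add_const_nat_at_top)
  have "(\<lambda>n. \<integral>\<^sup>+ s. ennreal (s / (s + X (n + N))) * ?D s \<partial>lborel)
      \<longlonglongrightarrow> (\<integral>\<^sup>+ s. 0 \<partial>(lborel :: real measure))"
  proof (rule nn_integral_dominated_convergence[where w = ?D])
    show "AE s in lborel. ennreal (s / (s + X (n + N))) * ?D s \<le> ?D s" for n
      by (intro AE_I2 weighted_deriv_sup_le N) simp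
    have "AE s in lborel. ?D s \<noteq> \<infinity>" using D_fin D by (intro nn_integral_noteq_infinite) auto
    thus "AE s in lborel. (\<lambda>n. ennreal (s / (s + X (n + N))) * ?D s) \<longlonglongrightarrow> 0"
    proof eventually_elim
      case (elim s)
      have "((\<lambda>x. s / (s + x)) \<longlongrightarrow> 0) at_top" by real_asymp
      from tendsto_ennrealI[OF filterlim_compose[OF this XN]]
      have "(\<lambda>n. ennreal (s / (s + X (n + N))) * ?D s) \<longlonglongrightarrow> ennreal 0 * ?D s"
        using elim by (intro tendsto_mult_ennreal tendsto_const) auto
      thus ?case by simp
    qed
  qed (use D_fin in auto)
  hence "(\<lambda>n. weighted_B0_norm (X (n + N)) f) \<longlonglongrightarrow> 0" by (simp add: weighted_B0_norm_def)
  thus "(\<lambda>n. weighted_B0_norm (X n) f) \<longlonglongrightarrow> 0" by (rule LIMSEQ_offset)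
qed

lemma deriv_sup_exp_neg_le:
  assumes "0 < t"
  shows "deriv_sup (exp_neg t) \<alpha> \<le> ennreal (t * exp (- t * \<alpha>))"
  unfolding deriv_sup_def deriv_exp_neg using assms
  by (intro SUP_least ennreal_leI) (simp add: norm_mult)

lemma B0_norm_exp_neg_le:
  assumes "0 < t"
  shows "B0_norm (exp_neg t) \<le> 1"
proof -
  have "B0_norm (exp_neg t) \<le> (\<integral>\<^sup>+ \<alpha>. ennreal (t * exp (- t * \<alpha>)) * indicator {0..} \<alpha> \<partial>lborel)"
    unfolding B0_norm_def using deriv_sup_exp_neg_le[OF assms]
    by (intro nn_integral_mono) (auto simp: indicator_def)
  also have "\<dots> = ennreal (0 - (- exp (- t * 0)))"
  proof (rule nn_integral_FTC_atLeast)
    show "((\<lambda>\<alpha>. - exp (- t * \<alpha>)) has_real_derivative t * exp (- t * \<alpha>)) (at \<alpha>)" for \<alpha>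
      by (auto intro!: derivative_eq_intros)
    show "((\<lambda>\<alpha>. - exp (- t * \<alpha>)) \<longlongrightarrow> 0) at_top" using assms by real_asymp
  qed (use assms in auto)
  finally show ?thesis by simp
qed

lemma exp_decay_of_submultiplicative:
  fixes N :: "real \<Rightarrow> real"
  assumes nonneg: "\<And>t. 0 \<le> t \<Longrightarrow> 0 \<le> N t" and bounded: "\<And>t. 0 \<le> t \<Longrightarrow> N t \<le> M"
    and submult: "\<And>t s. 0 \<le> t \<Longrightarrow> 0 \<le> s \<Longrightarrow> N (t + s) \<le> N t * N s"
    and lim: "(N \<longlongrightarrow> 0) at_top"
  shows "\<exists>M \<omega>. \<omega> > 0 \<and> (\<forall>t\<ge>0. N t \<le> M * exp (- \<omega> * t))"
proof -
  have "\<forall>\<^sub>F t in at_top. N t < exp (- 1)" using lim by (rule order_tendstoD) simp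
  hence "\<forall>\<^sub>F t in at_top. N t < exp (- 1) \<and> 0 < t"
    using eventually_gt_at_top[of 0] by (rule eventually_conj)
  then obtain t\<^sub>0 where t0: "N t\<^sub>0 < exp (- 1)" "0 < t\<^sub>0"
    using eventually_happens'[OF trivial_limit_at_top_linorder] by blast
  have "0 \<le> M" using nonneg[of 0] bounded[of 0] by simp
  have steps: "N (real n * t\<^sub>0 + r) \<le> exp (- real n) * M" if "0 \<le> r" for n r
  proof (induction n)
    case (Suc n)
    have "N (real (Suc n) * t\<^sub>0 + r) = N (t\<^sub>0 + (real n * t\<^sub>0 + r))" by (simp add: algebra_simps)
    also have "\<dots> \<le> N t\<^sub>0 * N (real n * t\<^sub>0 + r)" using that t0 by (intro submult) auto
    also have "\<dots> \<le> exp (- 1) * (exp (- real n) * M)"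
      using t0 that Suc.IH by (intro mult_mono nonneg) auto
    also have "\<dots> = exp (- real (Suc n)) * M" by (simp add: exp_add[symmetric] flip: mult.assoc)
    finally show ?case .
  qed (use bounded[OF that] in simp)
  have "N t \<le> (M * exp 1) * exp (- (1 / t\<^sub>0) * t)" if "0 \<le> t" for t
  proof -
    define n where "n = nat \<lfloor>t / t\<^sub>0\<rfloor>"
    have n: "real n \<le> t / t\<^sub>0" "t / t\<^sub>0 < real n + 1"
      using that t0 unfolding n_def by (auto simp: floor_less_iff of_nat_nat)
    have "N (real n * t\<^sub>0 + (t - real n * t\<^sub>0)) \<le> exp (- real n) * M"
      using n(1) t0 by (intro steps) (simp add: field_simps)
    also have "\<dots> \<le> exp (1 - t / t\<^sub>0) * M" using n(2) \<open>0 \<le> M\<close> by (intro mult_right_mono) auto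
    also have "\<dots> = (M * exp 1) * exp (- (1 / t\<^sub>0) * t)"
      by (simp add: exp_diff exp_minus field_simps)
    finally show ?thesis by simp
  qed
  thus ?thesis using t0 by (intro exI[of _ "M * exp 1"] exI[of _ "1 / t\<^sub>0"]) auto
qed

context gsf_resolvent
begin

lemma calc_rep_exists:
  assumes f: "f holomorphic_on rhp" and fin: "B0_norm f < \<infinity>" and "val_infty f = 0"
    and W: "weighted_B0_norm 1 f \<le> ennreal W" "0 \<le> W"
  shows "\<exists>T. calc_rep f T \<and> onorm T \<le> 2 / pi * (C * W)"
proof -
  obtain B where B: "bounded_linear B" "\<And>x \<phi>. \<phi> \<in> dual_space \<Longrightarrow> \<phi> (B x) = B_form f \<phi> x"
      "onorm B \<le> C * W"
    using B_form_operator_exists[OF f fin W] by blast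
  define T where "T = (\<lambda>x. (- (2 / pi)) *\<^sub>R B x)"
  have "bounded_linear T"
    unfolding T_def by (rule bounded_linear_compose[OF bounded_linear_scaleR_right B(1)])
  moreover have "\<phi> (T x) = val_infty f * \<phi> x - of_real (2 / pi) * B_form f \<phi> x"
    if \<phi>: "\<phi> \<in> dual_space" for \<phi> x
    unfolding T_def dual_scaleR[OF \<phi>] B(2)[OF \<phi>] \<open>val_infty f = 0\<close>
    by (simp add: scaleR_conv_of_real)
  ultimately have "calc_rep f T" by (simp add: calc_rep_def)
  moreover have "onorm T = 2 / pi * onorm B"
    unfolding T_def by (subst onorm_scaleR[OF B(1)]) simp
  hence "onorm T \<le> 2 / pi * (C * W)" using mult_left_mono[OF B(3), of "2 / pi"] by simp
  ultimately show ?thesis by blast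
qed

lemma calc_rep_dilate_exists:
  assumes f: "f holomorphic_on rhp" and fin: "B0_norm f < \<infinity>" and "val_infty f = 0" and "0 < t"
  shows "\<exists>T. calc_rep (\<lambda>z. f (of_real t * z)) T \<and> onorm T
      \<le> 2 / pi * (C * enn2real (weighted_B0_norm t f))"
proof (rule calc_rep_exists)
  show "B0_norm (\<lambda>z. f (of_real t * z)) < \<infinity>"
    using B0_norm_dilate_le[OF f \<open>0 < t\<close>] fin by (rule le_less_trans)
  have "weighted_B0_norm t f < \<infinity>"
    using weighted_B0_norm_le_B0_norm[OF less_imp_le[OF \<open>0 < t\<close>]] fin by (rule le_less_trans)
  thus "weighted_B0_norm 1 (\<lambda>z. f (of_real t * z)) \<le> ennreal (enn2real (weighted_B0_norm t f))"
    using weighted_B0_norm_dilate_le[OF f \<open>0 < t\<close>] by simp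
  show "val_infty (\<lambda>z. f (of_real t * z)) = 0"
    using val_infty_dilate[OF \<open>0 < t\<close>] \<open>val_infty f = 0\<close> by simp
qed (use holomorphic_dilate[OF f \<open>0 < t\<close>] in simp_all)

lemma calc_rep_dilate_tendsto_zero:
  assumes f: "f holomorphic_on rhp" and fin: "B0_norm f < \<infinity>" and "val_infty f = 0"
    and T: "\<And>t S. 0 < t \<Longrightarrow> calc_rep (\<lambda>z. f (of_real t * z)) S \<Longrightarrow> T t = S"
  shows "((\<lambda>t. onorm (T t)) \<longlongrightarrow> 0) at_top"
proof (rule Lim_null_comparison)
  show "\<forall>\<^sub>F t in at_top. norm (onorm (T t)) \<le> 2 / pi * (C * enn2real (weighted_B0_norm t f))"
    using eventually_gt_at_top[of 0]
  proof eventually_elim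
    case (elim t)
    obtain S where S: "calc_rep (\<lambda>z. f (of_real t * z)) S"
        "onorm S \<le> 2 / pi * (C * enn2real (weighted_B0_norm t f))"
      using calc_rep_dilate_exists[OF f fin \<open>val_infty f = 0\<close> elim] by blast
    thus ?case using T[OF elim S(1)] onorm_pos_le[OF calc_rep_bounded_linear[OF S(1)]] by simp
  qed
  have "((\<lambda>t. enn2real (weighted_B0_norm t f)) \<longlongrightarrow> 0) at_top"
    using weighted_B0_norm_tendsto_zero[OF f fin] by (intro tendsto_enn2real) auto
  hence "((\<lambda>t. 2 / pi * (C * enn2real (weighted_B0_norm t f))) \<longlongrightarrow> 2 / pi * (C * 0)) at_top"
    by (intro tendsto_mult_left)
  thus "((\<lambda>t. 2 / pi * (C * enn2real (weighted_B0_norm t f))) \<longlongrightarrow> 0) at_top" by simp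
qed

lemma calc_rep_one: "calc_rep (\<lambda>_. 1) (\<lambda>x. x)"
proof -
  have "val_infty (\<lambda>_. 1) = 1" by (rule val_infty_eqI) simp
  thus ?thesis unfolding calc_rep_def B_form_def by simp
qed

lemma calc_rep_exp_exists:
  assumes "0 \<le> t"
  shows "\<exists>T. calc_rep (exp_neg t) T \<and> onorm T \<le> max 1 (2 / pi * C)"
proof (cases "t = 0")
  case True
  thus ?thesis using calc_rep_one onorm_id_le[where 'a = 'a] by (intro exI[of _ "\<lambda>x. x"]) auto
next
  case False
  hence "0 < t" using assms by simp
  have fin: "B0_norm (exp_neg t) < \<infinity>"
    using B0_norm_exp_neg_le[OF \<open>0 < t\<close>] by (rule le_less_trans) simp
  have "weighted_B0_norm 1 (exp_neg t) \<le> ennreal 1"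
    using order.trans[OF weighted_B0_norm_le_B0_norm B0_norm_exp_neg_le[OF \<open>0 < t\<close>]] by simp
  from calc_rep_exists[OF _ fin val_infty_exp_neg[OF \<open>0 < t\<close>] this]
  have "\<exists>T. calc_rep (exp_neg t) T \<and> onorm T \<le> 2 / pi * C" by (simp add: holomorphic_intros)
  thus ?thesis by (auto intro: max.coboundedI2)
qed

lemma calc_rep_exp_decay:
  assumes T: "\<And>t S. 0 \<le> t \<Longrightarrow> calc_rep (exp_neg t) S \<Longrightarrow> T t = S"
    and lim: "((\<lambda>t. onorm (T t)) \<longlongrightarrow> 0) at_top"
  shows "\<exists>M \<omega>. \<omega> > 0 \<and> (\<forall>t\<ge>0. onorm (T t) \<le> M * exp (- \<omega> * t))"
proof -
  have rep: "calc_rep (exp_neg t) (T t)" and bounded: "onorm (T t) \<le> max 1 (2 / pi * C)"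
    if "0 \<le> t" for t
    using calc_rep_exp_exists[OF that] T[OF that] by auto
  have semigroup: "T (t + s) = T t \<circ> T s" if "0 \<le> t" "0 \<le> s" for t s
  proof (cases "t = 0 \<or> s = 0")
    case True
    moreover have "T 0 = (\<lambda>x. x)" using calc_rep_one by (intro T) auto
    ultimately show ?thesis by (auto simp: fun_eq_iff)
  next
    case False
    thus ?thesis
      using calc_rep_exp_semigroup[OF _ _ rep rep rep, of t s] that by (auto simp: fun_eq_iff)
  qed
  show ?thesis
  proof (rule exp_decay_of_submultiplicative[OF _ bounded _ lim])
    show "onorm (T (t + s)) \<le> onorm (T t) * onorm (T s)" if "0 \<le> t" "0 \<le> s" for t s
      unfolding semigroup[OF that] by (intro onorm_compose calc_rep_bounded_linear[OF rep] that)
  qed (use calc_rep_bounded_linear[OF rep] in \<open>auto intro: onorm_pos_le\<close>)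
qed

lemma B_calc_eqI:
  assumes "R = res_plus D A" and T: "calc_rep f T"
  shows "B_calc D A f = T"
proof -
  have "B_calc D A f = (THE T. calc_rep f T)"
    unfolding B_calc_def calc_rep_def B_form_def \<open>R = res_plus D A\<close>[symmetric] ..
  thus ?thesis using T calc_rep_unique by (simp add: the_equality)
qed

end

lemma exp_neg_in_B0_space: "(\<lambda>z. exp (- z)) \<in> B0_space"
proof -
  have "bounded ((\<lambda>z. exp (- z :: complex)) ` rhp)"
    by (rule boundedI[where B = 1]) (auto simp: rhp_def)
  moreover have "B0_norm (\<lambda>z. exp (- z)) < \<infinity>"
    using B0_norm_exp_neg_le[of 1] by (simp add: le_less_trans)
  moreover have "val_infty (\<lambda>z. exp (- z)) = 0" using val_infty_exp_neg[of 1] by simp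
  ultimately show ?thesis
    by (auto simp: B0_space_def B_space_def B0_norm_def deriv_sup_def intro!: holomorphic_intros)
qed

section \<open>The resolvent of an operator with spectrum in the right half-plane\<close>

lemma
  fixes D :: "'a::complex_banach set"
  assumes spec: "op_spectrum D A \<subseteq> {z. Re z \<ge> 0}" and z: "0 < Re z"
  shows res_plus_in_domain: "res_plus D A z y \<in> D"
    and res_plus_right_inverse: "cscale z (res_plus D A z y) + A (res_plus D A z y) = y"
    and res_plus_eqI: "x \<in> D \<Longrightarrow> cscale z x + A x = y \<Longrightarrow> res_plus D A z y = x"
    and bounded_linear_res_plus: "bounded_linear (res_plus D A z)"
proof -
  have "- z \<in> resolvent_set D A" using spec z by (auto simp: op_spectrum_def)
  hence resolvent: "\<And>y. \<exists>!x. x \<in> D \<and> cscale (- z) x - A x = y"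
      "bounded_linear (resolvent D A (- z))"
    by (auto simp: resolvent_set_def)
  have eq_iff: "cscale (- z) x - A x = - y \<longleftrightarrow> cscale z x + A x = y" for x y
  proof -
    have "cscale (- z) x - A x = - (cscale z x + A x)" by (simp add: cscale.minus_left)
    thus ?thesis by (simp only: neg_equal_iff_equal)
  qed
  have ex1: "\<exists>!x. x \<in> D \<and> cscale z x + A x = y" for y
    using resolvent(1)[of "- y"] unfolding eq_iff .
  show "res_plus D A z y \<in> D" "cscale z (res_plus D A z y) + A (res_plus D A z y) = y"
    using theI'[OF ex1] unfolding res_plus_def by auto
  show "res_plus D A z y = x" if "x \<in> D" "cscale z x + A x = y"
    unfolding res_plus_def by (rule the1_equality[OF ex1]) (use that in auto)
  have "res_plus D A z = (\<lambda>y. resolvent D A (- z) (- y))"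
    unfolding res_plus_def resolvent_def eq_iff ..
  thus "bounded_linear (res_plus D A z)"
    using bounded_linear_compose[OF resolvent(2) bounded_linear_minus[OF bounded_linear_ident]]
    by simp
qed

lemma resolvent_family_res_plus:
  fixes D :: "'a::complex_banach set"
  assumes lin: "lin_operator D A" and spec: "op_spectrum D A \<subseteq> {z. Re z \<ge> 0}"
  shows "resolvent_family (res_plus D A)"
proof (rule resolvent_family.intro)
  have D_add: "x + y \<in> D" "A (x + y) = A x + A y" if "x \<in> D" "y \<in> D" for x y
    using lin that unfolding lin_operator_def by blast+
  have D_cscale: "cscale c x \<in> D" "A (cscale c x) = cscale c (A x)" if "x \<in> D" for c x
    using lin that unfolding lin_operator_def by blast+
  note D_res = res_plus_in_domain[OF spec] and inverse = res_plus_right_inverse[OF spec]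
  fix z :: complex assume z: "0 < Re z"
  show "bounded_linear (res_plus D A z)" by (rule bounded_linear_res_plus[OF spec z])
  show "res_plus D A z (cscale c x) = cscale c (res_plus D A z x)" for c x
  proof (rule res_plus_eqI[OF spec z D_cscale(1)[OF D_res[OF z]]])
    have "cscale z (cscale c (res_plus D A z x)) + A (cscale c (res_plus D A z x)) =
        cscale c (cscale z (res_plus D A z x) + A (res_plus D A z x))"
      by (simp add: D_cscale[OF D_res[OF z]] cscale_add_right cscale_cscale mult.commute)
    thus "cscale z (cscale c (res_plus D A z x)) + A (cscale c (res_plus D A z x)) = cscale c x"
      unfolding inverse[OF z] .
  qed
  fix w :: complex and x assume w: "0 < Re w"
  let ?v = "res_plus D A w x" let ?u = "res_plus D A z ?v"
  note in_D = D_res[OF w, of x] D_res[OF z, of ?v]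
  have "res_plus D A z x = ?v + cscale (w - z) ?u"
  proof (rule res_plus_eqI[OF spec z])
    show "?v + cscale (w - z) ?u \<in> D" by (intro D_add D_cscale in_D)
    have "cscale z (?v + cscale (w - z) ?u) + A (?v + cscale (w - z) ?u)
        = cscale z ?v + A ?v + cscale (w - z) (cscale z ?u + A ?u)"
      by (simp add: D_add D_cscale in_D cscale_add_right cscale_cscale mult.commute)
    also have "cscale z ?u + A ?u = ?v" by (rule inverse[OF z])
    also have "cscale z ?v + A ?v + cscale (w - z) ?v = cscale w ?v + A ?v"
      by (simp add: cscale.diff_left)
    also have "\<dots> = x" by (rule inverse[OF w])
    finally show "cscale z (?v + cscale (w - z) ?u) + A (?v + cscale (w - z) ?u) = x" .
  qed
  thus "res_plus D A z x - ?v = cscale (w - z) ?u" by simp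
qed

lemma dense_range_res_plus:
  assumes spec: "op_spectrum D A \<subseteq> {z. Re z \<ge> 0}" and "0 < Re z" and "densely_defined D"
  shows "closure (range (res_plus D A z)) = UNIV"
proof -
  have "x \<in> range (res_plus D A z)" if "x \<in> D" for x
    using res_plus_eqI[OF spec \<open>0 < Re z\<close> that refl] by (metis rangeI)
  hence "closure D \<subseteq> closure (range (res_plus D A z))" by (intro closure_mono) blast
  thus ?thesis using \<open>densely_defined D\<close> by (auto simp: densely_defined_def)
qed

lemma (in resolvent_family) nn_integral_RR_le_of_gsf_seminorm_le:
  assumes "0 < \<alpha>" "0 \<le> B" and bound: "gsf_seminorm \<phi> x \<le> ennreal B"
  shows "(\<integral>\<^sup>+ \<beta>. ennreal (cmod (\<phi> (RR (Complex \<alpha> \<beta>) x))) \<partial>lborel)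
      \<le> ennreal (B / (\<alpha> + 1))" (is "?I \<le> _")
proof -
  have "ennreal (1 / (\<alpha> + 1)) * ennreal (\<alpha> + 1) = 1"
    using \<open>0 < \<alpha>\<close> by (subst ennreal_mult[symmetric]) auto
  hence "?I = ennreal (1 / (\<alpha> + 1)) * (ennreal (\<alpha> + 1) * ?I)" by (simp flip: mult.assoc)
  also have "ennreal (\<alpha> + 1) * ?I \<le> gsf_seminorm \<phi> x"
    unfolding gsf_seminorm_def using \<open>0 < \<alpha>\<close> by (intro SUP_upper) simp
  also note bound
  also have "ennreal (1 / (\<alpha> + 1)) * ennreal B = ennreal (B / (\<alpha> + 1))"
    using \<open>0 < \<alpha>\<close> \<open>0 \<le> B\<close> by (simp flip: ennreal_mult)
  finally show ?thesis by (simp add: mult_left_mono)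
qed

lemma exists_gsf_resolvent_res_plus:
  fixes D :: "'a::complex_banach set"
  assumes "lin_operator D A" "densely_defined D" and spec: "op_spectrum D A \<subseteq> {z. Re z \<ge> 0}"
    and gsf: "\<And>x \<phi>. \<phi> \<in> dual_space \<Longrightarrow> (SUP \<alpha>\<in>{0<..}. ennreal (\<alpha> + 1) *
      (\<integral>\<^sup>+ \<beta>. ennreal (cmod (\<phi> (res_plus D A (Complex \<alpha> \<beta>) (res_plus D A (Complex \<alpha> \<beta>) x))))
          \<partial>lborel)) < \<infinity>"
  shows "\<exists>C. gsf_resolvent (res_plus D A) C"
proof -
  interpret resolvent_family "res_plus D A"
    by (rule resolvent_family_res_plus[OF \<open>lin_operator D A\<close> spec])
  obtain C where C: "0 \<le> C"
      "\<And>\<phi> x. \<phi> \<in> dual_space \<Longrightarrow> gsf_seminorm \<phi> x \<le> ennreal (C * onorm \<phi> * norm x)"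
    using gsf_seminorm_bounded gsf unfolding gsf_seminorm_def by blast
  have "gsf_resolvent (res_plus D A) C"
    using C dense_range_res_plus[OF spec _ \<open>densely_defined D\<close>, of 1]
    by unfold_locales
      (auto intro!: nn_integral_RR_le_of_gsf_seminorm_le mult_nonneg_nonneg dual_onorm_nonneg)
  thus ?thesis ..
qed

theorem mainTheorem19:
  fixes D :: "'a::complex_banach set" and A :: "'a \<Rightarrow> 'a"
  assumes "lin_operator D A"
    and "densely_defined D"
    and "op_spectrum D A \<subseteq> {z. Re z \<ge> 0}"
    and "\<forall>x. \<forall>\<phi>\<in>dual_space.
           (SUP \<alpha>\<in>{0<..}. ennreal (\<alpha> + 1) *
              (\<integral>\<^sup>+ \<beta>. ennreal (cmod (\<phi> (res_plus D A (Complex \<alpha> \<beta>) (res_plus D A (Complex \<alpha> \<beta>) x)))) \<partial>lborel)) < \<infinity>"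
  shows "(\<forall>f\<in>B0_space. ((\<lambda>t. onorm (B_calc D A (\<lambda>z. f (of_real t * z)))) \<longlongrightarrow> 0) at_top)
       \<and> (\<exists>M \<omega>. \<omega> > 0 \<and> (\<forall>t\<ge>0. onorm (B_calc D A (\<lambda>z. exp (- (of_real t * z)))) \<le> M * exp (- \<omega> * t)))"
proof -
  obtain C where "gsf_resolvent (res_plus D A) C"
    using exists_gsf_resolvent_res_plus[OF assms(1-3)] assms(4) by blast
  then interpret gsf_resolvent "res_plus D A" C .
  have decay: "((\<lambda>t. onorm (B_calc D A (\<lambda>z. f (of_real t * z)))) \<longlongrightarrow> 0) at_top"
    if "f \<in> B0_space" for f
    using that by (intro calc_rep_dilate_tendsto_zero[of f] B_calc_eqI)
      (auto simp: B0_space_def B_space_def B0_norm_def deriv_sup_def)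
  have "\<exists>M \<omega>. \<omega> > 0 \<and> (\<forall>t\<ge>0. onorm (B_calc D A (exp_neg t)) \<le> M * exp (- \<omega> * t))"
    using decay[OF exp_neg_in_B0_space] by (intro calc_rep_exp_decay B_calc_eqI[OF refl])
  thus ?thesis using decay by blast
qed

end
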